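(* Let $n\ge2$ and let $\chi$ be a regular dominant character of $T$ lying in the root lattice. Then $$(\mathrm{Pet}_n)^{ss}_{G_0}(\mathcal L(\chi))=\bigsqcup_{\substack{J\subseteq I\subseteq S\\ \langle w_I(\chi),\lambda\rangle\ge0\\ \langle w_J(\chi),\lambda\rangle\le0}}Y^0_{I,J},$$ $$(\mathrm{Pet}_n)^{s}_{G_0}(\mathcal L(\chi))=\bigsqcup_{\substack{J\subseteq I\subseteq S\\ \langle w_I(\chi),\lambda\rangle>0\\ \langle w_J(\chi),\lambda\rangle<0}}Y^0_{I,J}.$$ Moreover, $$(\mathrm{Pet}_n)^{ps}_{G_0}(\mathcal L(\chi))=(\mathrm{Pet}_n)^{s}_{G_0}(\mathcal L(\chi))\sqcup\bigsqcup_{\substack{I\subseteq S\\ \langle w_I(\chi),\lambda\rangle=0}}\{p_I\}.$$ Equivalently, since $Y^0_{I,I}=\{p_I\}$, $$(\mathrm{Pet}_n)^{ps}_{G_0}(\mathcal L(\chi))=(\mathrm{Pet}_n)^{s}_{G_0}(\mathcal L(\chi))\sqcup\bigsqcup_{\substack{I\subseteq S\\ \langle w_I(\chi),\lambda\rangle=0}}Y^0_{I,I}.$$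
   Context: Let $G=\mathrm{GL}(n,\mathbb C)$, $B,B^-\subset G$ the upper and lower triangular matrices, $T$ the diagonal torus, $\epsilon_i$ the $i$-th coordinate character of $T$, and $S=\{\alpha_1,\ldots,\alpha_{n-1}\}$, $\alpha_i=\epsilon_i-\epsilon_{i+1}$, the simple roots. The Weyl group $W=S_n$ acts on characters by $w(\epsilon_i)=\epsilon_{w(i)}$. For $I\subseteq S$ let $W_I\subseteq W$ be generated by the simple reflections in $I$ and let $w_I$ be its longest element. Peterson variety: $N=\sum_{i=1}^{n-1}E_{i,i+1}$ and $\mathrm{Pet}_n=\{gB\in G/B : (g^{-1}Ng)_{ij}=0 \text{ for } i>j+1\}$, i.e. the closed subvariety of full flags $(V_i)$ in $\mathbb C^n$ with $NV_i\subseteq V_{i+1}$ for $1\le i\le n-1$. For $I,J\subseteq S$: $p_I=w_IB/B$ and $Y^0_{I,J}=(B^-w_JB/B)\cap(Bw_IB/B)\cap\mathrm{Pet}_n$. Torus action: $\lambda:\mathbb G_m\to T$, $\lambda(t)=\mathrm{diag}(t,t^2,\ldots,t^n)$; $G_0=\lambda(\mathbb G_m)$ acts on $\mathrm{Pet}_n$ by left multiplication. The pairing is $\langle\sum_i x_i\epsilon_i,\lambda\rangle=\sum_i i\,x_i$. Characters: the root lattice is $Q=\mathbb ZS$. A character $\sum x_i\epsilon_i\in Q$ (so $x_i\in\mathbb Z$, $\sum x_i=0$) is regular dominant if $x_1>\cdots>x_n$. Linearization: $\mathcal L(\chi)=G\times^B\mathbb C_{-\chi}$ on $G/B$ (so $H^0(G/B,\mathcal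 L(\chi))\simeq V(\chi)^*$ for dominant $\chi$, and $\mathcal L(\chi)$ is ample for regular dominant $\chi$), restricted to $\mathrm{Pet}_n$, with the $G_0$-linearization obtained by restricting the natural $G$-linearization. A point is semistable if some $G_0$-invariant section of a positive power of $\mathcal L(\chi)$ does not vanish at it; polystable if it is semistable and its $G_0$-orbit is closed in the semistable locus; stable if it is polystable and its stabilizer in $G_0$ is finite. The superscripts $ss$, $ps$, $s$ denote the semistable, polystable and stable loci. *)

theory Defs
  imports
    "Jordan_Normal_Form.Determinant"
    "HOL-Algebra.Left_Coset"
    "HOL-Algebra.Group_Action"
    "HOL-Algebra.Sym_Groups"
    "HOL-Library.Disjoint_Sets"
begin

text \<open>
  Convention: permutations and characters use the indices \<open>1,\<dots>,n\<close>, while the entries of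
  a matrix are numbered from \<open>0\<close>, so that the usual entry \<open>(i, j)\<close> is
  \<open>g $$ (i - 1, j - 1)\<close>.
\<close>

section \<open>The group and its flag variety\<close>

definition GLn :: "nat \<Rightarrow> complex mat monoid" where
  "GLn n = units_of (ring_mat TYPE(complex) n ())"

definition Borel :: "nat \<Rightarrow> complex mat set" where
  "Borel n = {b \<in> carrier (GLn n). upper_triangular b}"

definition Borel_opp :: "nat \<Rightarrow> complex mat set" where
  "Borel_opp n = {b \<in> carrier (GLn n). upper_triangular (transpose_mat b)}"

definition flag_point :: "nat \<Rightarrow> complex mat \<Rightarrow> complex mat set" where
  "flag_point n g = g <#\<^bsub>GLn n\<^esub> Borel n"

definition flag_variety :: "nat \<Rightarrow> complex mat set set" where
  "flag_variety n = lcosets\<^bsub>GLn n\<^esub> (Borel n)"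

text \<open>The coordinate ring of \<open>GL\<^sub>n\<close> is generated by the matrix entries and the inverse of the
  determinant.\<close>

inductive_set regular_functions :: "nat \<Rightarrow> (complex mat \<Rightarrow> complex) set" for n :: nat where
  const: "(\<lambda>g. c) \<in> regular_functions n"
| entry: "i < n \<Longrightarrow> j < n \<Longrightarrow> (\<lambda>g. g $$ (i, j)) \<in> regular_functions n"
| inverse_det: "(\<lambda>g. inverse (det g)) \<in> regular_functions n"
| add: "f \<in> regular_functions n \<Longrightarrow> h \<in> regular_functions n \<Longrightarrow> (\<lambda>g. f g + h g) \<in> regular_functions n"
| mult: "f \<in> regular_functions n \<Longrightarrow> h \<in> regular_functions n \<Longrightarrow> (\<lambda>g. f g * h g) \<in> regular_functions n"

definition zariski_closed_GL :: "nat \<Rightarrow> complex mat set \<Rightarrow> bool" where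
  "zariski_closed_GL n Z \<longleftrightarrow>
     (\<exists>F \<subseteq> regular_functions n. Z = {g \<in> carrier (GLn n). \<forall>f\<in>F. f g = 0})"

text \<open>The Zariski topology of \<open>G/B\<close> is the quotient topology.\<close>

definition zariski_closed_flag :: "nat \<Rightarrow> complex mat set set \<Rightarrow> bool" where
  "zariski_closed_flag n Z \<longleftrightarrow>
     Z \<subseteq> flag_variety n \<and> zariski_closed_GL n {g \<in> carrier (GLn n). flag_point n g \<in> Z}"

section \<open>The Peterson variety\<close>

definition nilp :: "nat \<Rightarrow> complex mat" where
  "nilp n = mat n n (\<lambda>(i, j). if j = Suc i then 1 else 0)"

definition Pet :: "nat \<Rightarrow> complex mat set set" where
  "Pet n = {flag_point n g | g. g \<in> carrier (GLn n) \<and>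
     (\<forall>i<n. \<forall>j<n. i > j + 1 \<longrightarrow> (inv\<^bsub>GLn n\<^esub> g * nilp n * g) $$ (i, j) = 0)}"

section \<open>Characters, roots and the Weyl group\<close>

text \<open>The function \<open>\<chi>\<close> stands for the character \<open>\<Sum>\<^sub>i \<chi> i \<epsilon>\<^sub>i\<close>.\<close>

definition coord_char :: "nat \<Rightarrow> nat \<Rightarrow> int" where
  "coord_char i = (\<lambda>k. if k = i then 1 else 0)"

definition simple_root :: "nat \<Rightarrow> nat \<Rightarrow> int" where
  "simple_root i = (\<lambda>k. coord_char i k - coord_char (Suc i) k)"

definition simple_roots :: "nat \<Rightarrow> (nat \<Rightarrow> int) set" where
  "simple_roots n = simple_root ` {1..<n}"

definition root_lattice :: "nat \<Rightarrow> (nat \<Rightarrow> int) set" where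
  "root_lattice n = {(\<lambda>k. \<Sum>\<alpha>\<in>simple_roots n. c \<alpha> * \<alpha> k) | c :: (nat \<Rightarrow> int) \<Rightarrow> int. True}"

definition regular_dominant :: "nat \<Rightarrow> (nat \<Rightarrow> int) \<Rightarrow> bool" where
  "regular_dominant n \<chi> \<longleftrightarrow> (\<forall>i j. 1 \<le> i \<and> i < j \<and> j \<le> n \<longrightarrow> \<chi> i > \<chi> j)"

definition simple_reflections :: "nat \<Rightarrow> (nat \<Rightarrow> int) set \<Rightarrow> (nat \<Rightarrow> nat) set" where
  "simple_reflections n I = {transpose i (Suc i) | i. i \<in> {1..<n} \<and> simple_root i \<in> I}"

definition parabolic_subgroup :: "nat \<Rightarrow> (nat \<Rightarrow> int) set \<Rightarrow> (nat \<Rightarrow> nat) set" where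
  "parabolic_subgroup n I = generate (sym_group n) (simple_reflections n I)"

definition weyl_length :: "nat \<Rightarrow> (nat \<Rightarrow> nat) \<Rightarrow> nat" where
  "weyl_length n w = (LEAST k. \<exists>ws. length ws = k \<and>
     set ws \<subseteq> simple_reflections n (simple_roots n) \<and> foldr (\<circ>) ws id = w)"

definition longest :: "nat \<Rightarrow> (nat \<Rightarrow> int) set \<Rightarrow> (nat \<Rightarrow> nat)" where
  "longest n I = (ARG_MAX (weyl_length n) w. w \<in> parabolic_subgroup n I)"

text \<open>The linear extension of \<open>\<epsilon>\<^sub>i \<mapsto> \<epsilon>\<^bsub>w(i)\<^esub>\<close>.\<close>

definition weyl_act :: "nat \<Rightarrow> (nat \<Rightarrow> nat) \<Rightarrow> (nat \<Rightarrow> int) \<Rightarrow> (nat \<Rightarrow> int)" where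
  "weyl_act n w \<chi> = (\<lambda>k. \<Sum>i = 1..n. \<chi> i * coord_char (w i) k)"

definition pairing :: "nat \<Rightarrow> (nat \<Rightarrow> int) \<Rightarrow> int" where
  "pairing n \<chi> = (\<Sum>i = 1..n. int i * \<chi> i)"

text \<open>The representative of \<open>w\<close> in \<open>GL\<^sub>n\<close> with \<open>e\<^sub>j \<mapsto> e\<^bsub>w(j)\<^esub>\<close>.\<close>

definition perm_mat :: "nat \<Rightarrow> (nat \<Rightarrow> nat) \<Rightarrow> complex mat" where
  "perm_mat n w = mat n n (\<lambda>(i, j). if Suc i = w (Suc j) then 1 else 0)"

definition fixed_point :: "nat \<Rightarrow> (nat \<Rightarrow> int) set \<Rightarrow> complex mat set" where
  "fixed_point n I = flag_point n (perm_mat n (longest n I))"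

definition cell :: "nat \<Rightarrow> complex mat set \<Rightarrow> (nat \<Rightarrow> nat) \<Rightarrow> complex mat set set" where
  "cell n H w = {flag_point n (h * perm_mat n w) | h. h \<in> H}"

definition Y0 :: "nat \<Rightarrow> (nat \<Rightarrow> int) set \<Rightarrow> (nat \<Rightarrow> int) set \<Rightarrow> complex mat set set" where
  "Y0 n I J = cell n (Borel_opp n) (longest n J) \<inter> cell n (Borel n) (longest n I) \<inter> Pet n"

section \<open>The torus action\<close>

definition cochar :: "nat \<Rightarrow> complex \<Rightarrow> complex mat" where
  "cochar n t = mat_diag n (\<lambda>i. t ^ Suc i)"

definition G0 :: "nat \<Rightarrow> complex mat monoid" where
  "G0 n = (GLn n)\<lparr>carrier := cochar n ` (UNIV - {0})\<rparr>"

definition flag_act :: "nat \<Rightarrow> complex mat \<Rightarrow> complex mat set \<Rightarrow> complex mat set" where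
  "flag_act n h x = h <#\<^bsub>GLn n\<^esub> x"

section \<open>The linearized line bundle and its sections\<close>

definition char_val :: "nat \<Rightarrow> (nat \<Rightarrow> int) \<Rightarrow> complex mat \<Rightarrow> complex" where
  "char_val n \<chi> b = (\<Prod>i<n. (b $$ (i, i)) powi \<chi> (Suc i))"

text \<open>The class \<open>[g, v]\<close> in \<open>G \<times>\<^sup>B \<complex>\<^bsub>-\<chi>\<^esub>\<close>, i.e. the orbit of
  \<open>(g, v)\<close> under \<open>b \<cdot> (g, v) = (g b\<inverse>, (-\<chi>)(b) v)\<close>.\<close>

definition bundle_point ::
    "nat \<Rightarrow> (nat \<Rightarrow> int) \<Rightarrow> complex mat \<Rightarrow> complex \<Rightarrow> (complex mat \<times> complex) set" where
  "bundle_point n \<chi> g v =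
     {(g * inv\<^bsub>GLn n\<^esub> b, char_val n (\<lambda>i. - \<chi> i) b * v) | b. b \<in> Borel n}"

definition bundle_act ::
    "nat \<Rightarrow> complex mat \<Rightarrow> (complex mat \<times> complex) set \<Rightarrow> (complex mat \<times> complex) set" where
  "bundle_act n h p = (\<lambda>(g, v). (h * g, v)) ` p"

text \<open>
  A section \<open>s\<close> over \<open>Pet\<^sub>n\<close> has the form \<open>s(gB) = [g, f(g)]\<close>, and it is regular iff
  \<open>f\<close> is a regular function on the preimage of \<open>Pet\<^sub>n\<close> in \<open>GL\<^sub>n\<close>. This preimage is closed in the
  affine variety \<open>GL\<^sub>n\<close>, so its regular functions are the restrictions of those on \<open>GL\<^sub>n\<close>.
  That \<open>f\<close> is \<open>B\<close>-equivariant on the preimage follows from \<open>s\<close> being well defined. Only the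
  values of \<open>s\<close> on \<open>Pet\<^sub>n\<close> are relevant.
\<close>

definition is_section ::
    "nat \<Rightarrow> (nat \<Rightarrow> int) \<Rightarrow> (complex mat set \<Rightarrow> (complex mat \<times> complex) set) \<Rightarrow> bool" where
  "is_section n \<chi> s \<longleftrightarrow> (\<exists>f\<in>regular_functions n. \<forall>g\<in>carrier (GLn n).
     flag_point n g \<in> Pet n \<longrightarrow> s (flag_point n g) = bundle_point n \<chi> g (f g))"

definition is_invariant_section ::
    "nat \<Rightarrow> (nat \<Rightarrow> int) \<Rightarrow> (complex mat set \<Rightarrow> (complex mat \<times> complex) set) \<Rightarrow> bool" where
  "is_invariant_section n \<chi> s \<longleftrightarrow> is_section n \<chi> s \<and>
     (\<forall>h\<in>carrier (G0 n). \<forall>x\<in>Pet n. s (flag_act n h x) = bundle_act n h (s x))"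

definition vanishes_at ::
    "nat \<Rightarrow> (nat \<Rightarrow> int) \<Rightarrow> (complex mat set \<Rightarrow> (complex mat \<times> complex) set) \<Rightarrow> complex mat set \<Rightarrow> bool"
  where
  "vanishes_at n \<chi> s x \<longleftrightarrow> (\<exists>g\<in>x. s x = bundle_point n \<chi> g 0)"

section \<open>Semistability\<close>

text \<open>The power \<open>\<L>(\<chi>)\<^sup>m\<close> is \<open>G \<times>\<^sup>B (\<complex>\<^bsub>-\<chi>\<^esub>)\<^sup>m = \<L>(m\<chi>)\<close> as a
  linearized line bundle.\<close>

definition semistable_locus :: "nat \<Rightarrow> (nat \<Rightarrow> int) \<Rightarrow> complex mat set set" where
  "semistable_locus n \<chi> = {x \<in> Pet n. \<exists>m::nat. m > 0 \<and>
     (\<exists>s. is_invariant_section n (\<lambda>i. int m * \<chi> i) s \<and>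
          \<not> vanishes_at n (\<lambda>i. int m * \<chi> i) s x)}"

definition polystable_locus :: "nat \<Rightarrow> (nat \<Rightarrow> int) \<Rightarrow> complex mat set set" where
  "polystable_locus n \<chi> = {x \<in> semistable_locus n \<chi>. \<exists>Z. zariski_closed_flag n Z \<and>
     orbit (G0 n) (flag_act n) x = Z \<inter> semistable_locus n \<chi>}"

definition stable_locus :: "nat \<Rightarrow> (nat \<Rightarrow> int) \<Rightarrow> complex mat set set" where
  "stable_locus n \<chi> = {x \<in> polystable_locus n \<chi>. finite (stabilizer (G0 n) (flag_act n) x)}"

end

theory Submission
  imports Defs
begin

text \<open>  The Hilbert-Mumford criterion for the one-parameter group \<open>\<lambda>(t) = diag(t, t\<^sup>2, ...)\<close> is verified here
  by hand, with the Bruhat decompositions for upper and for lower triangular matrices as the only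
  structure theory.

  Every flag \<open>gB\<close> lies in one cell \<open>B w B/B\<close> and in one cell \<open>B\<^sup>- w' B/B\<close>; the limits of \<open>\<lambda>(t) gB\<close> for
  \<open>t\<close> tending to infinity and to \<open>0\<close> are the fixed points \<open>wB\<close> and \<open>w'B\<close>. If the flag belongs to the
  Peterson variety, then \<open>i \<le> j + 1\<close> whenever \<open>w j = w i + 1\<close>, and likewise for \<open>w'\<close>
  (\<open>hessenberg_cell\<close>). The permutations with this property are exactly the longest elements of the
  parabolic subgroups (\<open>hessenberg_perm_longest\<close>). Moreover \<open>w'\<close> preserves every initial segment that
  \<open>w\<close> preserves, so the Peterson variety is the disjoint union of the strata \<open>Y0 n I J\<close> with
  \<open>J \<subseteq> I\<close> (\<open>Pet_stratification\<close>, \<open>Y0_disjoint\<close>), and \<open>Y0 n I I\<close> is a fixed point (\<open>Y0_diagonal\<close>).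

  An invariant section of a power of the line bundle is a function \<open>f\<close> on \<open>GL\<^sub>n\<close> that is semi-invariant
  under \<open>B\<close> and invariant under \<open>\<lambda>\<close> (\<open>semistable_iff\<close>). For each \<open>w\<close> the product of the flag
  minors with rows \<open>w 1, ..., w k\<close> is semi-invariant of weight \<open>\<langle>w \<chi>, \<lambda>\<rangle>\<close>, and it vanishes nowhere on the
  two cells of \<open>w\<close>. On the stratum of \<open>I\<close> and \<open>J\<close>, therefore, the products for \<open>w\<^sub>I\<close> and \<open>w\<^sub>J\<close> combine to
  a nonvanishing invariant as soon as \<open>\<langle>w\<^sub>J \<chi>, \<lambda>\<rangle> \<le> 0 \<le> \<langle>w\<^sub>I \<chi>, \<lambda>\<rangle>\<close>. Conversely, with respect to a
  trivialization that extends to the limit, an invariant of degree \<open>m\<close> varies along the orbit like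
  the power of \<open>t\<close> with exponent \<open>- m \<langle>w \<chi>, \<lambda>\<rangle>\<close>, and its continuity at the limit excludes the wrong
  signs (\<open>semistable_Y0_iff\<close>).

  If one of the two weights is \<open>0\<close>, the corresponding limit is semistable and lies in the closure of
  the orbit, so the orbit is closed only if it consists of this fixed point (\<open>polystable_limit\<close>). If
  both weights are nonzero, let \<open>h\<close> represent a semistable point in the closure of the orbit of \<open>gB\<close>.
  Semi-invariants of equal degree and weight are proportional on the orbit, hence also at \<open>h\<close>. This
  shows first that both extremal products are nonzero at \<open>h\<close> (\<open>nonvanishing_on_closure\<close>), and then
  that a single \<open>t\<close> accounts, up to a common factor, for the ratios between the values at \<open>h\<close> and
  at \<open>g\<close> of all semi-invariants of degree \<open>1\<close> (\<open>closure_point_scaling\<close>). Quotients of minors are coordinates near the fixed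
  point (\<open>flag_point_eq_of_coordinates\<close>), so \<open>hB = \<lambda>(t) gB\<close> and the orbit is closed in the
  semistable locus (\<open>strictly_between_polystable\<close>). Its stabilizer is finite, because
  an element \<open>\<lambda>(t)\<close> of it satisfies \<open>t\<^sup>a = t\<^sup>b\<close> for the two distinct weights \<open>a\<close> and \<open>b\<close>.\<close>

section \<open>Longest elements of parabolic subgroups\<close>

text \<open>Membership of \<open>k\<close> in \<open>A\<close> means that \<open>k\<close> and \<open>k + 1\<close> belong to the same block of \<open>{1..n}\<close>; the second
  and third conditions say that \<open>w\<close> preserves every block and reverses it, without mentioning the blocks.\<close>

definition is_block_reversal :: "nat \<Rightarrow> nat set \<Rightarrow> (nat \<Rightarrow> nat) \<Rightarrow> bool" where
  "is_block_reversal n A w \<longleftrightarrow> w permutes {1..n} \<and>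
     (\<forall>k\<le>n. k \<notin> A \<longrightarrow> w ` {1..k} = {1..k}) \<and> (\<forall>i\<in>A. w (Suc i) < w i)"

definition inversions :: "nat \<Rightarrow> (nat \<Rightarrow> nat) \<Rightarrow> (nat \<times> nat) set" where
  "inversions n w = {(a, b). 1 \<le> a \<and> a < b \<and> b \<le> n \<and> w b < w a}"

lemma finite_inversions: "finite (inversions n w)"
  by (rule finite_subset[of _ "{1..n} \<times> {1..n}"]) (auto simp: inversions_def)

lemma inversions_id: "inversions n id = {}"
  by (auto simp: inversions_def)

text \<open>The transposition carries the inversions of \<open>w\<close> to inversions of the composition, and
  \<open>(i, i + 1)\<close> is the only new one.\<close>

lemma card_inversions_ascent:
  assumes w: "w permutes {1..n}" and i: "1 \<le> i" "i < n" and asc: "w i < w (Suc i)"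
  shows "card (inversions n (w \<circ> transpose i (Suc i))) = Suc (card (inversions n w))"
proof -
  let ?s = "transpose i (Suc i)"
  let ?f = "\<lambda>(a, b). (?s a, ?s b)"
  have inj: "inj ?f"
    by (rule injI) (auto dest: injD[OF inj_transpose])
  have s: "?s a = (if a = i then Suc i else if a = Suc i then i else a)" for a
    by (simp add: transpose_def)
  have "inversions n (w \<circ> ?s) = insert (i, Suc i) (?f ` inversions n w)"
  proof (rule Set.set_eqI, rule iffI)
    fix p assume p: "p \<in> inversions n (w \<circ> ?s)"
    obtain a b where ab: "p = (a, b)" by force
    have *: "1 \<le> a" "a < b" "b \<le> n" "w (?s b) < w (?s a)"
      using p by (auto simp: ab inversions_def)
    show "p \<in> insert (i, Suc i) (?f ` inversions n w)"
    proof (cases "a = i \<and> b = Suc i")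
      case False
      have "(?s a, ?s b) \<in> inversions n w"
        using * False i by (auto simp: inversions_def s split: if_splits)
      moreover have "p = ?f (?s a, ?s b)" by (simp add: ab)
      ultimately show ?thesis by blast
    qed (simp add: ab)
  next
    fix p assume "p \<in> insert (i, Suc i) (?f ` inversions n w)"
    then show "p \<in> inversions n (w \<circ> ?s)"
      using asc i by (auto simp: inversions_def s split: if_splits)
  qed
  moreover have "(i, Suc i) \<notin> ?f ` inversions n w"
    using asc by (auto simp: inversions_def s split: if_splits)
  ultimately show ?thesis
    by (simp add: finite_inversions card_image inj_on_subset[OF inj])
qed

lemma card_inversions_descent:
  assumes w: "w permutes {1..n}" and i: "1 \<le> i" "i < n" and desc: "w (Suc i) < w i"
  shows "card (inversions n w) = Suc (card (inversions n (w \<circ> transpose i (Suc i))))"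
proof -
  let ?s = "transpose i (Suc i)"
  have "?s permutes {1..n}" using i by (intro permutes_swap_id) auto
  then have "w \<circ> ?s permutes {1..n}" using w by (rule permutes_compose)
  moreover have "(w \<circ> ?s) i < (w \<circ> ?s) (Suc i)" using desc by simp
  ultimately show ?thesis
    using card_inversions_ascent[of "w \<circ> ?s" n i] i by (simp add: comp_assoc)
qed

lemma simple_root_inj: "simple_root i = simple_root j \<longleftrightarrow> i = j"
proof
  assume eq: "simple_root i = simple_root j"
  have "simple_root i i = simple_root j i" "simple_root i (Suc i) = simple_root j (Suc i)"
    using eq by auto
  then show "i = j"
    by (auto simp: simple_root_def coord_char_def split: if_splits)
qed simp

lemma simple_reflections_all:
  "simple_reflections n (simple_roots n) = {transpose i (Suc i) | i. i \<in> {1..<n}}"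
  by (auto simp: simple_reflections_def simple_roots_def)

lemma foldr_comp: "foldr (\<circ>) ws f = foldr (\<circ>) ws id \<circ> (f :: 'a \<Rightarrow> 'a)"
  by (induction ws) (auto simp: comp_assoc)

lemma reflection_word_permutes:
  assumes "set ws \<subseteq> simple_reflections n (simple_roots n)"
  shows "foldr (\<circ>) ws id permutes {1..n}"
  using assms
proof (induction ws)
  case (Cons s ws)
  then have "s permutes {1..n}"
    by (auto simp: simple_reflections_all intro!: permutes_swap_id)
  moreover have "foldr (\<circ>) ws id permutes {1..n}"
    by (rule Cons.IH) (use Cons.prems in simp)
  moreover have "foldr (\<circ>) (s # ws) id = s \<circ> foldr (\<circ>) ws id" by simp
  ultimately show ?case by (metis permutes_compose)
qed (simp add: permutes_id)

lemma card_inversions_le_word: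
  assumes "set ws \<subseteq> simple_reflections n (simple_roots n)"
  shows "card (inversions n (foldr (\<circ>) ws id)) \<le> length ws"
  using assms
proof (induction ws rule: rev_induct)
  case (snoc s ws)
  let ?w = "foldr (\<circ>) ws id"
  obtain i where i: "s = transpose i (Suc i)" "1 \<le> i" "i < n"
    using snoc.prems by (auto simp: simple_reflections_all)
  have w: "?w permutes {1..n}" using snoc.prems by (intro reflection_word_permutes) auto
  have eq: "foldr (\<circ>) (ws @ [s]) id = ?w \<circ> s" by (simp add: foldr_comp[of ws s])
  have "?w i \<noteq> ?w (Suc i)" using permutes_inj[OF w] by (metis injD n_not_Suc_n)
  then have "card (inversions n (?w \<circ> s)) \<le> Suc (card (inversions n ?w))"
    using card_inversions_ascent[OF w i(2,3)] card_inversions_descent[OF w i(2,3)]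
    by (cases "?w i < ?w (Suc i)") (auto simp: i(1))
  moreover have "card (inversions n ?w) \<le> length ws"
    by (rule snoc.IH) (use snoc.prems in simp)
  ultimately show ?case unfolding eq length_append by (auto simp del: o_apply)
qed (simp add: inversions_id)

text \<open>A permutation without descents is increasing, so \<open>i \<le> w i\<close> for all \<open>i\<close>; as both sides have the
  same sum, it is the identity.\<close>

lemma exists_descent:
  assumes w: "w permutes {1..n}" and "w \<noteq> id"
  obtains i where "1 \<le> i" "i < n" "w (Suc i) < w i"
proof (rule ccontr)
  assume "\<not> thesis"
  with that have "\<not> w (Suc i) < w i" if "1 \<le> i" "i < n" for i using that by blast
  moreover have "w i \<noteq> w (Suc i)" for i using permutes_inj[OF w] by (metis injD n_not_Suc_n)
  ultimately have inc: "w i < w (Suc i)" if "1 \<le> i" "i < n" for i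
    using that by (meson linorder_neqE_nat)
  have ge: "i \<le> n \<Longrightarrow> i \<le> w i" for i
  proof (induction i)
    case (Suc i)
    show ?case
    proof (cases "i = 0")
      case True
      then show ?thesis using permutes_in_image[OF w, of "Suc i"] Suc.prems by auto
    next
      case False
      then show ?thesis using Suc inc[of i] by auto
    qed
  qed simp
  have "w i = i" if "i \<in> {1..n}" for i
  proof (rule ccontr)
    assume "w i \<noteq> i"
    then have "(\<Sum>i=1..n. i) < (\<Sum>i=1..n. w i)"
      using that ge[of i] by (intro sum_strict_mono_ex1 bexI[of _ i] ballI ge) auto
    also have "\<dots> = (\<Sum>i=1..n. i)"
      using sum.permute[OF w, of "\<lambda>i. i"] by (simp add: comp_def)
    finally show False by simp
  qed
  then have "w = id" using w by (auto simp: fun_eq_iff permutes_def)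
  with \<open>w \<noteq> id\<close> show False ..
qed

text \<open>Sorting \<open>w\<close> by adjacent transpositions at descents removes one inversion at a time.\<close>

lemma exists_word_card_inversions:
  assumes "w permutes {1..n}"
  shows "\<exists>ws. length ws = card (inversions n w) \<and>
     set ws \<subseteq> simple_reflections n (simple_roots n) \<and> foldr (\<circ>) ws id = w"
  using assms
proof (induction "card (inversions n w)" arbitrary: w rule: less_induct)
  case less
  show ?case
  proof (cases "w = id")
    case True
    then show ?thesis by (intro exI[of _ "[]"]) (auto simp: inversions_id)
  next
    case False
    obtain i where i: "1 \<le> i" "i < n" "w (Suc i) < w i"
      using exists_descent[OF less.prems False] by blast
    let ?s = "transpose i (Suc i)"
    note card = card_inversions_descent[OF less.prems i]
    have "?s permutes {1..n}" using i by (intro permutes_swap_id) auto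
    then have p: "w \<circ> ?s permutes {1..n}" using less.prems by (rule permutes_compose)
    obtain ws where ws: "length ws = card (inversions n (w \<circ> ?s))"
      "set ws \<subseteq> simple_reflections n (simple_roots n)" "foldr (\<circ>) ws id = w \<circ> ?s"
      using less.hyps[OF _ p] card by auto
    have "foldr (\<circ>) (ws @ [?s]) id = w"
      by (simp add: foldr_comp[of ws ?s] ws(3) comp_assoc)
    then show ?thesis using ws i card
      by (intro exI[of _ "ws @ [?s]"]) (auto simp: simple_reflections_all)
  qed
qed

lemma weyl_length_eq_card_inversions:
  assumes "w permutes {1..n}"
  shows "weyl_length n w = card (inversions n w)"
  unfolding weyl_length_def
  by (rule Least_equality) (use exists_word_card_inversions[OF assms] card_inversions_le_word in auto)

text \<open>The only initial segment that the transposition of \<open>i\<close> and \<open>i + 1\<close> does not preserve is \<open>{1..i}\<close>.\<close>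

lemma parabolic_subgroup_permutes:
  assumes "w \<in> parabolic_subgroup n I"
  shows "w permutes {1..n}"
    and "k \<le> n \<Longrightarrow> simple_root k \<notin> I \<Longrightarrow> w ` {1..k} = {1..k}"
proof -
  have *: "s permutes {1..n} \<and> s ` {1..k} = {1..k} \<and> inv\<^bsub>sym_group n\<^esub> s = s"
    if s: "s \<in> simple_reflections n I" and k: "simple_root k \<notin> I" for s k
  proof -
    obtain i where i: "s = transpose i (Suc i)" "1 \<le> i" "i < n" "simple_root i \<in> I"
      using s by (auto simp: simple_reflections_def)
    have p: "s permutes {1..n}" unfolding i(1) using i by (intro permutes_swap_id) auto
    have "i \<noteq> k" using i k by auto
    then have "s permutes {1..k} \<or> (\<forall>a\<in>{1..k}. s a = a)"
      unfolding i(1) using i by (cases "Suc i \<le> k") (auto simp: transpose_def intro!: permutes_swap_id)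
    then have "s ` {1..k} = {1..k}" by (auto dest: permutes_image)
    moreover have "inv\<^bsub>sym_group n\<^esub> s = s"
      using p by (simp add: sym_group_carrier i(1))
    ultimately show ?thesis using p by simp
  qed
  show p: "w permutes {1..n}"
    using assms unfolding parabolic_subgroup_def
  proof (induction rule: generate.induct)
    case (incl h)
    then show ?case by (auto simp: simple_reflections_def intro!: permutes_swap_id)
  next
    case (inv h)
    then have "h permutes {1..n}" by (auto simp: simple_reflections_def intro!: permutes_swap_id)
    then show ?case by (simp add: sym_group_carrier permutes_inv)
  next
    case (eng h1 h2)
    then show ?case unfolding sym_group_mult by (intro permutes_compose)
  qed (simp only: sym_group_one permutes_id)
  show "w ` {1..k} = {1..k}" if "k \<le> n" and k: "simple_root k \<notin> I"
    using assms unfolding parabolic_subgroup_def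
  proof (induction rule: generate.induct)
    case (eng h1 h2)
    then show ?case by (metis image_comp sym_group_mult)
  qed (use *[OF _ k] in \<open>auto simp: sym_group_one\<close>)
qed

lemma longest_in_parabolic_subgroup: "longest n I \<in> parabolic_subgroup n I"
  and weyl_length_le_longest:
    "w \<in> parabolic_subgroup n I \<Longrightarrow> weyl_length n w \<le> weyl_length n (longest n I)"
proof -
  have one: "id \<in> parabolic_subgroup n I"
    unfolding parabolic_subgroup_def by (metis generate.one sym_group_one)
  have bound: "\<forall>w. w \<in> parabolic_subgroup n I \<longrightarrow> weyl_length n w < Suc (n * n)"
  proof (intro allI impI)
    fix w assume "w \<in> parabolic_subgroup n I"
    then have "weyl_length n w = card (inversions n w)"
      by (intro weyl_length_eq_card_inversions parabolic_subgroup_permutes)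
    also have "\<dots> \<le> card ({1..n} \<times> {1..n})"
      by (rule card_mono) (auto simp: inversions_def)
    finally show "weyl_length n w < Suc (n * n)" by simp
  qed
  show "longest n I \<in> parabolic_subgroup n I"
    unfolding longest_def by (rule arg_max_natI[OF one bound])
  show "w \<in> parabolic_subgroup n I \<Longrightarrow> weyl_length n w \<le> weyl_length n (longest n I)"
    unfolding longest_def by (rule arg_max_nat_le[OF _ bound])
qed

definition root_indices :: "nat \<Rightarrow> (nat \<Rightarrow> int) set \<Rightarrow> nat set" where
  "root_indices n I = {i \<in> {1..<n}. simple_root i \<in> I}"

lemma root_indices_mono_iff:
  assumes "I \<subseteq> simple_roots n"
  shows "root_indices n I \<subseteq> root_indices n J \<longleftrightarrow> I \<subseteq> J"
  using assms by (fastforce simp: root_indices_def simple_roots_def)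

text \<open>At an ascent \<open>i\<close> with \<open>\<alpha>\<^sub>i\<close> in \<open>I\<close>, multiplication by the reflection in \<open>\<alpha>\<^sub>i\<close> would give a longer
  element of the parabolic subgroup.\<close>

lemma is_block_reversal_longest:
  assumes I: "I \<subseteq> simple_roots n"
  shows "is_block_reversal n (root_indices n I) (longest n I)"
proof -
  let ?w = "longest n I"
  note mem = longest_in_parabolic_subgroup[of n I]
  note perm = parabolic_subgroup_permutes(1)[OF mem]
  have "?w ` {1..k} = {1..k}" if "k \<le> n" "k \<notin> root_indices n I" for k
  proof (cases "k = 0 \<or> k = n")
    case True
    then show ?thesis using permutes_image[OF perm] by auto
  next
    case False
    then show ?thesis
      using parabolic_subgroup_permutes(2)[OF mem that(1)] that by (auto simp: root_indices_def)
  qed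
  moreover have "?w (Suc i) < ?w i" if "i \<in> root_indices n I" for i
  proof (rule ccontr)
    assume "\<not> ?w (Suc i) < ?w i"
    moreover have "?w i \<noteq> ?w (Suc i)" using permutes_inj[OF perm] by (metis injD n_not_Suc_n)
    ultimately have asc: "?w i < ?w (Suc i)" by simp
    let ?s = "transpose i (Suc i)"
    have i: "1 \<le> i" "i < n" "simple_root i \<in> I" using that by (auto simp: root_indices_def)
    have "?s \<in> simple_reflections n I" using i by (auto simp: simple_reflections_def)
    then have m: "?w \<circ> ?s \<in> parabolic_subgroup n I"
      using mem unfolding parabolic_subgroup_def by (metis generate.eng generate.incl sym_group_mult)
    have "weyl_length n (?w \<circ> ?s) = Suc (weyl_length n ?w)"
      using card_inversions_ascent[OF perm i(1,2) asc] perm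
        weyl_length_eq_card_inversions[OF parabolic_subgroup_permutes(1)[OF m]]
      by (simp add: weyl_length_eq_card_inversions)
    then show False using weyl_length_le_longest[OF m] by simp
  qed
  ultimately show ?thesis using perm by (auto simp: is_block_reversal_def)
qed

text \<open>On the block from \<open>l + 1\<close> to \<open>m\<close>, \<open>w\<close> is a strictly decreasing map of an interval to itself. Counting
  steps from the left end bounds \<open>w i\<close> from above, counting from the right end bounds it from below.\<close>

lemma block_reversal_value:
  assumes w: "is_block_reversal n A w" and lm: "l < i" "i \<le> m" "m \<le> n"
    and A: "l \<notin> A" "m \<notin> A" "{l<..<m} \<subseteq> A"
  shows "w i = l + m + 1 - i"
proof -
  have img: "w ` {1..l} = {1..l}" "w ` {1..m} = {1..m}" and inj: "inj w"
    using w lm A permutes_inj by (auto simp: is_block_reversal_def)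
  have in_block: "l < w j \<and> w j \<le> m" if "l < j" "j \<le> m" for j
  proof -
    have "w j \<in> {1..l} \<longleftrightarrow> j \<in> {1..l}" "w j \<in> {1..m} \<longleftrightarrow> j \<in> {1..m}"
      using inj_image_mem_iff[OF inj, of j "{1..l}"] inj_image_mem_iff[OF inj, of j "{1..m}"]
      unfolding img by blast+
    then show ?thesis using that by simp
  qed
  have desc: "w (Suc j) < w j" if "l < j" "j < m" for j
    using w A that by (auto simp: is_block_reversal_def)
  have up: "j \<le> m \<longrightarrow> w j + j \<le> l + m + 1" if "Suc l \<le> j" for j
    using that
  proof (induction j rule: dec_induct)
    case base
    show ?case using in_block[of "Suc l"] by linarith
  next
    case (step j)
    show ?case using step.hyps step.IH desc[of j] by linarith
  qed
  have down: "l < j \<longrightarrow> l + m + 1 \<le> w j + j" if "j \<le> m" for j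
    using that
  proof (induction j rule: inc_induct)
    case base
    show ?case using in_block[of m] by linarith
  next
    case (step j)
    show ?case using step.hyps step.IH desc[of j] by linarith
  qed
  show ?thesis using up[of i] down[of i] lm by linarith
qed

lemma block_reversal_unique:
  assumes A: "A \<subseteq> {1..<n}" and w: "is_block_reversal n A w" and w': "is_block_reversal n A w'"
  shows "w = w'"
proof
  fix i
  show "w i = w' i"
  proof (cases "i \<in> {1..n}")
    case False
    then show ?thesis using w w' by (auto simp: is_block_reversal_def permutes_def)
  next
    case True
    define l where "l = Max {l. l < i \<and> l \<notin> A}"
    define m where "m = (LEAST m. i \<le> m \<and> m \<notin> A)"
    have fin: "finite {l. l < i \<and> l \<notin> A}" by simp
    have "0 \<in> {l. l < i \<and> l \<notin> A}" using True A by auto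
    then have "l \<in> {l. l < i \<and> l \<notin> A}" unfolding l_def using Max_in[OF fin] by blast
    then have l: "l < i" "l \<notin> A" by auto
    have ex: "i \<le> n \<and> n \<notin> A" using True A by auto
    then have m: "i \<le> m" "m \<notin> A" "m \<le> n"
      unfolding m_def using LeastI[of "\<lambda>m. i \<le> m \<and> m \<notin> A", OF ex] Least_le[of "\<lambda>m. i \<le> m \<and> m \<notin> A", OF ex] by auto
    have "j \<in> A" if "l < j" "j < m" for j
    proof (cases "j < i")
      case True
      show ?thesis
      proof (rule ccontr)
        assume "j \<notin> A"
        with True have "j \<le> l" unfolding l_def by (intro Max_ge[OF fin]) auto
        with that show False by simp
      qed
    next
      case False
      then show ?thesis using that not_less_Least[of j "\<lambda>m. i \<le> m \<and> m \<notin> A"] by (auto simp: m_def)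
    qed
    then have "{l<..<m} \<subseteq> A" by auto
    with l m show ?thesis using block_reversal_value[OF w] block_reversal_value[OF w'] by metis
  qed
qed

text \<open>The index set can be read off from the permutation; this makes \<open>I \<mapsto> w\<^sub>I\<close> injective and tells which
  \<open>I\<close> belongs to a given block reversal.\<close>

lemma block_reversal_indices:
  assumes A: "A \<subseteq> {1..<n}" and w: "is_block_reversal n A w"
  shows "A = {k \<in> {1..<n}. w ` {1..k} \<noteq> {1..k}}"
proof -
  have "w ` {1..k} \<noteq> {1..k}" if "k \<in> A" for k
  proof
    assume eq: "w ` {1..k} = {1..k}"
    have perm: "w permutes {1..n}" using w by (simp add: is_block_reversal_def)
    have "k \<ge> 1" using that A by auto
    then have "w k \<le> k" using eq by (metis atLeastAtMost_iff image_eqI order_refl)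
    moreover have "w (Suc k) < w k" using that w by (auto simp: is_block_reversal_def)
    ultimately have "w (Suc k) \<le> k" by simp
    moreover have "w (Suc k) \<in> {1..n}"
      using permutes_in_image[OF perm, of "Suc k"] that A by auto
    ultimately have "w (Suc k) \<in> w ` {1..k}" using eq by auto
    then show False
      using inj_image_mem_iff[OF permutes_inj[OF perm], of "Suc k" "{1..k}"] by simp
  qed
  moreover have "w ` {1..k} = {1..k}" if "k \<in> {1..<n}" "k \<notin> A" for k
    using w that unfolding is_block_reversal_def by (meson atLeastLessThan_iff less_imp_le)
  ultimately show ?thesis using A by blast
qed

lemma longest_inj:
  assumes "I \<subseteq> simple_roots n" "J \<subseteq> simple_roots n" "longest n I = longest n J"
  shows "I = J"
proof -
  have "root_indices n K = {k \<in> {1..<n}. longest n K ` {1..k} \<noteq> {1..k}}"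
    if "K \<subseteq> simple_roots n" for K
    by (rule block_reversal_indices[OF _ is_block_reversal_longest[OF that]])
      (auto simp: root_indices_def)
  then have "root_indices n I = root_indices n J" using assms by simp
  then show ?thesis using root_indices_mono_iff assms by blast
qed

text \<open>The matrix \<open>nilp n\<close> sends the basis vector with index \<open>w j\<close> to the one with index \<open>w j - 1 = w i\<close>. For the
  coordinate flag of \<open>w\<close> to lie in the Peterson variety, this image must lie in step \<open>j + 1\<close> of the flag.\<close>

definition hessenberg_perm :: "nat \<Rightarrow> (nat \<Rightarrow> nat) \<Rightarrow> bool" where
  "hessenberg_perm n w \<longleftrightarrow>
     (\<forall>i\<in>{1..n}. \<forall>j\<in>{1..n}. w j = Suc (w i) \<longrightarrow> i \<le> Suc j)"

text \<open>If \<open>w j = w i + 1\<close> and \<open>j < i\<close>, no block ends between \<open>j\<close> and \<open>i\<close>, because \<open>w\<close> preserves the blocks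
  and their order. So \<open>w\<close> decreases at every step from \<open>j\<close> to \<open>i\<close>, and since it drops by \<open>1\<close> only,
  there is just one step.\<close>

lemma block_reversal_hessenberg:
  assumes w: "is_block_reversal n A w"
  shows "hessenberg_perm n w"
  unfolding hessenberg_perm_def
proof (intro ballI impI)
  fix i j assume ij: "i \<in> {1..n}" "j \<in> {1..n}" "w j = Suc (w i)"
  show "i \<le> Suc j"
  proof (rule ccontr)
    assume "\<not> i \<le> Suc j"
    then have lt: "Suc j < i" by simp
    have perm: "w permutes {1..n}" using w by (simp add: is_block_reversal_def)
    have "k \<in> A" if "j \<le> k" "k < i" for k
    proof (rule ccontr)
      assume "k \<notin> A"
      then have eq: "w ` {1..k} = {1..k}" using w that ij by (auto simp: is_block_reversal_def)
      have "w j \<in> w ` {1..k}" using that ij by (intro imageI) simp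
      then have "w j \<le> k" using eq by auto
      moreover have "w i \<in> {1..n}" using permutes_in_image[OF perm] ij by blast
      ultimately have "w i \<in> w ` {1..k}" using ij eq by auto
      then show False
        using that inj_image_mem_iff[OF permutes_inj[OF perm], of i "{1..k}"] by simp
    qed
    then have "w (Suc j) < w j" "w (Suc (Suc j)) < w (Suc j)"
      using w lt by (auto simp: is_block_reversal_def)
    moreover have "k \<le> i \<Longrightarrow> w k \<le> w (Suc (Suc j))" if "Suc (Suc j) \<le> k" for k
      using that
    proof (induction k rule: dec_induct)
      case (step k)
      have "k \<in> A" using step.hyps step.prems \<open>\<And>k. j \<le> k \<Longrightarrow> k < i \<Longrightarrow> k \<in> A\<close> by auto
      then have "w (Suc k) < w k" using w by (auto simp: is_block_reversal_def)
      then show ?case using step by auto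
    qed simp
    from this[of i] have "w i \<le> w (Suc (Suc j))" using lt by simp
    ultimately show False using ij by simp
  qed
qed

text \<open>If \<open>k\<close> is an ascent, then \<open>i = k + 1\<close> is impossible for \<open>j = k\<close> in the Hessenberg condition. So the
  condition makes \<open>w ` {1..k}\<close> closed under positive predecessors, that is, equal to \<open>{1..k}\<close>. Every \<open>k\<close> for
  which this fails is therefore a descent.\<close>

lemma hessenberg_perm_block_reversal:
  assumes perm: "w permutes {1..n}" and hess: "hessenberg_perm n w"
  shows "is_block_reversal n {k \<in> {1..<n}. w ` {1..k} \<noteq> {1..k}} w"
proof -
  have inj: "inj w" using perm by (rule permutes_inj)
  have "w (Suc k) < w k" if k: "k \<in> {1..<n}" and ne: "w ` {1..k} \<noteq> {1..k}" for k
  proof (rule ccontr)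
    assume asc: "\<not> w (Suc k) < w k"
    have down: "r \<in> w ` {1..k}" if r: "Suc r \<in> w ` {1..k}" "1 \<le> r" for r
    proof -
      obtain j where j: "Suc r = w j" "j \<in> {1..k}" using r(1) by (rule imageE)
      have "w j \<in> {1..n}" unfolding permutes_in_image[OF perm] using j k by auto
      then have "r \<in> {1..n}" using j(1) r(2) by simp
      then have "r \<in> w ` {1..n}" unfolding permutes_image[OF perm] .
      then obtain i where i: "r = w i" "i \<in> {1..n}" by (rule imageE)
      have "j \<in> {1..n}" using j(2) k by auto
      moreover have wj: "w j = Suc (w i)" using i(1) j(1) by simp
      ultimately have "i \<le> Suc j" using hess i(2) unfolding hessenberg_perm_def by blast
      moreover have "i \<noteq> Suc k \<or> j \<noteq> k" using asc wj by auto
      ultimately have "i \<in> {1..k}" using i(2) j(2) by auto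
      then show ?thesis unfolding i(1) by (rule imageI)
    qed
    have down': "1 \<le> r \<longrightarrow> r \<in> w ` {1..k}" if q: "q \<in> w ` {1..k}" "r \<le> q" for q r
      using q(2)
    proof (induction r rule: inc_induct)
      case (step m)
      then show ?case using down[of m] by simp
    qed (use q in simp)
    have sub: "w ` {1..k} \<subseteq> {1..k}"
    proof
      fix q assume q: "q \<in> w ` {1..k}"
      have "{1..q} \<subseteq> w ` {1..k}" using down'[OF q] by (meson atLeastAtMost_iff subsetI)
      then have "card {1..q} \<le> card (w ` {1..k})" by (rule card_mono[rotated]) simp
      also have "\<dots> \<le> k" using card_image_le[of "{1..k}" w] by simp
      finally have "q \<le> k" by simp
      moreover obtain j where "q = w j" "j \<in> {1..k}" using q by (rule imageE)
      then have "q \<in> {1..n}" using k permutes_in_image[OF perm, of j] by simp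
      ultimately show "q \<in> {1..k}" by simp
    qed
    have "card (w ` {1..k}) = card {1..k}" by (rule card_image[OF inj_on_subset[OF inj]]) simp
    with sub have "w ` {1..k} = {1..k}" by (intro card_subset_eq) auto
    with ne show False ..
  qed
  moreover have "w ` {1..k} = {1..k}"
    if "k \<le> n" and k: "k \<notin> {k \<in> {1..<n}. w ` {1..k} \<noteq> {1..k}}" for k
  proof (cases "k \<in> {1..<n}")
    case True
    with k show ?thesis by blast
  next
    case False
    with that have "k = 0 \<or> k = n" by auto
    then show ?thesis using permutes_image[OF perm] by (elim disjE) simp_all
  qed
  ultimately show ?thesis using perm unfolding is_block_reversal_def by blast
qed

lemma hessenberg_perm_longest:
  assumes perm: "w permutes {1..n}" and hess: "hessenberg_perm n w"
  obtains I where "I \<subseteq> simple_roots n" "w = longest n I"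
proof
  define A where "A = {k \<in> {1..<n}. w ` {1..k} \<noteq> {1..k}}"
  define I where "I = simple_root ` A"
  show I: "I \<subseteq> simple_roots n" by (auto simp: I_def A_def simple_roots_def)
  have idx: "root_indices n I = A"
    by (auto simp: root_indices_def I_def A_def simple_root_inj)
  have "A \<subseteq> {1..<n}" unfolding A_def by blast
  then show "w = longest n I"
    using hessenberg_perm_block_reversal[OF assms] is_block_reversal_longest[OF I]
    unfolding idx A_def[symmetric] by (rule block_reversal_unique)
qed

section \<open>The general linear group and its flags\<close>

lemma GL_iff: "g \<in> carrier (GLn n) \<longleftrightarrow> g \<in> carrier_mat n n \<and> det g \<noteq> 0"
proof -
  have "g \<in> Units (ring_mat TYPE(complex) n ()) \<Longrightarrow> g \<in> carrier_mat n n"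
    by (auto simp: Units_def ring_mat_def)
  then show ?thesis
    unfolding GLn_def units_of_carrier
    using unit_imp_det_non_zero[of g n "()"] det_non_zero_imp_unit[of g n "()"] by blast
qed

lemma GL_carrier_mat: "g \<in> carrier (GLn n) \<Longrightarrow> g \<in> carrier_mat n n"
  by (simp add: GL_iff)

lemma GL_mult_eq [simp]: "mult (GLn n) = (*)"
  by (simp add: GLn_def units_of_def ring_mat_def)

lemma GL_one_eq [simp]: "\<one>\<^bsub>GLn n\<^esub> = 1\<^sub>m n"
  by (simp add: GLn_def units_of_def ring_mat_def)

lemma group_GLn: "group (GLn n)"
proof -
  interpret semiring "ring_mat TYPE(complex) n ()" by (rule semiring_mat)
  show ?thesis unfolding GLn_def by (rule units_group)
qed

lemma GL_mult: "g \<in> carrier (GLn n) \<Longrightarrow> h \<in> carrier (GLn n) \<Longrightarrow> g * h \<in> carrier (GLn n)"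
  using monoid.m_closed[OF group.is_monoid[OF group_GLn[of n]]] by simp

lemma GL_inv: "g \<in> carrier (GLn n) \<Longrightarrow> inv\<^bsub>GLn n\<^esub> g \<in> carrier (GLn n)"
  by (rule group.inv_closed[OF group_GLn])

lemma GL_inv_mult: "g \<in> carrier (GLn n) \<Longrightarrow> inv\<^bsub>GLn n\<^esub> g * g = 1\<^sub>m n"
  using group.l_inv[OF group_GLn] by simp

lemma GL_mult_inv: "g \<in> carrier (GLn n) \<Longrightarrow> g * inv\<^bsub>GLn n\<^esub> g = 1\<^sub>m n"
  using group.r_inv[OF group_GLn] by simp

lemma GL_one: "1\<^sub>m n \<in> carrier (GLn n)"
  using monoid.one_closed[OF group.is_monoid[OF group_GLn[of n]]] by simp

lemma GL_assoc:
  "g \<in> carrier (GLn n) \<Longrightarrow> h \<in> carrier (GLn n) \<Longrightarrow> k \<in> carrier (GLn n) \<Longrightarrow>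
     g * h * k = g * (h * k)"
  using monoid.m_assoc[OF group.is_monoid[OF group_GLn[of n]]] by simp

lemma GL_one_mult: "g \<in> carrier (GLn n) \<Longrightarrow> 1\<^sub>m n * g = g" "g \<in> carrier (GLn n) \<Longrightarrow> g * 1\<^sub>m n = g"
  by (auto dest: GL_carrier_mat)

lemma GL_cancel:
  assumes "g \<in> carrier (GLn n)" "h \<in> carrier (GLn n)"
  shows "inv\<^bsub>GLn n\<^esub> g * (g * h) = h" "g * (inv\<^bsub>GLn n\<^esub> g * h) = h"
    "h * g * inv\<^bsub>GLn n\<^esub> g = h" "h * inv\<^bsub>GLn n\<^esub> g * g = h"
proof -
  note g = assms GL_inv[OF assms(1)]
  show "inv\<^bsub>GLn n\<^esub> g * (g * h) = h" "g * (inv\<^bsub>GLn n\<^esub> g * h) = h"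
    using g by (simp_all add: GL_assoc[symmetric, of _ n] GL_inv_mult GL_mult_inv GL_one_mult)
  show "h * g * inv\<^bsub>GLn n\<^esub> g = h" "h * inv\<^bsub>GLn n\<^esub> g * g = h"
    using g by (simp_all add: GL_assoc[of _ n] GL_inv_mult GL_mult_inv GL_one_mult)
qed

lemma GL_inv_of_mult:
  assumes "g \<in> carrier (GLn n)" "h \<in> carrier (GLn n)"
  shows "inv\<^bsub>GLn n\<^esub> (g * h) = inv\<^bsub>GLn n\<^esub> h * inv\<^bsub>GLn n\<^esub> g"
  using group.inv_mult_group[OF group_GLn assms] by simp

lemma mult_entry:
  assumes "A \<in> carrier_mat n n" "B \<in> carrier_mat n n" "i < n" "j < n"
  shows "(A * B) $$ (i, j) = (\<Sum>l<n. A $$ (i, l) * B $$ (l, j))"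
  using assms by (auto simp: scalar_prod_def atLeast0LessThan intro!: sum.cong)

lemma mult_entry_nonzero:
  assumes "A \<in> carrier_mat n n" "B \<in> carrier_mat n n" "i < n" "j < n"
    and "(A * B) $$ (i, j) \<noteq> (0 :: complex)"
  obtains l where "l < n" "A $$ (i, l) \<noteq> 0" "B $$ (l, j) \<noteq> 0"
proof -
  have "(\<Sum>l<n. A $$ (i, l) * B $$ (l, j)) \<noteq> 0"
    using assms(5) unfolding mult_entry[OF assms(1-4)] .
  then obtain l where "l \<in> {..<n}" "A $$ (i, l) * B $$ (l, j) \<noteq> 0" by (rule sum.not_neutral_contains_not_neutral)
  with that show ?thesis by auto
qed

lemma mult_entry_single:
  assumes "A \<in> carrier_mat n n" "B \<in> carrier_mat n n" "i < n" "j < n" "k < n"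
    and "\<And>l. l < n \<Longrightarrow> l \<noteq> k \<Longrightarrow> A $$ (i, l) = 0 \<or> B $$ (l, j) = (0 :: complex)"
  shows "(A * B) $$ (i, j) = A $$ (i, k) * B $$ (k, j)"
proof -
  have "(A * B) $$ (i, j) = (\<Sum>l<n. A $$ (i, l) * B $$ (l, j))" by (rule mult_entry[OF assms(1-4)])
  also have "\<dots> = (\<Sum>l\<in>{k}. A $$ (i, l) * B $$ (l, j))"
    using assms(5,6) by (intro sum.mono_neutral_right) auto
  finally show ?thesis by simp
qed

section \<open>Triangular matrices\<close>

text \<open>Upper and lower triangular matrices are treated together: \<open>R i j\<close> says that the entry \<open>(i, j)\<close> may be
  nonzero.\<close>

locale triangular_direction =
  fixes R :: "nat \<Rightarrow> nat \<Rightarrow> bool"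
  assumes direction: "R = (\<le>) \<or> R = (\<ge>)"
begin

lemma R_refl: "R i i" and R_trans: "R i j \<Longrightarrow> R j k \<Longrightarrow> R i k"
  and R_antisym: "R i j \<Longrightarrow> R j i \<Longrightarrow> i = j"
  using direction by auto

lemma R_extremal:
  assumes "finite S" "S \<noteq> {}"
  obtains p where "p \<in> S" "\<And>i. i \<in> S \<Longrightarrow> R i p"
  using direction that[of "Max S"] that[of "Min S"] Max_in[OF assms] Min_in[OF assms]
    Max_ge[OF assms(1)] Min_le[OF assms(1)] by blast

text \<open>A permutation \<open>p\<close> contributes to the Leibniz formula only if \<open>f i\<close> and \<open>f (p i)\<close> are comparable in the same
  direction for all \<open>i\<close>. As both have the same sum over \<open>i\<close>, they are equal and \<open>p\<close> is the identity. The key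
  \<open>f\<close> covers matrices that become triangular only after a simultaneous permutation of rows and columns.\<close>

lemma det_comparable:
  assumes A: "A \<in> carrier_mat k k" and f: "inj_on f {..<k}"
    and R: "\<And>i j. i < k \<Longrightarrow> j < k \<Longrightarrow> A $$ (i, j) \<noteq> (0 :: complex) \<Longrightarrow> R (f i) (f j)"
  shows "det A = (\<Prod>i<k. A $$ (i, i))"
proof -
  have fixed: "p = id" if p: "p permutes {0..<k}" and nz: "(\<Prod>i = 0..<k. A $$ (i, p i)) \<noteq> 0" for p
  proof -
    have Rp: "R (f i) (f (p i))" if "i \<in> {0..<k}" for i
    proof (rule R)
      show "i < k" using that by simp
      show "p i < k" using permutes_in_image[OF p, of i] that by simp
      show "A $$ (i, p i) \<noteq> 0" using nz that by (metis finite_atLeastLessThan prod_zero)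
    qed
    have eq: "(\<Sum>i\<in>{0..<k}. f (p i)) = (\<Sum>i\<in>{0..<k}. f i)"
      using sum.permute[OF p, of f] by (simp add: comp_def)
    have same: "f (p i) = f i" if i: "i \<in> {0..<k}" for i
    proof (rule ccontr)
      assume ne: "f (p i) \<noteq> f i"
      from direction show False
      proof
        assume "R = (\<le>)"
        then have "(\<Sum>i\<in>{0..<k}. f i) < (\<Sum>i\<in>{0..<k}. f (p i))"
          using Rp i ne by (intro sum_strict_mono_ex1) (force simp: order_less_le)+
        with eq show False by simp
      next
        assume "R = (\<ge>)"
        then have "(\<Sum>i\<in>{0..<k}. f (p i)) < (\<Sum>i\<in>{0..<k}. f i)"
          using Rp i ne by (intro sum_strict_mono_ex1) (force simp: order_less_le)+
        with eq show False by simp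
      qed
    qed
    show ?thesis
    proof
      fix i show "p i = id i"
      proof (cases "i < k")
        case True
        moreover have "p i < k" using permutes_in_image[OF p, of i] True by simp
        ultimately show ?thesis using same[of i] f by (simp add: inj_on_def)
      next
        case False
        then show ?thesis using permutes_not_in[OF p, of i] by simp
      qed
    qed
  qed
  let ?t = "\<lambda>p. signof p * (\<Prod>i = 0..<k. A $$ (i, p i))"
  have "det A = (\<Sum>p\<in>{p. p permutes {0..<k}}. ?t p)" by (rule det_def'[OF A])
  also have "\<dots> = (\<Sum>p\<in>{id}. ?t p)"
  proof (rule sum.mono_neutral_right)
    show "\<forall>p\<in>{p. p permutes {0..<k}} - {id}. ?t p = 0"
      using fixed by (metis DiffE mem_Collect_eq mult_zero_right singletonI)
  qed (auto simp: finite_permutations permutes_id)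
  finally show ?thesis by (simp add: sign_id atLeast0LessThan)
qed

end

definition triangular :: "(nat \<Rightarrow> nat \<Rightarrow> bool) \<Rightarrow> nat \<Rightarrow> complex mat set" where
  "triangular R n = {b \<in> carrier (GLn n). \<forall>i<n. \<forall>j<n. \<not> R i j \<longrightarrow> b $$ (i, j) = 0}"

lemma triangular_GL: "b \<in> triangular R n \<Longrightarrow> b \<in> carrier (GLn n)"
  by (simp add: triangular_def)

lemma triangularD: "b \<in> triangular R n \<Longrightarrow> i < n \<Longrightarrow> j < n \<Longrightarrow> b $$ (i, j) \<noteq> 0 \<Longrightarrow> R i j"
  by (auto simp: triangular_def)

lemma Borel_eq: "Borel n = triangular (\<le>) n"
  by (fastforce simp: Borel_def triangular_def upper_triangular_def dest: GL_carrier_mat)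

lemma Borel_opp_eq: "Borel_opp n = triangular (\<ge>) n"
  by (fastforce simp: Borel_opp_def triangular_def upper_triangular_def dest: GL_carrier_mat)

context triangular_direction
begin

lemma det_triangular:
  assumes "b \<in> carrier_mat n n" "\<And>i j. i < n \<Longrightarrow> j < n \<Longrightarrow> b $$ (i, j) \<noteq> (0 :: complex) \<Longrightarrow> R i j"
  shows "det b = (\<Prod>i<n. b $$ (i, i))"
  by (rule det_comparable[of b n "\<lambda>i. i"]) (use assms in auto)

lemma triangularI:
  assumes "b \<in> carrier_mat n n" "\<And>i j. i < n \<Longrightarrow> j < n \<Longrightarrow> b $$ (i, j) \<noteq> 0 \<Longrightarrow> R i j"
    and "\<And>i. i < n \<Longrightarrow> b $$ (i, i) \<noteq> 0"
  shows "b \<in> triangular R n"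
proof -
  have "det b \<noteq> 0" using det_triangular[OF assms(1,2)] assms(3) by simp
  then show ?thesis using assms unfolding triangular_def GL_iff by blast
qed

lemma triangular_det:
  assumes "b \<in> triangular R n"
  shows "det b = (\<Prod>i<n. b $$ (i, i))"
  by (rule det_triangular[OF GL_carrier_mat[OF triangular_GL[OF assms]]]) (rule triangularD[OF assms])

lemma triangular_diag:
  assumes "b \<in> triangular R n" "i < n"
  shows "b $$ (i, i) \<noteq> 0"
proof -
  have "det b \<noteq> 0" using triangular_GL[OF assms(1)] by (simp add: GL_iff)
  then show ?thesis using assms by (simp add: triangular_det)
qed

lemma triangular_mult:
  assumes b: "b \<in> triangular R n" and c: "c \<in> triangular R n"
  shows "b * c \<in> triangular R n"
proof -
  note G = GL_carrier_mat[OF triangular_GL]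
  have "R i j" if ij: "i < n" "j < n" and nz: "(b * c) $$ (i, j) \<noteq> 0" for i j
  proof -
    obtain l where "l < n" "b $$ (i, l) \<noteq> 0" "c $$ (l, j) \<noteq> 0"
      by (rule mult_entry_nonzero[OF G[OF b] G[OF c] ij nz])
    then show ?thesis using triangularD[OF b ij(1)] triangularD[OF c _ ij(2)] R_trans by blast
  qed
  then show ?thesis using GL_mult[OF triangular_GL[OF b] triangular_GL[OF c]]
    unfolding triangular_def by blast
qed

lemma triangular_one: "1\<^sub>m n \<in> triangular R n"
  by (auto simp: triangular_def GL_one R_refl)

text \<open>In column \<open>j\<close> of the inverse, take the nonzero entry that is extreme for \<open>R\<close>, in row \<open>p\<close> say. The entry
  \<open>(p, j)\<close> of \<open>b\<close> times its inverse is then a single nonzero product, so \<open>p = j\<close>.\<close>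

lemma triangular_inv:
  assumes b: "b \<in> triangular R n"
  shows "inv\<^bsub>GLn n\<^esub> b \<in> triangular R n"
proof -
  let ?c = "inv\<^bsub>GLn n\<^esub> b"
  have bG: "b \<in> carrier (GLn n)" using b by (rule triangular_GL)
  note G = GL_carrier_mat[OF bG] GL_carrier_mat[OF GL_inv[OF bG]]
  have "R i j" if ij: "i < n" "j < n" "?c $$ (i, j) \<noteq> 0" for i j
  proof -
    let ?S = "{i. i < n \<and> ?c $$ (i, j) \<noteq> 0}"
    obtain p where p: "p \<in> ?S" "\<And>i. i \<in> ?S \<Longrightarrow> R i p"
      by (rule R_extremal[of ?S]) (use ij in auto)
    have "(b * ?c) $$ (p, j) = b $$ (p, p) * ?c $$ (p, j)"
    proof (rule mult_entry_single[OF G])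
      fix l assume "l < n" "l \<noteq> p"
      then show "b $$ (p, l) = 0 \<or> ?c $$ (l, j) = 0"
        using p triangularD[OF b, of p l] R_antisym by blast
    qed (use p ij in auto)
    also have "\<dots> \<noteq> 0" using p triangular_diag[OF b] by simp
    finally have "p = j" using p ij by (simp add: GL_mult_inv[OF bG] split: if_splits)
    then show ?thesis using p(2)[of i] ij by blast
  qed
  then show ?thesis using GL_inv[OF bG] by (auto simp: triangular_def)
qed

end

interpretation upper: triangular_direction "(\<le>)" by unfold_locales simp
interpretation lower: triangular_direction "(\<ge>)" by unfold_locales simp

lemmas Borel_GL = triangular_GL[of _ "(\<le>)", folded Borel_eq]
lemmas Borel_mult = upper.triangular_mult[folded Borel_eq]
lemmas Borel_inv = upper.triangular_inv[folded Borel_eq]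
lemmas Borel_one = upper.triangular_one[folded Borel_eq]
lemmas Borel_diag = upper.triangular_diag[folded Borel_eq]
lemmas BorelD = triangularD[of _ "(\<le>)", folded Borel_eq]

lemma flag_point_eq: "flag_point n g = {g * b | b. b \<in> Borel n}"
  by (auto simp: flag_point_def l_coset_def)

lemma flag_point_self: "g \<in> carrier (GLn n) \<Longrightarrow> g \<in> flag_point n g"
  unfolding flag_point_eq using Borel_one[of n] GL_one_mult(2)[of g n] by (metis (mono_tags) mem_Collect_eq)

lemma flag_point_mult_Borel:
  assumes "g \<in> carrier (GLn n)" "b \<in> Borel n"
  shows "flag_point n (g * b) = flag_point n g"
proof (intro subset_antisym subsetI)
  fix x assume "x \<in> flag_point n (g * b)"
  then obtain c where c: "c \<in> Borel n" "x = g * b * c" by (auto simp: flag_point_eq)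
  then have "x = g * (b * c)" using assms by (simp add: GL_assoc Borel_GL)
  then show "x \<in> flag_point n g" using Borel_mult[OF assms(2) c(1)] unfolding flag_point_eq by blast
next
  fix x assume "x \<in> flag_point n g"
  then obtain c where c: "c \<in> Borel n" "x = g * c" by (auto simp: flag_point_eq)
  let ?d = "inv\<^bsub>GLn n\<^esub> b * c"
  have d: "?d \<in> Borel n" by (intro Borel_mult Borel_inv assms c)
  have "x = g * b * ?d"
    using assms c GL_cancel(2)[OF Borel_GL[OF assms(2)] Borel_GL[OF c(1)]]
    by (simp add: GL_assoc[OF _ _ Borel_GL[OF d]] Borel_GL)
  then show "x \<in> flag_point n (g * b)" using d unfolding flag_point_eq by blast
qed

lemma flag_point_eq_iff:
  assumes "g \<in> carrier (GLn n)" "h \<in> carrier (GLn n)"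
  shows "flag_point n g = flag_point n h \<longleftrightarrow> (\<exists>b\<in>Borel n. h = g * b)"
proof
  assume "flag_point n g = flag_point n h"
  then have "h \<in> flag_point n g" using flag_point_self[OF assms(2)] by simp
  then show "\<exists>b\<in>Borel n. h = g * b" by (auto simp: flag_point_eq)
qed (use flag_point_mult_Borel[OF assms(1)] in auto)

lemma flag_act_point:
  assumes "h \<in> carrier (GLn n)" "g \<in> carrier (GLn n)"
  shows "flag_act n h (flag_point n g) = flag_point n (h * g)"
proof -
  have "flag_act n h (flag_point n g) = {h * (g * b) | b. b \<in> Borel n}"
    unfolding flag_act_def flag_point_eq l_coset_def by auto
  also have "\<dots> = flag_point n (h * g)"
    unfolding flag_point_eq using GL_assoc[OF assms Borel_GL] by metis
  finally show ?thesis .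
qed

section \<open>Permutation matrices\<close>

text \<open>Matrix entries are numbered from \<open>0\<close>, whereas Weyl group elements permute \<open>{1..n}\<close>.\<close>

definition perm_shift :: "(nat \<Rightarrow> nat) \<Rightarrow> nat \<Rightarrow> nat" where
  "perm_shift w i = w (Suc i) - 1"

lemma Suc_perm_shift:
  assumes w: "w permutes {1..n}"
  shows "Suc (perm_shift w i) = w (Suc i)"
proof -
  have "w 0 = 0" using permutes_not_in[OF w, of 0] by simp
  then have "w (Suc i) \<noteq> 0" using permutes_inj[OF w] by (metis injD nat.distinct(1))
  then show ?thesis by (simp add: perm_shift_def)
qed

lemma perm_shift_less:
  assumes w: "w permutes {1..n}"
  shows "perm_shift w i < n \<longleftrightarrow> i < n"
proof -
  have "Suc i \<in> {1..n} \<longleftrightarrow> Suc (perm_shift w i) \<in> {1..n}"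
    unfolding Suc_perm_shift[OF w] by (rule permutes_in_image[OF w, symmetric])
  then show ?thesis by auto
qed

lemma perm_shift_inj: 
  assumes w: "w permutes {1..n}"
  shows "perm_shift w i = perm_shift w j \<longleftrightarrow> i = j"
  using Suc_perm_shift[OF w, of i] Suc_perm_shift[OF w, of j] permutes_inj[OF w]
  by (metis Suc_inject injD)

lemma perm_shift_permutes:
  assumes w: "w permutes {1..n}"
  shows "perm_shift w permutes {..<n}"
proof (rule bij_imp_permutes)
  have "inj_on (perm_shift w) {..<n}" using perm_shift_inj[OF w] by (simp add: inj_on_def)
  moreover have "perm_shift w ` {..<n} \<subseteq> {..<n}" using perm_shift_less[OF w] by blast
  ultimately show "bij_betw (perm_shift w) {..<n} {..<n}"
    by (simp add: bij_betw_def endo_inj_surj)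
  fix i assume "i \<notin> {..<n}"
  then show "perm_shift w i = i" using permutes_not_in[OF w, of "Suc i"] by (simp add: perm_shift_def)
qed

lemma perm_shift_surj:
  assumes w: "w permutes {1..n}" and "k < n"
  obtains i where "i < n" "perm_shift w i = k"
proof -
  have "k \<in> perm_shift w ` {..<n}" using permutes_image[OF perm_shift_permutes[OF w]] assms by simp
  then show ?thesis using that by blast
qed

lemma perm_shift_cancel:
  assumes "w permutes {1..n}" "w' permutes {1..n}" "\<And>i. i < n \<Longrightarrow> perm_shift w i = perm_shift w' i"
  shows "w = w'"
proof
  fix i show "w i = w' i"
  proof (cases "i \<in> {1..n}")
    case True
    then obtain j where "i = Suc j" "j < n" by (cases i) auto
    then show ?thesis using assms(3) Suc_perm_shift[OF assms(1)] Suc_perm_shift[OF assms(2)] by metis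
  next
    case False
    then show ?thesis using permutes_not_in[OF assms(1)] permutes_not_in[OF assms(2)] by metis
  qed
qed

lemma exists_perm_shift:
  assumes inj: "inj_on f {..<n}" and img: "f ` {..<n} \<subseteq> {..<n}"
  obtains w where "w permutes {1..n}" "\<And>i. i < n \<Longrightarrow> perm_shift w i = f i"
proof -
  define w where "w k = (if k \<in> {1..n} then Suc (f (k - 1)) else k)" for k
  have "inj_on w {1..n}"
  proof (rule inj_onI)
    fix x y assume xy: "x \<in> {1..n}" "y \<in> {1..n}" "w x = w y"
    then have "f (x - 1) = f (y - 1)" by (simp add: w_def)
    moreover have "x - 1 \<in> {..<n}" "y - 1 \<in> {..<n}" using xy by auto
    ultimately have "x - 1 = y - 1" using inj by (rule inj_onD[rotated])
    then show "x = y" using xy by auto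
  qed
  moreover have "w ` {1..n} \<subseteq> {1..n}"
  proof
    fix y assume "y \<in> w ` {1..n}"
    then obtain x where x: "x \<in> {1..n}" "y = w x" by blast
    then have "x - 1 \<in> {..<n}" by auto
    then have "f (x - 1) \<in> {..<n}" using img by blast
    then show "y \<in> {1..n}" using x by (simp add: w_def)
  qed
  ultimately have "bij_betw w {1..n} {1..n}" by (simp add: bij_betw_def endo_inj_surj)
  then have "w permutes {1..n}" by (rule bij_imp_permutes) (simp only: w_def if_False)
  moreover have "perm_shift w i = f i" if "i < n" for i
    using that by (simp add: perm_shift_def w_def)
  ultimately show ?thesis by (rule that)
qed

lemma perm_mat_carrier [simp]: "perm_mat n w \<in> carrier_mat n n"
  by (simp add: perm_mat_def)

lemma perm_mat_entry:
  assumes "w permutes {1..n}" "i < n" "j < n"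
  shows "perm_mat n w $$ (i, j) = (if i = perm_shift w j then 1 else 0)"
  using assms by (simp add: perm_mat_def Suc_perm_shift[OF assms(1), symmetric])

lemma perm_mat_dim [simp]: "dim_row (perm_mat n w) = n" "dim_col (perm_mat n w) = n"
  by (simp_all add: perm_mat_def)

lemma transpose_perm_mat_entry:
  assumes "w permutes {1..n}" "i < n" "j < n"
  shows "transpose_mat (perm_mat n w) $$ (i, j) = (if j = perm_shift w i then 1 else 0)"
  using assms by (simp add: perm_mat_entry)

lemma transpose_perm_mat_mult:
  assumes w: "w permutes {1..n}"
  shows "transpose_mat (perm_mat n w) * perm_mat n w = 1\<^sub>m n"
proof (rule eq_matI)
  note entry = perm_mat_entry[OF w] transpose_perm_mat_entry[OF w] perm_shift_less[OF w]
  fix i j assume "i < dim_row (1\<^sub>m n :: complex mat)" "j < dim_col (1\<^sub>m n :: complex mat)"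
  then have ij: "i < n" "j < n" by auto
  have "(transpose_mat (perm_mat n w) * perm_mat n w) $$ (i, j) =
    transpose_mat (perm_mat n w) $$ (i, perm_shift w i) * perm_mat n w $$ (perm_shift w i, j)"
    by (rule mult_entry_single) (use ij in \<open>auto simp add: entry simp del: index_transpose_mat(1)\<close>)
  also have "\<dots> = 1\<^sub>m n $$ (i, j)"
    using ij by (simp add: entry perm_shift_inj[OF w] del: index_transpose_mat(1))
  finally show "(transpose_mat (perm_mat n w) * perm_mat n w) $$ (i, j) = 1\<^sub>m n $$ (i, j)" .
qed auto

lemma perm_mat_GL:
  assumes w: "w permutes {1..n}"
  shows "perm_mat n w \<in> carrier (GLn n)"
proof -
  have "det (transpose_mat (perm_mat n w)) * det (perm_mat n w) = 1"
    using det_mult[of "transpose_mat (perm_mat n w)" n "perm_mat n w"] transpose_perm_mat_mult[OF w] by simp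
  then show ?thesis unfolding GL_iff by force
qed

lemma perm_mat_inv:
  assumes w: "w permutes {1..n}"
  shows "inv\<^bsub>GLn n\<^esub> (perm_mat n w) = transpose_mat (perm_mat n w)"
proof -
  have "transpose_mat (perm_mat n w) \<in> carrier (GLn n)"
    using perm_mat_GL[OF w] by (simp add: GL_iff det_transpose[OF perm_mat_carrier])
  then show ?thesis
    using group.inv_equality[OF group_GLn _ perm_mat_GL[OF w], of "transpose_mat (perm_mat n w)"]
      transpose_perm_mat_mult[OF w] by simp
qed

lemma mult_perm_mat_entry:
  assumes w: "w permutes {1..n}" and "A \<in> carrier_mat n n" "i < n" "j < n"
  shows "(A * perm_mat n w) $$ (i, j) = A $$ (i, perm_shift w j)"
proof -
  have "(A * perm_mat n w) $$ (i, j) = A $$ (i, perm_shift w j) * perm_mat n w $$ (perm_shift w j, j)"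
    by (rule mult_entry_single) (use assms in \<open>auto simp: perm_mat_entry[OF w] perm_shift_less[OF w]\<close>)
  then show ?thesis using assms by (simp add: perm_mat_entry[OF w] perm_shift_less[OF w])
qed

lemma inv_perm_mat_mult_entry:
  assumes w: "w permutes {1..n}" and "A \<in> carrier_mat n n" "i < n" "j < n"
  shows "(inv\<^bsub>GLn n\<^esub> (perm_mat n w) * A) $$ (i, j) = A $$ (perm_shift w i, j)"
proof -
  note entry = transpose_perm_mat_entry[OF w] perm_shift_less[OF w]
  have "(transpose_mat (perm_mat n w) * A) $$ (i, j) =
    transpose_mat (perm_mat n w) $$ (i, perm_shift w i) * A $$ (perm_shift w i, j)"
    by (rule mult_entry_single) (use assms in \<open>auto simp add: entry simp del: index_transpose_mat(1)\<close>)
  then show ?thesis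
    using assms by (simp add: perm_mat_inv[OF w] entry del: index_transpose_mat(1))
qed

lemma perm_mat_mult_entry:
  assumes w: "w permutes {1..n}" and "A \<in> carrier_mat n n" "i < n" "j < n"
  shows "(perm_mat n w * A) $$ (perm_shift w i, j) = A $$ (i, j)"
proof -
  have "(perm_mat n w * A) $$ (perm_shift w i, j) = perm_mat n w $$ (perm_shift w i, i) * A $$ (i, j)"
    by (rule mult_entry_single)
      (use assms in \<open>auto simp: perm_mat_entry[OF w] perm_shift_less[OF w] perm_shift_inj[OF w]\<close>)
  then show ?thesis using assms by (simp add: perm_mat_entry[OF w] perm_shift_less[OF w])
qed

lemma square_mult: "A \<in> carrier_mat n n \<Longrightarrow> B \<in> carrier_mat n n \<Longrightarrow> A * B \<in> carrier_mat n n"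
  by (rule mult_carrier_mat)

lemma square_assoc:
  "A \<in> carrier_mat n n \<Longrightarrow> B \<in> carrier_mat n n \<Longrightarrow> C \<in> carrier_mat n n \<Longrightarrow> A * B * C = A * (B * C)"
  by (rule assoc_mult_mat)

section \<open>Bruhat decompositions\<close>

lemma GL_column_nonzero:
  assumes h: "h \<in> carrier (GLn n)" and k: "k < n"
  obtains i where "i < n" "h $$ (i, k) \<noteq> 0"
proof -
  have "(inv\<^bsub>GLn n\<^esub> h * h) $$ (k, k) \<noteq> 0" using k by (simp add: GL_inv_mult[OF h])
  then show ?thesis
    using mult_entry_nonzero[OF GL_carrier_mat[OF GL_inv[OF h]] GL_carrier_mat[OF h] k k] that by metis
qed

lemma add_row_multiples_entry:
  fixes A :: "complex mat"
  assumes "A \<in> carrier_mat n n" "p < n" "i < n" "j < n"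
  shows "(mat n n (\<lambda>(i, l). (if i = l then 1 else 0) + (if l = p then t i else 0)) * A) $$ (i, j) =
    A $$ (i, j) + t i * A $$ (p, j)"
proof -
  let ?E = "mat n n (\<lambda>(i, l). (if i = l then 1 else 0) + (if l = p then t i else 0)) :: complex mat"
  have "(?E * A) $$ (i, j) = (\<Sum>l<n. ?E $$ (i, l) * A $$ (l, j))"
    by (rule mult_entry) (use assms in auto)
  also have "\<dots> = (\<Sum>l<n. (if l = i then A $$ (l, j) else 0) + (if l = p then t i * A $$ (l, j) else 0))"
    by (rule sum.cong) (use assms in \<open>auto simp: algebra_simps\<close>)
  also have "\<dots> = A $$ (i, j) + t i * A $$ (p, j)"
    using assms by (simp add: sum.distrib)
  finally show ?thesis .
qed

lemma add_to_column_entry: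
  fixes A :: "complex mat"
  assumes "A \<in> carrier_mat n n" "k < n" "i < n" "j < n"
  shows "(A * mat n n (\<lambda>(l, j). (if l = j then 1 else 0) + (if j = k then t l else 0))) $$ (i, j) =
    A $$ (i, j) + (if j = k then \<Sum>l<n. A $$ (i, l) * t l else 0)"
proof -
  let ?E = "mat n n (\<lambda>(l, j). (if l = j then 1 else 0) + (if j = k then t l else 0)) :: complex mat"
  have "(A * ?E) $$ (i, j) = (\<Sum>l<n. A $$ (i, l) * ?E $$ (l, j))"
    by (rule mult_entry) (use assms in auto)
  also have "\<dots> = (\<Sum>l<n. (if l = j then A $$ (i, l) else 0) + (if j = k then A $$ (i, l) * t l else 0))"
    by (rule sum.cong) (use assms in \<open>auto simp: algebra_simps\<close>)
  also have "\<dots> = A $$ (i, j) + (if j = k then \<Sum>l<n. A $$ (i, l) * t l else 0)"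
    using assms by (simp add: sum.distrib)
  finally show ?thesis .
qed

context triangular_direction
begin

text \<open>One step of Gaussian elimination. Subtracting multiples of the columns on the left clears the rows
  of the earlier pivots in column \<open>k\<close>. The new pivot is the extreme row \<open>p\<close> with a nonzero entry, so
  that the row operations that clear the rest of the column are triangular. They do not change
  the earlier columns, which vanish in row \<open>p\<close>.\<close>

lemma eliminate_column:
  assumes h: "h \<in> carrier (GLn n)" and k: "k < n" and f: "f ` {..<k} \<subseteq> {..<n}"
    and cols: "\<And>i j. i < n \<Longrightarrow> j < k \<Longrightarrow> h $$ (i, j) = (if i = f j then 1 else 0)"
  obtains u c p where "u \<in> triangular R n" "c \<in> Borel n" "p < n" "p \<notin> f ` {..<k}"
    "\<And>i j. i < n \<Longrightarrow> j < k \<Longrightarrow> (u * (h * c)) $$ (i, j) = (if i = f j then 1 else 0)"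
    "\<And>i. i < n \<Longrightarrow> (u * (h * c)) $$ (i, k) = (if i = p then 1 else 0)"
proof -
  have hM: "h \<in> carrier_mat n n" using h by (rule GL_carrier_mat)
  have fn: "f j < n" if "j < k" for j using f that by blast
  have f_inj: "f i = f j \<longleftrightarrow> i = j" if "i < k" "j < k" for i j
  proof
    assume eq: "f i = f j"
    show "i = j"
    proof (rule ccontr)
      assume "i \<noteq> j"
      have "(inv\<^bsub>GLn n\<^esub> h * h) $$ (i, l) = (inv\<^bsub>GLn n\<^esub> h) $$ (i, f l)" if "l < k" for l
      proof -
        have "(inv\<^bsub>GLn n\<^esub> h * h) $$ (i, l) = (inv\<^bsub>GLn n\<^esub> h) $$ (i, f l) * h $$ (f l, l)"
          by (rule mult_entry_single[OF GL_carrier_mat[OF GL_inv[OF h]] hM])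
            (use that \<open>i < k\<close> k fn cols in auto)
        then show ?thesis using cols[OF fn[OF that] that] by simp
      qed
      from this[OF \<open>i < k\<close>] this[OF \<open>j < k\<close>] show False
        using eq that k \<open>i \<noteq> j\<close> by (simp add: GL_inv_mult[OF h])
    qed
  qed simp
  define t where "t l = (if l < k then - h $$ (f l, k) else 0)" for l
  define c where "c = mat n n (\<lambda>(l, j). (if l = j then 1 else 0) + (if j = k then t l else 0))"
  have c: "c \<in> Borel n" unfolding Borel_eq
  proof (rule upper.triangularI)
    show "c \<in> carrier_mat n n" by (simp add: c_def)
  qed (auto simp: c_def t_def split: if_splits)
  have hc: "h * c \<in> carrier (GLn n)" by (intro GL_mult h Borel_GL c)
  then have hcM: "h * c \<in> carrier_mat n n" by (rule GL_carrier_mat)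
  have hc_old: "(h * c) $$ (i, j) = (if i = f j then 1 else 0)" if "i < n" "j < k" for i j
    using that k cols unfolding c_def by (subst add_to_column_entry[OF hM k]) auto
  define v where "v i = (h * c) $$ (i, k)" for i
  have v_f: "v (f j) = 0" if j: "j < k" for j
  proof -
    have "v (f j) = h $$ (f j, k) + (\<Sum>l<n. h $$ (f j, l) * t l)"
      unfolding v_def c_def using fn[OF j] k by (subst add_to_column_entry[OF hM k]) auto
    also have "(\<Sum>l<n. h $$ (f j, l) * t l) = (\<Sum>l\<in>{j}. h $$ (f j, l) * t l)"
    proof (rule sum.mono_neutral_right)
      show "\<forall>l\<in>{..<n} - {j}. h $$ (f j, l) * t l = 0"
        using cols[OF fn[OF j]] f_inj[OF j] by (auto simp: t_def)
    qed (use j k in auto)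
    finally show ?thesis using j cols[OF fn[OF j] j] by (simp add: t_def)
  qed
  \<comment> \<open>The next pivot is chosen extreme, so that the row operations go in the direction of \<open>R\<close>.\<close>
  let ?S = "{i. i < n \<and> v i \<noteq> 0}"
  have "?S \<noteq> {}" using GL_column_nonzero[OF hc k] unfolding v_def by blast
  then obtain p where p: "p \<in> ?S" "\<And>i. i \<in> ?S \<Longrightarrow> R i p"
    using R_extremal[of ?S] by auto
  have pf: "p \<notin> f ` {..<k}" using v_f p by auto
  define s where "s i = (if i = p then inverse (v p) - 1 else - v i / v p)" for i
  define u where "u = mat n n (\<lambda>(i, l). (if i = l then 1 else 0) + (if l = p then s i else 0))"
  have u: "u \<in> triangular R n"
  proof (rule triangularI)
    fix i j assume ij: "i < n" "j < n" "u $$ (i, j) \<noteq> 0"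
    show "R i j"
    proof (cases "i = j")
      case False
      then have "j = p" "v i \<noteq> 0" using ij by (auto simp: u_def s_def split: if_splits)
      then show ?thesis using p ij by blast
    qed (simp add: R_refl)
  qed (use p in \<open>auto simp: u_def s_def\<close>)
  have entry: "(u * (h * c)) $$ (i, j) = (h * c) $$ (i, j) + s i * (h * c) $$ (p, j)"
    if "i < n" "j < n" for i j
    unfolding u_def by (rule add_row_multiples_entry) (use hcM p that in auto)
  have "(u * (h * c)) $$ (i, j) = (if i = f j then 1 else 0)" if ij: "i < n" "j < k" for i j
  proof -
    have "p \<noteq> f j" using pf ij by blast
    then have "(h * c) $$ (p, j) = 0" using hc_old[of p j] p ij by auto
    then show ?thesis using entry[of i j] hc_old[OF ij] ij k by simp
  qed
  moreover have "(u * (h * c)) $$ (i, k) = (if i = p then 1 else 0)" if "i < n" for i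
    using entry[OF that k] p unfolding v_def[symmetric] by (auto simp: s_def field_simps)
  ultimately show ?thesis using that[OF u c _ pf] p by blast
qed

lemma partial_bruhat:
  assumes g: "g \<in> carrier (GLn n)"
  shows "k \<le> n \<Longrightarrow> \<exists>u\<in>triangular R n. \<exists>c\<in>Borel n. \<exists>f. inj_on f {..<k} \<and> f ` {..<k} \<subseteq> {..<n} \<and>
    (\<forall>i<n. \<forall>j<k. (u * (g * c)) $$ (i, j) = (if i = f j then 1 else 0))"
proof (induction k)
  case 0
  show ?case
    by (rule bexI[OF _ triangular_one], rule bexI[OF _ Borel_one]) simp
next
  case (Suc k)
  then obtain u c f where IH: "u \<in> triangular R n" "c \<in> Borel n" "inj_on f {..<k}" "f ` {..<k} \<subseteq> {..<n}"
    "\<And>i j. i < n \<Longrightarrow> j < k \<Longrightarrow> (u * (g * c)) $$ (i, j) = (if i = f j then 1 else 0)"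
    by auto
  have k: "k < n" using Suc.prems by simp
  have G: "u \<in> carrier (GLn n)" "c \<in> carrier (GLn n)" "g * c \<in> carrier (GLn n)"
    using IH(1,2) g by (auto intro: triangular_GL Borel_GL GL_mult)
  have h: "u * (g * c) \<in> carrier (GLn n)" by (rule GL_mult[OF G(1,3)])
  obtain u' c' p where el: "u' \<in> triangular R n" "c' \<in> Borel n" "p < n" "p \<notin> f ` {..<k}"
    "\<And>i j. i < n \<Longrightarrow> j < k \<Longrightarrow> (u' * (u * (g * c) * c')) $$ (i, j) = (if i = f j then 1 else 0)"
    "\<And>i. i < n \<Longrightarrow> (u' * (u * (g * c) * c')) $$ (i, k) = (if i = p then 1 else 0)"
    by (rule eliminate_column[OF h k IH(4,5)]) auto
  have G': "u' \<in> carrier (GLn n)" "c' \<in> carrier (GLn n)"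
    using el(1,2) by (auto intro: triangular_GL Borel_GL)
  have eq: "u' * (u * (g * c) * c') = (u' * u) * (g * (c * c'))"
    using G G' g by (simp add: GL_assoc[of _ n] GL_mult)
  let ?f = "f(k := p)"
  have "inj_on ?f {..<Suc k}"
    using IH(3) el(4) by (auto simp: inj_on_def lessThan_Suc)
  moreover have "?f ` {..<Suc k} \<subseteq> {..<n}"
    using IH(4) el(3) by (auto simp: lessThan_Suc)
  moreover have "\<forall>i<n. \<forall>j<Suc k. ((u' * u) * (g * (c * c'))) $$ (i, j) = (if i = ?f j then 1 else 0)"
    using el(5,6) unfolding eq[symmetric] by (auto simp: less_Suc_eq)
  ultimately show ?case
    using triangular_mult[OF el(1) IH(1)] Borel_mult[OF IH(2) el(2)] by blast
qed

lemma bruhat_decomposition: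
  assumes g: "g \<in> carrier (GLn n)"
  obtains b w c where "b \<in> triangular R n" "w permutes {1..n}" "c \<in> Borel n"
    "g = b * perm_mat n w * c"
proof -
  obtain u c f where *: "u \<in> triangular R n" "c \<in> Borel n" "inj_on f {..<n}" "f ` {..<n} \<subseteq> {..<n}"
    "\<forall>i<n. \<forall>j<n. (u * (g * c)) $$ (i, j) = (if i = f j then 1 else 0)"
    using partial_bruhat[OF g order_refl] by blast
  obtain w where w: "w permutes {1..n}" "\<And>i. i < n \<Longrightarrow> perm_shift w i = f i"
    using exists_perm_shift[OF *(3,4)] by blast
  have G: "u \<in> carrier (GLn n)" "c \<in> carrier (GLn n)" "g * c \<in> carrier (GLn n)"
    using *(1,2) g by (auto intro: triangular_GL Borel_GL GL_mult)
  have "u * (g * c) = perm_mat n w"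
  proof (rule eq_matI)
    fix i j assume "i < dim_row (perm_mat n w)" "j < dim_col (perm_mat n w)"
    then show "(u * (g * c)) $$ (i, j) = perm_mat n w $$ (i, j)"
      using *(5) w by (simp add: perm_mat_entry)
  qed (use GL_carrier_mat[OF GL_mult[OF G(1,3)]] in auto)
  then have "inv\<^bsub>GLn n\<^esub> u * perm_mat n w = g * c"
    using GL_cancel(1)[OF G(1,3)] by simp
  then have "inv\<^bsub>GLn n\<^esub> u * perm_mat n w * inv\<^bsub>GLn n\<^esub> c = g"
    using GL_cancel(3)[OF G(2) g] by simp
  then show ?thesis
    using that[OF triangular_inv[OF *(1)] w(1) Borel_inv[OF *(2)]] by simp
qed

text \<open>Column \<open>j\<close> of the left side is nonzero in row \<open>w j\<close>, and the right side is nonzero there only if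
  \<open>w j = w' i\<close> for some \<open>i \<le> j\<close>. By induction on \<open>j\<close> this forces \<open>i = j\<close>.\<close>

lemma bruhat_unique:
  assumes b: "b \<in> triangular R n" and c: "c \<in> Borel n"
    and w: "w permutes {1..n}" and w': "w' permutes {1..n}"
    and eq: "b * perm_mat n w = perm_mat n w' * c"
  shows "w = w'"
proof -
  note bM = GL_carrier_mat[OF triangular_GL[OF b]] and cM = GL_carrier_mat[OF Borel_GL[OF c]]
  have ex: "\<exists>i\<le>j. perm_shift w' i = perm_shift w j" if j: "j < n" for j
  proof -
    have sj: "perm_shift w j < n" using j perm_shift_less[OF w] by simp
    obtain i where i: "i < n" "perm_shift w' i = perm_shift w j"
      using perm_shift_surj[OF w' sj] by blast
    have "(b * perm_mat n w) $$ (perm_shift w j, j) \<noteq> 0"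
      using mult_perm_mat_entry[OF w bM sj j] triangular_diag[OF b sj] by simp
    then have "c $$ (i, j) \<noteq> 0"
      using perm_mat_mult_entry[OF w' cM i(1) j] i(2) eq by simp
    then have "i \<le> j" using BorelD[OF c i(1) j] by simp
    then show ?thesis using i by blast
  qed
  have "j < n \<longrightarrow> perm_shift w j = perm_shift w' j" for j
  proof (induction j rule: less_induct)
    case (less j)
    show ?case
    proof
      assume j: "j < n"
      obtain i where i: "i \<le> j" "perm_shift w' i = perm_shift w j" using ex[OF j] by blast
      have "i = j"
      proof (rule ccontr)
        assume "i \<noteq> j"
        then have "i < j" using i by simp
        then have "perm_shift w i = perm_shift w j" using less.IH[of i] i j by simp
        then show False using \<open>i \<noteq> j\<close> perm_shift_inj[OF w] by blast
      qed
      then show "perm_shift w j = perm_shift w' j" using i by simp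
    qed
  qed
  then show ?thesis by (intro perm_shift_cancel[OF w w']) blast
qed

lemma cell_iff:
  assumes w: "w permutes {1..n}" and g: "g \<in> carrier (GLn n)"
  shows "flag_point n g \<in> cell n (triangular R n) w \<longleftrightarrow>
    (\<exists>b\<in>triangular R n. \<exists>c\<in>Borel n. g = b * perm_mat n w * c)"
proof -
  have G: "b * perm_mat n w \<in> carrier (GLn n)" if "b \<in> triangular R n" for b
    by (rule GL_mult[OF triangular_GL[OF that] perm_mat_GL[OF w]])
  have "flag_point n g \<in> cell n (triangular R n) w \<longleftrightarrow>
      (\<exists>b\<in>triangular R n. flag_point n (b * perm_mat n w) = flag_point n g)"
    unfolding cell_def by auto
  also have "\<dots> \<longleftrightarrow> (\<exists>b\<in>triangular R n. \<exists>c\<in>Borel n. g = b * perm_mat n w * c)"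
    using flag_point_eq_iff[OF G g] by blast
  finally show ?thesis .
qed

lemma cell_disjoint:
  assumes g: "g \<in> carrier (GLn n)" and w: "w permutes {1..n}" and w': "w' permutes {1..n}"
    and "flag_point n g \<in> cell n (triangular R n) w" "flag_point n g \<in> cell n (triangular R n) w'"
  shows "w = w'"
proof -
  obtain b c where bc: "b \<in> triangular R n" "c \<in> Borel n" "g = b * perm_mat n w * c"
    using assms(4) cell_iff[OF w g] by blast
  obtain b' c' where bc': "b' \<in> triangular R n" "c' \<in> Borel n" "g = b' * perm_mat n w' * c'"
    using assms(5) cell_iff[OF w' g] by blast
  note G = triangular_GL[OF bc(1)] Borel_GL[OF bc(2)] triangular_GL[OF bc'(1)] Borel_GL[OF bc'(2)]
    perm_mat_GL[OF w] perm_mat_GL[OF w']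
  have "b * perm_mat n w = b * perm_mat n w * c * inv\<^bsub>GLn n\<^esub> c"
    using G by (intro GL_cancel(3)[symmetric] GL_mult)
  also have "\<dots> = b' * (perm_mat n w' * (c' * inv\<^bsub>GLn n\<^esub> c))"
    using G by (simp add: bc(3)[symmetric] bc'(3) GL_assoc[of _ n] GL_mult GL_inv)
  finally have "inv\<^bsub>GLn n\<^esub> b' * (b * perm_mat n w) = perm_mat n w' * (c' * inv\<^bsub>GLn n\<^esub> c)"
    using G GL_cancel(1)[of b' n "perm_mat n w' * (c' * inv\<^bsub>GLn n\<^esub> c)"] by (simp add: GL_mult GL_inv)
  moreover have "inv\<^bsub>GLn n\<^esub> b' * (b * perm_mat n w) = inv\<^bsub>GLn n\<^esub> b' * b * perm_mat n w"
    using G by (simp add: GL_assoc[of _ n] GL_inv)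
  ultimately show ?thesis
    using bruhat_unique[OF triangular_mult[OF triangular_inv[OF bc'(1)] bc(1)]
        Borel_mult[OF bc'(2) Borel_inv[OF bc(2)]] w w'] by simp
qed

end

text \<open>If \<open>w\<close> preserves \<open>{1..k}\<close>, step \<open>k\<close> of every flag in the cell of \<open>w\<close> is spanned by the first \<open>k\<close> basis
  vectors. For a flag in the opposite cell of \<open>w'\<close>, on the other hand, this step contains vectors
  with a nonzero component in each of the rows \<open>w' 1, ..., w' k\<close>.\<close>

lemma opposite_cell_meets_cell:
  assumes g: "g \<in> carrier (GLn n)" and w: "w permutes {1..n}" and w': "w' permutes {1..n}"
    and "flag_point n g \<in> cell n (Borel n) w" "flag_point n g \<in> cell n (Borel_opp n) w'"
    and k: "k \<le> n" "w ` {1..k} = {1..k}"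
  shows "w' ` {1..k} \<subseteq> {1..k}"
proof -
  obtain b c where bc: "b \<in> Borel n" "c \<in> Borel n" "g = b * perm_mat n w * c"
    using assms(4) upper.cell_iff[OF w g] unfolding Borel_eq by blast
  obtain b' c' where bc': "b' \<in> triangular (\<ge>) n" "c' \<in> Borel n" "g = b' * perm_mat n w' * c'"
    using assms(5) lower.cell_iff[OF w' g] unfolding Borel_opp_eq by blast
  note G = Borel_GL[OF bc(1)] Borel_GL[OF bc(2)] triangular_GL[OF bc'(1)] Borel_GL[OF bc'(2)]
    perm_mat_GL[OF w] perm_mat_GL[OF w']
  define d where "d = c * inv\<^bsub>GLn n\<^esub> c'"
  have d: "d \<in> Borel n" unfolding d_def by (intro Borel_mult Borel_inv bc bc')
  have "b' * perm_mat n w' = b' * perm_mat n w' * c' * inv\<^bsub>GLn n\<^esub> c'"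
    using G by (intro GL_cancel(3)[symmetric] GL_mult)
  also have "\<dots> = b * perm_mat n w * d"
    unfolding d_def using G by (simp add: bc'(3)[symmetric] bc(3) GL_assoc[of _ n] GL_mult GL_inv)
  finally have eq: "b' * perm_mat n w' = b * perm_mat n w * d" .
  have shift: "perm_shift w' j < k" if j: "j < k" for j
  proof -
    let ?s = "perm_shift w' j"
    have jn: "j < n" and sn: "?s < n" using j k perm_shift_less[OF w'] by auto
    have "(b' * perm_mat n w') $$ (?s, j) \<noteq> 0"
      using mult_perm_mat_entry[OF w' GL_carrier_mat[OF G(3)] sn jn] lower.triangular_diag[OF bc'(1) sn]
      by simp
    then obtain l where l: "l < n" "(b * perm_mat n w) $$ (?s, l) \<noteq> 0" "d $$ (l, j) \<noteq> 0"
      unfolding eq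
      by (rule mult_entry_nonzero[OF GL_carrier_mat[OF GL_mult[OF G(1,5)]]
            GL_carrier_mat[OF Borel_GL[OF d]] sn jn])
    have "l \<le> j" using BorelD[OF d l(1) jn l(3)] .
    then have "Suc l \<in> {1..k}" using j by simp
    then have "w (Suc l) \<in> {1..k}" using k(2) by blast
    then have "perm_shift w l < k" using Suc_perm_shift[OF w, of l] by simp
    moreover have "b $$ (?s, perm_shift w l) \<noteq> 0"
      using l mult_perm_mat_entry[OF w GL_carrier_mat[OF G(1)] sn l(1)] by simp
    then have "?s \<le> perm_shift w l"
      using BorelD[OF bc(1) sn] perm_shift_less[OF w] l(1) by blast
    ultimately show ?thesis by simp
  qed
  show ?thesis
  proof
    fix y assume "y \<in> w' ` {1..k}"
    then obtain x where x: "y = w' x" "x \<in> {1..k}" by (rule imageE)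
    then obtain j where "x = Suc j" "j < k" by (cases x) auto
    then show "y \<in> {1..k}" using shift[of j] Suc_perm_shift[OF w', of j] x(1) by simp
  qed
qed

text \<open>Conjugated by the permutation matrix, the two factorizations give matrices \<open>L\<close> and \<open>D\<close> with \<open>L = D d\<close> for some \<open>d\<close> in \<open>B\<close>, whose
  off-diagonal supports are disjoint; comparing the columns from left to right, both \<open>L\<close> and
  \<open>D\<close> vanish below the diagonal.\<close>

lemma cell_inter_opposite_cell:
  assumes g: "g \<in> carrier (GLn n)" and w: "w permutes {1..n}"
    and "flag_point n g \<in> cell n (Borel n) w" "flag_point n g \<in> cell n (Borel_opp n) w"
  shows "flag_point n g = flag_point n (perm_mat n w)"
proof -
  obtain b c where bc: "b \<in> Borel n" "c \<in> Borel n" "g = b * perm_mat n w * c"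
    using assms(3) upper.cell_iff[OF w g] unfolding Borel_eq by blast
  obtain b' c' where bc': "b' \<in> triangular (\<ge>) n" "c' \<in> Borel n" "g = b' * perm_mat n w * c'"
    using assms(4) lower.cell_iff[OF w g] unfolding Borel_opp_eq by blast
  note G = Borel_GL[OF bc(1)] Borel_GL[OF bc(2)] triangular_GL[OF bc'(1)] Borel_GL[OF bc'(2)]
    perm_mat_GL[OF w]
  let ?P = "perm_mat n w"
  define d where "d = c * inv\<^bsub>GLn n\<^esub> c'"
  have d: "d \<in> Borel n" unfolding d_def by (intro Borel_mult Borel_inv bc bc')
  have "b' * ?P = b' * ?P * c' * inv\<^bsub>GLn n\<^esub> c'"
    using G by (intro GL_cancel(3)[symmetric] GL_mult)
  also have "\<dots> = b * ?P * d"
    unfolding d_def using G by (simp add: bc'(3)[symmetric] bc(3) GL_assoc[of _ n] GL_mult GL_inv)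
  finally have eq: "b' * ?P = b * ?P * d" .
  define L where "L = inv\<^bsub>GLn n\<^esub> ?P * (b' * ?P)"
  define D where "D = inv\<^bsub>GLn n\<^esub> ?P * (b * ?P)"
  have LG: "L \<in> carrier (GLn n)" and DG: "D \<in> carrier (GLn n)"
    unfolding L_def D_def using G by (auto intro!: GL_mult GL_inv)
  have LD: "L = D * d"
    unfolding L_def D_def eq using G Borel_GL[OF d] by (simp add: GL_assoc[of _ n] GL_mult GL_inv)
  have L: "L $$ (i, j) = b' $$ (perm_shift w i, perm_shift w j)"
    and D: "D $$ (i, j) = b $$ (perm_shift w i, perm_shift w j)" if "i < n" "j < n" for i j
    unfolding L_def D_def using that perm_shift_less[OF w] G
    by (simp_all add: inv_perm_mat_mult_entry[OF w] mult_perm_mat_entry[OF w] GL_carrier_mat GL_mult)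
  have low: "j < n \<longrightarrow> (\<forall>i. j < i \<and> i < n \<longrightarrow> L $$ (i, j) = 0 \<and> D $$ (i, j) = 0)" for j
  proof (induction j rule: less_induct)
    case (less j)
    show ?case
    proof (intro impI allI)
      fix i assume jn: "j < n" and i: "j < i \<and> i < n"
      have Lij: "L $$ (i, j) = D $$ (i, j) * d $$ (j, j)"
        unfolding LD
      proof (rule mult_entry_single[OF GL_carrier_mat[OF DG] GL_carrier_mat[OF Borel_GL[OF d]]])
        fix l assume l: "l < n" "l \<noteq> j"
        show "D $$ (i, l) = 0 \<or> d $$ (l, j) = 0"
        proof (cases "l < j")
          case True
          then show ?thesis using less.IH[of l] i l by simp
        next
          case False
          then show ?thesis using BorelD[OF d l(1) jn] l by auto
        qed
      qed (use i jn in auto)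
      have sn: "perm_shift w i < n" "perm_shift w j < n" using i jn perm_shift_less[OF w] by auto
      have "perm_shift w i \<noteq> perm_shift w j" using perm_shift_inj[OF w] i by auto
      then have "L $$ (i, j) = 0 \<or> D $$ (i, j) = 0"
        using L[of i j] D[of i j] i jn triangularD[OF bc'(1) sn] BorelD[OF bc(1) sn] by fastforce
      then show "L $$ (i, j) = 0 \<and> D $$ (i, j) = 0"
        using Lij Borel_diag[OF d jn] by auto
    qed
  qed
  have "L \<in> Borel n"
    unfolding Borel_eq triangular_def using LG low by (auto simp: not_le)
  then have "flag_point n (?P * L) = flag_point n ?P"
    by (intro flag_point_mult_Borel G)
  moreover have "?P * L = b' * ?P"
    unfolding L_def using G by (intro GL_cancel(2) GL_mult)
  moreover have "flag_point n (b' * ?P) = flag_point n g"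
    unfolding bc'(3) using G bc'(2) by (intro flag_point_mult_Borel[symmetric] GL_mult)
  ultimately show ?thesis by simp
qed

section \<open>The Peterson variety meets only the cells of longest elements\<close>

text \<open>The preimage of the Peterson variety in \<open>GL\<^sub>n\<close>.\<close>

definition hessenberg_matrices :: "nat \<Rightarrow> complex mat set" where
  "hessenberg_matrices n = {g \<in> carrier (GLn n).
     \<forall>i<n. \<forall>j<n. i > j + 1 \<longrightarrow> (inv\<^bsub>GLn n\<^esub> g * nilp n * g) $$ (i, j) = 0}"

lemma hessenberg_GL: "g \<in> hessenberg_matrices n \<Longrightarrow> g \<in> carrier (GLn n)"
  by (simp add: hessenberg_matrices_def)

lemma hessenbergD:
  assumes "g \<in> hessenberg_matrices n" "i < n" "j < n"
    and "(inv\<^bsub>GLn n\<^esub> g * nilp n * g) $$ (i, j) \<noteq> 0"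
  shows "i \<le> j + 1"
  using assms unfolding hessenberg_matrices_def by (metis (mono_tags, lifting) linorder_not_less mem_Collect_eq)

lemma nilp_carrier [simp]: "nilp n \<in> carrier_mat n n"
  by (simp add: nilp_def)

lemma hessenberg_mult_Borel:
  assumes g: "g \<in> hessenberg_matrices n" and b: "b \<in> Borel n"
  shows "g * b \<in> hessenberg_matrices n"
proof -
  have gG: "g \<in> carrier (GLn n)" and bG: "b \<in> carrier (GLn n)"
    using g b by (auto intro: hessenberg_GL Borel_GL)
  note M = GL_carrier_mat[OF gG] GL_carrier_mat[OF bG] GL_carrier_mat[OF GL_inv[OF gG]]
    GL_carrier_mat[OF GL_inv[OF bG]]
  let ?N = "inv\<^bsub>GLn n\<^esub> g * nilp n * g"
  have NM: "?N \<in> carrier_mat n n" using M by (intro square_mult nilp_carrier)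
  have eq: "inv\<^bsub>GLn n\<^esub> (g * b) * nilp n * (g * b) = inv\<^bsub>GLn n\<^esub> b * (?N * b)"
    unfolding GL_inv_of_mult[OF gG bG] using M nilp_carrier[of n]
    by (simp add: square_assoc[of _ n] square_mult)
  have "(inv\<^bsub>GLn n\<^esub> b * (?N * b)) $$ (i, j) = 0" if ij: "i < n" "j < n" "i > j + 1" for i j
  proof (rule ccontr)
    assume "(inv\<^bsub>GLn n\<^esub> b * (?N * b)) $$ (i, j) \<noteq> 0"
    then obtain k where k: "k < n" "(inv\<^bsub>GLn n\<^esub> b) $$ (i, k) \<noteq> 0" "(?N * b) $$ (k, j) \<noteq> 0"
      using M NM ij by (elim mult_entry_nonzero[rotated -1]) auto
    then obtain l where l: "l < n" "?N $$ (k, l) \<noteq> 0" "b $$ (l, j) \<noteq> 0"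
      using M NM ij by (elim mult_entry_nonzero[rotated -1]) auto
    have "i \<le> k" "l \<le> j" using BorelD[OF Borel_inv[OF b] ij(1) k(1,2)] BorelD[OF b l(1) ij(2) l(3)] by auto
    moreover have "k \<le> l + 1" by (rule hessenbergD[OF g k(1) l(1,2)])
    ultimately show False using ij by simp
  qed
  then show ?thesis using GL_mult[OF gG bG] eq unfolding hessenberg_matrices_def by simp
qed

lemma flag_point_Pet_iff:
  assumes g: "g \<in> carrier (GLn n)"
  shows "flag_point n g \<in> Pet n \<longleftrightarrow> g \<in> hessenberg_matrices n"
proof
  assume "flag_point n g \<in> Pet n"
  then obtain h where h: "h \<in> hessenberg_matrices n" "flag_point n g = flag_point n h"
    unfolding Pet_def hessenberg_matrices_def by blast
  then show "g \<in> hessenberg_matrices n"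
    using flag_point_eq_iff[OF hessenberg_GL[OF h(1)] g] hessenberg_mult_Borel[OF h(1)] by metis
next
  assume "g \<in> hessenberg_matrices n"
  then show "flag_point n g \<in> Pet n"
    unfolding Pet_def hessenberg_matrices_def by blast
qed

lemma Pet_cases:
  assumes "x \<in> Pet n"
  obtains g where "g \<in> hessenberg_matrices n" "x = flag_point n g"
  using assms unfolding Pet_def hessenberg_matrices_def by blast

lemma conj_perm_mat_entry:
  assumes w: "w permutes {1..n}" and "A \<in> carrier_mat n n" "i < n" "j < n"
  shows "(inv\<^bsub>GLn n\<^esub> (perm_mat n w) * A * perm_mat n w) $$ (i, j) =
    A $$ (perm_shift w i, perm_shift w j)"
proof -
  have "inv\<^bsub>GLn n\<^esub> (perm_mat n w) * A \<in> carrier_mat n n"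
    using assms GL_carrier_mat[OF GL_inv[OF perm_mat_GL[OF w]]] by (intro square_mult)
  then show ?thesis
    using assms perm_shift_less[OF w]
    by (simp add: mult_perm_mat_entry[OF w] inv_perm_mat_mult_entry[OF w])
qed

lemma perm_mat_hessenberg:
  assumes w: "w permutes {1..n}" and hess: "hessenberg_perm n w"
  shows "perm_mat n w \<in> hessenberg_matrices n"
proof -
  have "(inv\<^bsub>GLn n\<^esub> (perm_mat n w) * nilp n * perm_mat n w) $$ (i, j) = 0"
    if ij: "i < n" "j < n" "i > j + 1" for i j
  proof -
    have "perm_shift w j \<noteq> Suc (perm_shift w i)"
    proof
      assume "perm_shift w j = Suc (perm_shift w i)"
      then have "w (Suc j) = Suc (w (Suc i))" using Suc_perm_shift[OF w] by metis
      moreover have "Suc i \<in> {1..n}" "Suc j \<in> {1..n}" using ij by auto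
      ultimately have "Suc i \<le> Suc (Suc j)" using hess unfolding hessenberg_perm_def by blast
      then show False using ij by simp
    qed
    then show ?thesis
      using conj_perm_mat_entry[OF w nilp_carrier ij(1,2)] perm_shift_less[OF w] ij by (simp add: nilp_def)
  qed
  then show ?thesis using perm_mat_GL[OF w] by (simp add: hessenberg_matrices_def)
qed

context triangular_direction
begin

text \<open>In the sum that defines this entry, triangularity of \<open>b\<close> and of its inverse bounds the summation
  index from opposite sides. Only one product of diagonal entries survives.\<close>

lemma conj_nilp_superdiagonal:
  assumes b: "b \<in> triangular R n" and m: "Suc m < n"
  shows "(inv\<^bsub>GLn n\<^esub> b * nilp n * b) $$ (m, Suc m) \<noteq> 0"
proof -
  note bM = GL_carrier_mat[OF triangular_GL[OF b]]
    and iM = GL_carrier_mat[OF triangular_GL[OF triangular_inv[OF b]]]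
  have Nb: "(nilp n * b) $$ (k, l) = (if Suc k < n then b $$ (Suc k, l) else 0)" if "k < n" "l < n" for k l
  proof (cases "Suc k < n")
    case True
    have "(nilp n * b) $$ (k, l) = nilp n $$ (k, Suc k) * b $$ (Suc k, l)"
      by (rule mult_entry_single) (use that True bM in \<open>auto simp: nilp_def\<close>)
    then show ?thesis using True that by (simp add: nilp_def)
  next
    case False
    have "(nilp n * b) $$ (k, l) = nilp n $$ (k, k) * b $$ (k, l)"
      by (rule mult_entry_single) (use that False bM in \<open>auto simp: nilp_def\<close>)
    then show ?thesis using False that by (simp add: nilp_def)
  qed
  have "(inv\<^bsub>GLn n\<^esub> b * (nilp n * b)) $$ (m, Suc m) =
    (inv\<^bsub>GLn n\<^esub> b) $$ (m, m) * (nilp n * b) $$ (m, Suc m)"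
  proof (rule mult_entry_single)
    fix l assume l: "l < n" "l \<noteq> m"
    show "(inv\<^bsub>GLn n\<^esub> b) $$ (m, l) = 0 \<or> (nilp n * b) $$ (l, Suc m) = 0"
    proof (rule ccontr)
      assume nz: "\<not> ?thesis"
      then have Sl: "Suc l < n" "b $$ (Suc l, Suc m) \<noteq> 0" using Nb[OF l(1) m] by (auto split: if_splits)
      have "R m l" using triangularD[OF triangular_inv[OF b] _ l(1)] nz m by auto
      moreover have "R (Suc l) (Suc m)" using triangularD[OF b Sl(1) m Sl(2)] .
      ultimately show False using direction l by auto
    qed
  qed (use m in \<open>auto intro: iM square_mult[OF nilp_carrier bM]\<close>)
  also have "\<dots> \<noteq> 0"
    using Nb[of m "Suc m"] m triangular_diag[OF b m] triangular_diag[OF triangular_inv[OF b], of m] by simp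
  finally show ?thesis
    using square_assoc[OF iM nilp_carrier bM] by simp
qed

text \<open>Up to the right factor \<open>c\<close>, the matrix \<open>g\<^sup>-\<^sup>1 N g\<close> is the conjugate by the permutation matrix of \<open>b\<^sup>-\<^sup>1 N b\<close>, whose
  nonzero superdiagonal entries end up in the positions \<open>(i, j)\<close> with \<open>w j = w i + 1\<close>.\<close>

lemma hessenberg_cell:
  assumes g: "g \<in> hessenberg_matrices n" and w: "w permutes {1..n}"
    and cell: "flag_point n g \<in> cell n (triangular R n) w"
  shows "hessenberg_perm n w"
proof -
  let ?P = "perm_mat n w"
  obtain b c where bc: "b \<in> triangular R n" "c \<in> Borel n" "g = b * ?P * c"
    using cell cell_iff[OF w hessenberg_GL[OF g]] by blast
  note G = triangular_GL[OF bc(1)] Borel_GL[OF bc(2)] perm_mat_GL[OF w]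
  have "b * ?P = g * inv\<^bsub>GLn n\<^esub> c"
    unfolding bc(3) using G by (intro GL_cancel(3)[symmetric] GL_mult)
  then have bP: "b * ?P \<in> hessenberg_matrices n"
    using hessenberg_mult_Borel[OF g Borel_inv[OF bc(2)]] by simp
  let ?M = "inv\<^bsub>GLn n\<^esub> b * nilp n * b"
  note M = GL_carrier_mat[OF G(1)] GL_carrier_mat[OF GL_inv[OF G(1)]] GL_carrier_mat[OF G(3)]
    GL_carrier_mat[OF GL_inv[OF G(3)]]
  have MM: "?M \<in> carrier_mat n n" using M by (intro square_mult nilp_carrier)
  have eq: "inv\<^bsub>GLn n\<^esub> (b * ?P) * nilp n * (b * ?P) = inv\<^bsub>GLn n\<^esub> ?P * ?M * ?P"
    unfolding GL_inv_of_mult[OF G(1,3)] using M nilp_carrier[of n]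
    by (simp add: square_assoc[of _ n] square_mult)
  show ?thesis
    unfolding hessenberg_perm_def
  proof (intro ballI impI)
    fix i j assume ij: "i \<in> {1..n}" "j \<in> {1..n}" "w j = Suc (w i)"
    obtain i' where i': "i = Suc i'" "i' < n" using ij(1) by (cases i) auto
    obtain j' where j': "j = Suc j'" "j' < n" using ij(2) by (cases j) auto
    note ij' = i'(1) j'(1) i'(2) j'(2)
    have sh: "perm_shift w j' = Suc (perm_shift w i')"
      using ij(3) unfolding ij'(1,2) Suc_perm_shift[OF w, symmetric] by (rule Suc_inject)
    have "Suc (perm_shift w i') < n" using perm_shift_less[OF w, of j'] ij' sh by simp
    then have "(inv\<^bsub>GLn n\<^esub> ?P * ?M * ?P) $$ (i', j') \<noteq> 0"
      unfolding conj_perm_mat_entry[OF w MM ij'(3,4)] sh by (rule conj_nilp_superdiagonal[OF bc(1)])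
    then have "i' \<le> j' + 1" unfolding eq[symmetric] by (rule hessenbergD[OF bP ij'(3,4)])
    then show "i \<le> Suc j" using ij' by simp
  qed
qed

lemma Pet_cell_exists:
  assumes g: "g \<in> hessenberg_matrices n"
  obtains I where "I \<subseteq> simple_roots n" "flag_point n g \<in> cell n (triangular R n) (longest n I)"
proof -
  obtain b w c where bwc: "b \<in> triangular R n" "w permutes {1..n}" "c \<in> Borel n"
    "g = b * perm_mat n w * c"
    using bruhat_decomposition[OF hessenberg_GL[OF g]] by blast
  then have cell: "flag_point n g \<in> cell n (triangular R n) w"
    using cell_iff[OF bwc(2) hessenberg_GL[OF g]] by blast
  show ?thesis
    using hessenberg_perm_longest[OF bwc(2) hessenberg_cell[OF g bwc(2) cell]] cell that by metis
qed

end

lemma longest_permutes: "I \<subseteq> simple_roots n \<Longrightarrow> longest n I permutes {1..n}"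
  using is_block_reversal_longest by (simp add: is_block_reversal_def)

text \<open>The inclusion \<open>J \<subseteq> I\<close> holds because the indices outside \<open>I\<close> are those \<open>k\<close> for which \<open>w\<^sub>I\<close> preserves
  \<open>{1..k}\<close>, and \<open>w\<^sub>J\<close> then preserves it too.\<close>

lemma Pet_stratification:
  assumes x: "x \<in> Pet n"
  obtains I J where "J \<subseteq> I" "I \<subseteq> simple_roots n" "x \<in> Y0 n I J"
proof -
  obtain g where g: "g \<in> hessenberg_matrices n" "x = flag_point n g" using Pet_cases[OF x] .
  obtain I where I: "I \<subseteq> simple_roots n" "flag_point n g \<in> cell n (Borel n) (longest n I)"
    using upper.Pet_cell_exists[OF g(1)] unfolding Borel_eq by blast
  obtain J where J: "J \<subseteq> simple_roots n" "flag_point n g \<in> cell n (Borel_opp n) (longest n J)"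
    using lower.Pet_cell_exists[OF g(1)] unfolding Borel_opp_eq by blast
  note wI = longest_permutes[OF I(1)] and wJ = longest_permutes[OF J(1)]
  have "root_indices n J \<subseteq> root_indices n I"
  proof
    fix k assume k: "k \<in> root_indices n J"
    show "k \<in> root_indices n I"
    proof (rule ccontr)
      assume kI: "k \<notin> root_indices n I"
      have kn: "k \<in> {1..<n}" using k by (simp add: root_indices_def)
      then have "longest n I ` {1..k} = {1..k}"
        using is_block_reversal_longest[OF I(1)] kI unfolding is_block_reversal_def
        by (meson atLeastLessThan_iff less_imp_le)
      then have sub: "longest n J ` {1..k} \<subseteq> {1..k}"
        using opposite_cell_meets_cell[OF hessenberg_GL[OF g(1)] wI wJ I(2) J(2)] kn
        by (meson atLeastLessThan_iff less_imp_le)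
      have "inj_on (longest n J) {1..k}"
        using permutes_inj[OF wJ] by (rule inj_on_subset) simp
      then have "card (longest n J ` {1..k}) = card {1..k}" by (rule card_image)
      then have "longest n J ` {1..k} = {1..k}" using sub by (intro card_subset_eq) auto
      moreover have "root_indices n J \<subseteq> {1..<n}" unfolding root_indices_def by blast
      ultimately show False
        using block_reversal_indices[OF _ is_block_reversal_longest[OF J(1)]] k by blast
    qed
  qed
  then have "J \<subseteq> I" using root_indices_mono_iff[OF J(1)] by blast
  then show ?thesis using that[OF _ I(1)] I(2) J(2) x unfolding Y0_def g(2) by blast
qed

lemma Y0_disjoint:
  assumes "I \<subseteq> simple_roots n" "J \<subseteq> simple_roots n" "I' \<subseteq> simple_roots n" "J' \<subseteq> simple_roots n"
    and x: "x \<in> Y0 n I J" "x \<in> Y0 n I' J'"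
  shows "I = I' \<and> J = J'"
proof -
  have "x \<in> Pet n" using x by (simp add: Y0_def)
  then obtain g where g: "g \<in> hessenberg_matrices n" "x = flag_point n g" by (rule Pet_cases)
  have "longest n I = longest n I'"
    by (rule upper.cell_disjoint[OF hessenberg_GL[OF g(1)] longest_permutes[OF assms(1)]
          longest_permutes[OF assms(3)], folded Borel_eq])
      (use x in \<open>simp_all only: Y0_def Int_iff g(2)\<close>)
  moreover have "longest n J = longest n J'"
    by (rule lower.cell_disjoint[OF hessenberg_GL[OF g(1)] longest_permutes[OF assms(2)]
          longest_permutes[OF assms(4)], folded Borel_opp_eq])
      (use x in \<open>simp_all only: Y0_def Int_iff g(2)\<close>)
  ultimately show ?thesis using longest_inj assms by blast
qed

lemma Y0_diagonal:
  assumes I: "I \<subseteq> simple_roots n"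
  shows "Y0 n I I = {fixed_point n I}"
proof -
  let ?w = "longest n I"
  note w = longest_permutes[OF I]
  note P = perm_mat_GL[OF w]
  have "hessenberg_perm n ?w" using block_reversal_hessenberg[OF is_block_reversal_longest[OF I]] .
  then have "flag_point n (perm_mat n ?w) \<in> Pet n"
    using perm_mat_hessenberg[OF w] flag_point_Pet_iff[OF P] by blast
  moreover have "perm_mat n ?w = 1\<^sub>m n * perm_mat n ?w * 1\<^sub>m n" by simp
  then have "flag_point n (perm_mat n ?w) \<in> cell n (Borel n) ?w"
    "flag_point n (perm_mat n ?w) \<in> cell n (Borel_opp n) ?w"
    using upper.cell_iff[OF w P] lower.cell_iff[OF w P] upper.triangular_one lower.triangular_one
    unfolding Borel_eq Borel_opp_eq by blast+
  ultimately have "fixed_point n I \<in> Y0 n I I"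
    unfolding Y0_def fixed_point_def by blast
  moreover have "x = fixed_point n I" if x: "x \<in> Y0 n I I" for x
  proof -
    have "x \<in> Pet n" using x by (simp add: Y0_def)
    then obtain g where g: "g \<in> hessenberg_matrices n" "x = flag_point n g" by (rule Pet_cases)
    then show ?thesis
      using cell_inter_opposite_cell[OF hessenberg_GL[OF g(1)] w] x
      unfolding Y0_def fixed_point_def by blast
  qed
  ultimately show ?thesis by blast
qed

section \<open>Flag minors\<close>

lemma regular_sum:
  "(\<And>a. a \<in> S \<Longrightarrow> F a \<in> regular_functions n) \<Longrightarrow> (\<lambda>g. \<Sum>a\<in>S. F a g) \<in> regular_functions n"
proof (induction S rule: infinite_finite_induct)
  case (insert a S)
  have "(\<lambda>g. F a g + (\<Sum>a\<in>S. F a g)) \<in> regular_functions n"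
    by (rule regular_functions.add) (use insert in auto)
  then show ?case using insert by simp
qed (simp_all add: regular_functions.const)

lemma regular_prod:
  "(\<And>a. a \<in> S \<Longrightarrow> F a \<in> regular_functions n) \<Longrightarrow> (\<lambda>g. \<Prod>a\<in>S. F a g) \<in> regular_functions n"
proof (induction S rule: infinite_finite_induct)
  case (insert a S)
  have "(\<lambda>g. F a g * (\<Prod>a\<in>S. F a g)) \<in> regular_functions n"
    by (rule regular_functions.mult) (use insert in auto)
  then show ?case using insert by simp
qed (simp_all add: regular_functions.const)

lemma regular_power:
  assumes "f \<in> regular_functions n"
  shows "(\<lambda>g. f g ^ k) \<in> regular_functions n"
proof (induction k)
  case (Suc k)
  have "(\<lambda>g. f g * f g ^ k) \<in> regular_functions n" using assms Suc by (rule regular_functions.mult)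
  then show ?case by simp
qed (simp add: regular_functions.const)

lemma regular_cmult: "f \<in> regular_functions n \<Longrightarrow> (\<lambda>g. c * f g) \<in> regular_functions n"
  using regular_functions.mult[OF regular_functions.const[of c]] by simp

text \<open>The minor on the first \<open>k\<close> columns, with rows listed by \<open>\<rho>\<close>: a Pluecker coordinate of step \<open>k\<close> of the flag.\<close>

definition flag_minor :: "nat \<Rightarrow> (nat \<Rightarrow> nat) \<Rightarrow> complex mat \<Rightarrow> complex" where
  "flag_minor k \<rho> g = det (mat k k (\<lambda>(i, j). g $$ (\<rho> i, j)))"

lemma flag_minor_regular:
  assumes "k \<le> n" "\<And>i. i < k \<Longrightarrow> \<rho> i < n"
  shows "flag_minor k \<rho> \<in> regular_functions n"
proof -
  have "flag_minor k \<rho> =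
    (\<lambda>g. \<Sum>p\<in>{p. p permutes {0..<k}}. signof p * (\<Prod>i = 0..<k. g $$ (\<rho> i, p i)))"
  proof
    fix g :: "complex mat"
    have "flag_minor k \<rho> g = (\<Sum>p\<in>{p. p permutes {0..<k}}. signof p *
        (\<Prod>i = 0..<k. mat k k (\<lambda>(i, j). g $$ (\<rho> i, j)) $$ (i, p i)))"
      unfolding flag_minor_def by (rule det_def') simp
    also have "\<dots> = (\<Sum>p\<in>{p. p permutes {0..<k}}. signof p * (\<Prod>i = 0..<k. g $$ (\<rho> i, p i)))"
    proof (intro sum.cong prod.cong refl arg_cong2[where f = "(*)"])
      fix p i assume p: "p \<in> {p. p permutes {0..<k}}" and i: "i \<in> {0..<k}"
      have "p i < k" using p i permutes_in_image[of p "{0..<k}" i] by simp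
      then show "mat k k (\<lambda>(i, j). g $$ (\<rho> i, j)) $$ (i, p i) = g $$ (\<rho> i, p i)" using i by simp
    qed
    finally show "flag_minor k \<rho> g =
      (\<Sum>p\<in>{p. p permutes {0..<k}}. signof p * (\<Prod>i = 0..<k. g $$ (\<rho> i, p i)))" .
  qed
  also have "\<dots> \<in> regular_functions n"
  proof (intro regular_sum regular_cmult regular_prod regular_functions.entry)
    fix p i assume p: "p \<in> {p. p permutes {0..<k}}" and i: "i \<in> {0..<k}"
    have "p i < k" using p i permutes_in_image[of p "{0..<k}" i] by simp
    then show "\<rho> i < n" "p i < n" using i assms by auto
  qed
  finally show ?thesis .
qed

lemma flag_minor_mult_upper:
  assumes g: "g \<in> carrier_mat n n" and b: "b \<in> Borel n" and k: "k \<le> n"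
    and \<rho>: "\<And>i. i < k \<Longrightarrow> \<rho> i < n"
  shows "flag_minor k \<rho> (g * b) = flag_minor k \<rho> g * (\<Prod>i<k. b $$ (i, i))"
proof -
  let ?G = "mat k k (\<lambda>(i, j). g $$ (\<rho> i, j))" and ?B = "mat k k (\<lambda>(i, j). b $$ (i, j))"
  have bM: "b \<in> carrier_mat n n" by (rule GL_carrier_mat[OF Borel_GL[OF b]])
  have "mat k k (\<lambda>(i, j). (g * b) $$ (\<rho> i, j)) = ?G * ?B"
  proof (rule eq_matI)
    fix i j assume "i < dim_row (?G * ?B)" "j < dim_col (?G * ?B)"
    then have ij: "i < k" "j < k" by auto
    have "(g * b) $$ (\<rho> i, j) = (\<Sum>l<n. g $$ (\<rho> i, l) * b $$ (l, j))"
      by (rule mult_entry[OF g bM]) (use ij \<rho> k in auto)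
    also have "\<dots> = (\<Sum>l<k. g $$ (\<rho> i, l) * b $$ (l, j))"
    proof (rule sum.mono_neutral_right)
      show "\<forall>l\<in>{..<n} - {..<k}. g $$ (\<rho> i, l) * b $$ (l, j) = 0"
      proof
        fix l assume l: "l \<in> {..<n} - {..<k}"
        then have "\<not> l \<le> j" using ij by simp
        then have "b $$ (l, j) = 0" using BorelD[OF b, of l j] l ij k by auto
        then show "g $$ (\<rho> i, l) * b $$ (l, j) = 0" by simp
      qed
    qed (use k in auto)
    also have "\<dots> = (\<Sum>l<k. ?G $$ (i, l) * ?B $$ (l, j))" using ij by simp
    also have "\<dots> = (?G * ?B) $$ (i, j)" by (rule mult_entry[symmetric]) (use ij in auto)
    finally show "mat k k (\<lambda>(i, j). (g * b) $$ (\<rho> i, j)) $$ (i, j) = (?G * ?B) $$ (i, j)"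
      using ij by simp
  qed auto
  then have "flag_minor k \<rho> (g * b) = flag_minor k \<rho> g * det ?B"
    unfolding flag_minor_def using det_mult[of ?G k ?B] by (simp only: mat_carrier)
  also have "det ?B = (\<Prod>i<k. ?B $$ (i, i))"
  proof (rule upper.det_triangular)
    fix i j assume "i < k" "j < k" "?B $$ (i, j) \<noteq> 0"
    then show "i \<le> j" using BorelD[OF b, of i j] k by auto
  qed simp
  also have "\<dots> = (\<Prod>i<k. b $$ (i, i))" by simp
  finally show ?thesis .
qed

lemma flag_minor_scale_rows:
  assumes "\<And>i j. i < k \<Longrightarrow> j < k \<Longrightarrow> h $$ (\<rho> i, j) = c (\<rho> i) * g $$ (\<rho> i, j)"
  shows "flag_minor k \<rho> h = (\<Prod>i<k. c (\<rho> i)) * flag_minor k \<rho> g"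
proof -
  let ?G = "mat k k (\<lambda>(i, j). g $$ (\<rho> i, j))"
  have "mat k k (\<lambda>(i, j). h $$ (\<rho> i, j)) = mat_diag k (\<lambda>i. c (\<rho> i)) * ?G"
    by (subst mat_diag_mult_left[of _ k k]) (auto intro!: eq_matI simp: assms)
  moreover have "det (mat_diag k (\<lambda>i. c (\<rho> i))) = (\<Prod>i<k. c (\<rho> i))"
  proof (subst upper.det_triangular)
    show "(\<Prod>i<k. mat_diag k (\<lambda>i. c (\<rho> i)) $$ (i, i)) = (\<Prod>i<k. c (\<rho> i))"
      by (rule prod.cong) (auto simp: mat_diag_def)
  qed (auto simp: mat_diag_def split: if_splits)
  ultimately show ?thesis
    unfolding flag_minor_def by (simp add: det_mult[of _ k ?G])
qed

text \<open>In the rows \<open>w 1, ..., w k\<close>, the first \<open>k\<close> columns of \<open>b\<close> times the permutation matrix form a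
  principal submatrix of \<open>b\<close> in a permuted order, and \<open>det_comparable\<close> applies with \<open>w\<close> as the key.\<close>

lemma (in triangular_direction) flag_minor_cell:
  assumes b: "b \<in> triangular R n" and w: "w permutes {1..n}" and c: "c \<in> Borel n" and k: "k \<le> n"
  shows "flag_minor k (perm_shift w) (b * perm_mat n w * c) \<noteq> 0"
proof -
  let ?\<sigma> = "perm_shift w"
  have bM: "b \<in> carrier_mat n n" by (rule GL_carrier_mat[OF triangular_GL[OF b]])
  have bP: "b * perm_mat n w \<in> carrier_mat n n" by (rule square_mult[OF bM perm_mat_carrier])
  have \<sigma>: "?\<sigma> i < n" if "i < k" for i using that k perm_shift_less[OF w] by simp
  let ?A = "mat k k (\<lambda>(i, j). (b * perm_mat n w) $$ (?\<sigma> i, j))"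
  have entry: "?A $$ (i, j) = b $$ (?\<sigma> i, ?\<sigma> j)" if "i < k" "j < k" for i j
    using that k \<sigma> mult_perm_mat_entry[OF w bM \<sigma>[OF that(1)], of j] by simp
  have "det ?A = (\<Prod>i<k. ?A $$ (i, i))"
  proof (rule det_comparable)
    show "inj_on ?\<sigma> {..<k}" using perm_shift_inj[OF w] by (simp add: inj_on_def)
    show "R (?\<sigma> i) (?\<sigma> j)" if "i < k" "j < k" "?A $$ (i, j) \<noteq> 0" for i j
      using triangularD[OF b \<sigma>[OF that(1)] \<sigma>[OF that(2)]] that(3) unfolding entry[OF that(1,2)] .
  qed simp
  also have "\<dots> \<noteq> 0"
    using triangular_diag[OF b \<sigma>] by (simp add: entry del: index_mat(1))
  finally have "flag_minor k ?\<sigma> (b * perm_mat n w) \<noteq> 0" by (simp add: flag_minor_def)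
  moreover have "(\<Prod>i<k. c $$ (i, i)) \<noteq> 0" using Borel_diag[OF c] k by simp
  ultimately show ?thesis using flag_minor_mult_upper[OF bP c k \<sigma>] by simp
qed

section \<open>The cocharacter and the characters of the Borel subgroup\<close>

lemma cochar_carrier [simp]: "cochar n t \<in> carrier_mat n n"
  by (simp add: cochar_def)

lemma cochar_mult_entry:
  "A \<in> carrier_mat n n \<Longrightarrow> i < n \<Longrightarrow> j < n \<Longrightarrow> (cochar n t * A) $$ (i, j) = t ^ Suc i * A $$ (i, j)"
  unfolding cochar_def by (subst mat_diag_mult_left[of _ n n]) auto

lemma mult_cochar_entry:
  "A \<in> carrier_mat n n \<Longrightarrow> i < n \<Longrightarrow> j < n \<Longrightarrow> (A * cochar n t) $$ (i, j) = A $$ (i, j) * t ^ Suc j"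
  unfolding cochar_def by (subst mat_diag_mult_right[of _ n n]) auto

lemma cochar_Borel: "t \<noteq> 0 \<Longrightarrow> cochar n t \<in> Borel n"
  unfolding Borel_eq cochar_def
  by (rule upper.triangularI) (auto simp: mat_diag_def split: if_splits)

lemma cochar_GL: "t \<noteq> 0 \<Longrightarrow> cochar n t \<in> carrier (GLn n)"
  by (rule Borel_GL[OF cochar_Borel])

lemma det_cochar: "det (cochar n t) = (\<Prod>i<n. t ^ Suc i)"
proof -
  have "det (cochar n t) = (\<Prod>i<n. cochar n t $$ (i, i))"
    by (rule upper.det_triangular) (auto simp: cochar_def mat_diag_def split: if_splits)
  then show ?thesis by (simp add: cochar_def mat_diag_def)
qed

text \<open>Conjugation by the one-parameter group multiplies \<open>nilp n\<close> by a scalar.\<close>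

lemma hessenberg_cochar:
  assumes g: "g \<in> hessenberg_matrices n" and t: "t \<noteq> 0"
  shows "cochar n t * g \<in> hessenberg_matrices n"
proof -
  let ?c = "cochar n t"
  have gG: "g \<in> carrier (GLn n)" and cG: "?c \<in> carrier (GLn n)"
    using g t by (auto intro: hessenberg_GL cochar_GL)
  note M = GL_carrier_mat[OF gG] cochar_carrier[of n t] GL_carrier_mat[OF GL_inv[OF gG]]
    GL_carrier_mat[OF GL_inv[OF cG]] nilp_carrier[of n]
  have "nilp n * ?c = t \<cdot>\<^sub>m (?c * nilp n)"
  proof (rule eq_matI)
    fix i j assume "i < dim_row (t \<cdot>\<^sub>m (?c * nilp n))" "j < dim_col (t \<cdot>\<^sub>m (?c * nilp n))"
    then have ij: "i < n" "j < n" by (auto simp: cochar_def mat_diag_def nilp_def)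
    have "(t \<cdot>\<^sub>m (?c * nilp n)) $$ (i, j) = t * (?c * nilp n) $$ (i, j)"
      using ij by (simp add: cochar_def mat_diag_def nilp_def)
    then show "(nilp n * ?c) $$ (i, j) = (t \<cdot>\<^sub>m (?c * nilp n)) $$ (i, j)"
      using ij mult_cochar_entry[OF nilp_carrier ij] cochar_mult_entry[OF nilp_carrier ij]
      by (simp add: nilp_def)
  qed (auto simp: cochar_def mat_diag_def nilp_def)
  then have "inv\<^bsub>GLn n\<^esub> ?c * (nilp n * (?c * g)) = inv\<^bsub>GLn n\<^esub> ?c * ((t \<cdot>\<^sub>m (?c * nilp n)) * g)"
    using M by (simp add: square_assoc[of _ n, symmetric])
  also have "\<dots> = t \<cdot>\<^sub>m (inv\<^bsub>GLn n\<^esub> ?c * ?c * (nilp n * g))"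
    using M by (simp add: square_assoc[of _ n] square_mult mult_smult_assoc_mat[of _ n n _ n]
        mult_smult_distrib[of _ n n _ n])
  also have "inv\<^bsub>GLn n\<^esub> ?c * ?c = 1\<^sub>m n" by (rule GL_inv_mult[OF cG])
  finally have conj: "inv\<^bsub>GLn n\<^esub> ?c * (nilp n * (?c * g)) = t \<cdot>\<^sub>m (nilp n * g)"
    using M by (simp add: square_mult)
  have "inv\<^bsub>GLn n\<^esub> (?c * g) * nilp n * (?c * g) = inv\<^bsub>GLn n\<^esub> g * (inv\<^bsub>GLn n\<^esub> ?c * (nilp n * (?c * g)))"
    unfolding GL_inv_of_mult[OF cG gG] using M by (simp add: square_assoc[of _ n] square_mult)
  also have "\<dots> = t \<cdot>\<^sub>m (inv\<^bsub>GLn n\<^esub> g * nilp n * g)"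
    unfolding conj using M by (simp add: square_assoc[of _ n] square_mult mult_smult_distrib[of _ n n _ n])
  finally have eq: "inv\<^bsub>GLn n\<^esub> (?c * g) * nilp n * (?c * g) = t \<cdot>\<^sub>m (inv\<^bsub>GLn n\<^esub> g * nilp n * g)" .
  have NM: "inv\<^bsub>GLn n\<^esub> g * nilp n * g \<in> carrier_mat n n" using M by (intro square_mult)
  have "(t \<cdot>\<^sub>m (inv\<^bsub>GLn n\<^esub> g * nilp n * g)) $$ (i, j) = 0" if "i < n" "j < n" "i > j + 1" for i j
  proof -
    have "(inv\<^bsub>GLn n\<^esub> g * nilp n * g) $$ (i, j) = 0" using hessenbergD[OF g that(1,2)] that(3) by auto
    then show ?thesis using that NM by (subst index_smult_mat) auto
  qed
  then have "\<forall>i<n. \<forall>j<n. i > j + 1 \<longrightarrow>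
      (inv\<^bsub>GLn n\<^esub> (?c * g) * nilp n * (?c * g)) $$ (i, j) = 0"
    unfolding eq by blast
  then show ?thesis unfolding hessenberg_matrices_def using GL_mult[OF cG gG] by blast
qed

lemma char_val_nonzero: "b \<in> Borel n \<Longrightarrow> char_val n \<chi> b \<noteq> 0"
  unfolding char_val_def using Borel_diag[of b n] by simp

lemma Borel_mult_diag:
  assumes b: "b \<in> Borel n" and c: "c \<in> Borel n" and i: "i < n"
  shows "(b * c) $$ (i, i) = b $$ (i, i) * c $$ (i, i)"
proof (rule mult_entry_single)
  fix l assume "l < n" "l \<noteq> i"
  then show "b $$ (i, l) = 0 \<or> c $$ (l, i) = 0"
    using BorelD[OF b i, of l] BorelD[OF c, of l i] i by fastforce
qed (use b c i in \<open>auto intro: GL_carrier_mat Borel_GL\<close>)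

lemma char_val_mult:
  assumes "b \<in> Borel n" "c \<in> Borel n"
  shows "char_val n \<chi> (b * c) = char_val n \<chi> b * char_val n \<chi> c"
  unfolding char_val_def prod.distrib[symmetric]
  by (rule prod.cong) (simp_all add: Borel_mult_diag[OF assms] power_int_mult_distrib)

lemma char_val_one: "char_val n \<chi> (1\<^sub>m n) = 1"
  by (simp add: char_val_def)

lemma char_val_uminus: "char_val n (\<lambda>i. - \<chi> i) b = inverse (char_val n \<chi> b)"
  by (simp add: char_val_def power_int_minus prod_inversef[symmetric] comp_def)

lemma char_val_multiple: "char_val n (\<lambda>i. int m * \<chi> i) b = char_val n \<chi> b ^ m"
  unfolding char_val_def prod_power_distrib
  by (rule prod.cong) (simp_all add: power_int_mult mult.commute[of "int m"])

section \<open>Products of flag minors as sections\<close>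

text \<open>The fundamental weight \<open>\<omega>\<^sub>k\<close> occurs in \<open>\<chi>\<close> with multiplicity \<open>\<chi>\<^sub>k - \<chi>\<^bsub>k+1\<^esub>\<close>, which is the number of
  minors of size \<open>k\<close> in the product; \<open>sel k m\<close> lists the rows of the \<open>m\<close>-th of them. The last factor is the power of
  the determinant with exponent \<open>\<chi>\<^sub>n\<close>. Its positive part is written as a minor, which is polynomial in the
  entries for matrices of any size.\<close>

definition minor_product ::
    "nat \<Rightarrow> (nat \<Rightarrow> int) \<Rightarrow> (nat \<Rightarrow> nat \<Rightarrow> nat \<Rightarrow> nat) \<Rightarrow> complex mat \<Rightarrow> complex" where
  "minor_product n \<chi> sel g =
     (\<Prod>k\<in>{1..<n}. \<Prod>m<nat (\<chi> k - \<chi> (Suc k)). flag_minor k (sel k m) g) *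
     (flag_minor n (\<lambda>i. i) g ^ nat (\<chi> n) * inverse (det g) ^ nat (- \<chi> n))"

definition minor_weight :: "nat \<Rightarrow> (nat \<Rightarrow> int) \<Rightarrow> (nat \<Rightarrow> nat \<Rightarrow> nat \<Rightarrow> nat) \<Rightarrow> int" where
  "minor_weight n \<chi> sel =
     (\<Sum>k\<in>{1..<n}. \<Sum>m<nat (\<chi> k - \<chi> (Suc k)). \<Sum>i<k. int (Suc (sel k m i))) +
     \<chi> n * (\<Sum>i<n. int (Suc i))"

text \<open>Abel summation, in additive and in multiplicative form, converts between the multiplicities of the
  fundamental weights in \<open>\<chi>\<close> and the coefficients of \<open>\<chi>\<close>.\<close>

lemma summation_by_parts:
  fixes f :: "nat \<Rightarrow> int"
  shows "(\<Sum>k\<in>{1..<n}. (\<chi> k - \<chi> (Suc k)) * (\<Sum>i<k. f i)) + \<chi> n * (\<Sum>i<n. f i) = (\<Sum>i<n. \<chi> (Suc i) * f i)"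
proof (induction n)
  case (Suc n)
  show ?case
  proof (cases "n = 0")
    case False
    then have "{1..<Suc n} = insert n {1..<n}" by auto
    then show ?thesis using Suc False by (simp add: algebra_simps)
  qed simp
qed simp

lemma product_by_parts:
  fixes \<beta> :: "nat \<Rightarrow> complex"
  assumes "\<And>i. i < n \<Longrightarrow> \<beta> i \<noteq> 0"
  shows "(\<Prod>k\<in>{1..<n}. (\<Prod>i<k. \<beta> i) powi (\<chi> k - \<chi> (Suc k))) * (\<Prod>i<n. \<beta> i) powi \<chi> n =
    (\<Prod>i<n. \<beta> i powi \<chi> (Suc i))"
  using assms
proof (induction n)
  case (Suc n)
  show ?case
  proof (cases "n = 0")
    case False
    then have *: "{1..<Suc n} = insert n {1..<n}" by auto
    let ?B = "\<Prod>i<n. \<beta> i" and ?A = "\<Prod>k\<in>{1..<n}. (\<Prod>i<k. \<beta> i) powi (\<chi> k - \<chi> (Suc k))"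
    have B: "?B \<noteq> 0" using Suc.prems by simp
    have "(\<Prod>k\<in>{1..<Suc n}. (\<Prod>i<k. \<beta> i) powi (\<chi> k - \<chi> (Suc k))) * (\<Prod>i<Suc n. \<beta> i) powi \<chi> (Suc n) =
      ?A * (?B powi (\<chi> n - \<chi> (Suc n)) * ?B powi \<chi> (Suc n)) * \<beta> n powi \<chi> (Suc n)"
      unfolding * by (simp add: power_int_mult_distrib)
    also have "?B powi (\<chi> n - \<chi> (Suc n)) * ?B powi \<chi> (Suc n) = ?B powi \<chi> n"
      using B by (simp add: power_int_add[symmetric])
    also have "?A * ?B powi \<chi> n = (\<Prod>i<n. \<beta> i powi \<chi> (Suc i))" using Suc by simp
    finally show ?thesis by simp
  qed simp
qed simp

lemma powi_nat_split: "(x::complex) ^ nat m * inverse x ^ nat (- m) = x powi m"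
  by (cases "m \<ge> 0") (auto simp: power_int_def)

lemma powi_nat_diff: "m \<ge> 0 \<Longrightarrow> (x::complex) ^ nat m = x powi m"
  by (simp add: power_int_def)

lemma flag_minor_full: "g \<in> carrier_mat n n \<Longrightarrow> flag_minor n (\<lambda>i. i) g = det g"
  unfolding flag_minor_def by (rule arg_cong[of _ _ det]) (auto intro!: eq_matI)

lemma minor_product_regular:
  assumes "\<And>k m i. k \<in> {1..<n} \<Longrightarrow> m < nat (\<chi> k - \<chi> (Suc k)) \<Longrightarrow> i < k \<Longrightarrow> sel k m i < n"
  shows "minor_product n \<chi> sel \<in> regular_functions n"
  unfolding minor_product_def
  by (intro regular_functions.mult regular_prod regular_power regular_functions.inverse_det
      flag_minor_regular) (use assms in auto)

lemma minor_product_Borel: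
  assumes g: "g \<in> carrier_mat n n" and b: "b \<in> Borel n" and dom: "regular_dominant n \<chi>"
    and sel: "\<And>k m i. k \<in> {1..<n} \<Longrightarrow> m < nat (\<chi> k - \<chi> (Suc k)) \<Longrightarrow> i < k \<Longrightarrow> sel k m i < n"
  shows "minor_product n \<chi> sel (g * b) = char_val n \<chi> b * minor_product n \<chi> sel g"
proof -
  let ?\<beta> = "\<lambda>i. b $$ (i, i)"
  have bM: "b \<in> carrier_mat n n" by (rule GL_carrier_mat[OF Borel_GL[OF b]])
  have detb: "det b = (\<Prod>i<n. ?\<beta> i)" using upper.triangular_det b unfolding Borel_eq by blast
  have c_nonneg: "\<chi> k - \<chi> (Suc k) \<ge> 0" if "k \<in> {1..<n}" for k
  proof -
    have "1 \<le> k \<and> k < Suc k \<and> Suc k \<le> n" using that by auto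
    then show ?thesis using dom unfolding regular_dominant_def by fastforce
  qed
  have "(\<Prod>k\<in>{1..<n}. \<Prod>m<nat (\<chi> k - \<chi> (Suc k)). flag_minor k (sel k m) (g * b)) =
    (\<Prod>k\<in>{1..<n}. (\<Prod>m<nat (\<chi> k - \<chi> (Suc k)). flag_minor k (sel k m) g) * (\<Prod>i<k. ?\<beta> i) powi (\<chi> k - \<chi> (Suc k)))"
  proof (rule prod.cong[OF refl])
    fix k assume k: "k \<in> {1..<n}"
    have "(\<Prod>m<nat (\<chi> k - \<chi> (Suc k)). flag_minor k (sel k m) (g * b)) =
      (\<Prod>m<nat (\<chi> k - \<chi> (Suc k)). flag_minor k (sel k m) g * (\<Prod>i<k. ?\<beta> i))"
      by (rule prod.cong[OF refl], rule flag_minor_mult_upper[OF g b]) (use k sel in auto)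
    then show "(\<Prod>m<nat (\<chi> k - \<chi> (Suc k)). flag_minor k (sel k m) (g * b)) =
      (\<Prod>m<nat (\<chi> k - \<chi> (Suc k)). flag_minor k (sel k m) g) * (\<Prod>i<k. ?\<beta> i) powi (\<chi> k - \<chi> (Suc k))"
      by (simp add: prod.distrib powi_nat_diff[OF c_nonneg[OF k]])
  qed
  moreover have "flag_minor n (\<lambda>i. i) (g * b) ^ nat (\<chi> n) * inverse (det (g * b)) ^ nat (- \<chi> n) =
    flag_minor n (\<lambda>i. i) g ^ nat (\<chi> n) * inverse (det g) ^ nat (- \<chi> n) * (\<Prod>i<n. ?\<beta> i) powi \<chi> n"
    unfolding flag_minor_full[OF g] flag_minor_full[OF square_mult[OF g bM]] det_mult[OF g bM] detb
      powi_nat_split by (rule power_int_mult_distrib)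
  ultimately have "minor_product n \<chi> sel (g * b) = minor_product n \<chi> sel g *
    ((\<Prod>k\<in>{1..<n}. (\<Prod>i<k. ?\<beta> i) powi (\<chi> k - \<chi> (Suc k))) * (\<Prod>i<n. ?\<beta> i) powi \<chi> n)"
    unfolding minor_product_def by (simp add: prod.distrib)
  then show ?thesis
    unfolding char_val_def using product_by_parts[of n ?\<beta> \<chi>] Borel_diag[OF b] by simp
qed

lemma power_int_prod_sum:
  "(t::complex) \<noteq> 0 \<Longrightarrow> (\<Prod>a\<in>S. t powi f a) = t powi (\<Sum>a\<in>S. f a)"
  by (induction S rule: infinite_finite_induct) (auto simp: power_int_add)

lemma minor_product_cochar:
  assumes g: "g \<in> carrier_mat n n" and t: "t \<noteq> 0"
    and sel: "\<And>k m i. k \<in> {1..<n} \<Longrightarrow> m < nat (\<chi> k - \<chi> (Suc k)) \<Longrightarrow> i < k \<Longrightarrow> sel k m i < n"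
  shows "minor_product n \<chi> sel (cochar n t * g) = t powi minor_weight n \<chi> sel * minor_product n \<chi> sel g"
proof -
  have pw: "t ^ Suc i = t powi int (Suc i)" for i by (rule power_int_of_nat[symmetric])
  have "(\<Prod>k\<in>{1..<n}. \<Prod>m<nat (\<chi> k - \<chi> (Suc k)). flag_minor k (sel k m) (cochar n t * g)) =
    (\<Prod>k\<in>{1..<n}. \<Prod>m<nat (\<chi> k - \<chi> (Suc k)). t powi (\<Sum>i<k. int (Suc (sel k m i))) * flag_minor k (sel k m) g)"
  proof (intro prod.cong refl)
    fix k m assume km: "k \<in> {1..<n}" "m \<in> {..<nat (\<chi> k - \<chi> (Suc k))}"
    have "flag_minor k (sel k m) (cochar n t * g) = (\<Prod>i<k. t ^ Suc (sel k m i)) * flag_minor k (sel k m) g"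
      by (rule flag_minor_scale_rows, rule cochar_mult_entry[OF g]) (use km sel in auto)
    then show "flag_minor k (sel k m) (cochar n t * g) =
      t powi (\<Sum>i<k. int (Suc (sel k m i))) * flag_minor k (sel k m) g"
      unfolding pw by (simp only: power_int_prod_sum[OF t])
  qed
  also have "\<dots> = t powi (\<Sum>k\<in>{1..<n}. \<Sum>m<nat (\<chi> k - \<chi> (Suc k)). \<Sum>i<k. int (Suc (sel k m i))) *
    (\<Prod>k\<in>{1..<n}. \<Prod>m<nat (\<chi> k - \<chi> (Suc k)). flag_minor k (sel k m) g)"
    unfolding prod.distrib power_int_prod_sum[OF t] ..
  finally have 1: "(\<Prod>k\<in>{1..<n}. \<Prod>m<nat (\<chi> k - \<chi> (Suc k)). flag_minor k (sel k m) (cochar n t * g)) = \<dots>" .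
  have "det (cochar n t) = t powi (\<Sum>i<n. int (Suc i))"
    unfolding det_cochar pw power_int_prod_sum[OF t] ..
  then have "flag_minor n (\<lambda>i. i) (cochar n t * g) ^ nat (\<chi> n) * inverse (det (cochar n t * g)) ^ nat (- \<chi> n) =
    t powi (\<chi> n * (\<Sum>i<n. int (Suc i))) * (flag_minor n (\<lambda>i. i) g ^ nat (\<chi> n) * inverse (det g) ^ nat (- \<chi> n))"
    unfolding flag_minor_full[OF g] flag_minor_full[OF square_mult[OF cochar_carrier g]]
      det_mult[OF cochar_carrier g] powi_nat_split power_int_mult_distrib
    by (simp add: power_int_mult mult.commute[of "\<chi> n"])
  with 1 show ?thesis
    unfolding minor_product_def minor_weight_def using t by (simp add: power_int_add)
qed

lemma pairing_weyl_act:
  assumes w: "w permutes {1..n}"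
  shows "pairing n (weyl_act n w \<chi>) = (\<Sum>i<n. \<chi> (Suc i) * int (Suc (perm_shift w i)))"
proof -
  have "pairing n (weyl_act n w \<chi>) = (\<Sum>k=1..n. \<Sum>i=1..n. \<chi> i * (if k = w i then int k else 0))"
    unfolding pairing_def weyl_act_def coord_char_def
    by (auto simp: sum_distrib_left intro!: sum.cong)
  also have "\<dots> = (\<Sum>i=1..n. \<Sum>k=1..n. \<chi> i * (if k = w i then int k else 0))"
    by (rule sum.swap)
  also have "\<dots> = (\<Sum>i=1..n. \<chi> i * int (w i))"
  proof (rule sum.cong[OF refl])
    fix i assume "i \<in> {1..n}"
    then have "w i \<in> {1..n}" using permutes_in_image[OF w] by blast
    then show "(\<Sum>k=1..n. \<chi> i * (if k = w i then int k else 0)) = \<chi> i * int (w i)"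
      by (simp add: sum_distrib_left[symmetric])
  qed
  also have "\<dots> = (\<Sum>i<n. \<chi> (Suc i) * int (w (Suc i)))"
    using sum.atLeast1_atMost_eq[of "\<lambda>i. \<chi> i * int (w i)" n] by simp
  finally show ?thesis by (simp only: Suc_perm_shift[OF w])
qed

text \<open>The rows of the flag minors that are nonzero at the fixed point \<open>wB\<close>, one for each size.\<close>

definition extremal_rows :: "(nat \<Rightarrow> nat) \<Rightarrow> nat \<Rightarrow> nat \<Rightarrow> nat \<Rightarrow> nat" where
  "extremal_rows w k m = perm_shift w"

lemma minor_weight_extremal:
  assumes w: "w permutes {1..n}" and dom: "regular_dominant n \<chi>"
  shows "minor_weight n \<chi> (extremal_rows w) = pairing n (weyl_act n w \<chi>)"
proof -
  let ?f = "\<lambda>i. int (Suc (perm_shift w i))"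
  have 1: "(\<Sum>i<n. ?f i) = (\<Sum>i<n. int (Suc i))"
    using sum.permute[OF perm_shift_permutes[OF w], of "\<lambda>i. int (Suc i)"] by (simp add: comp_def)
  have 2: "(\<Sum>k\<in>{1..<n}. \<Sum>m<nat (\<chi> k - \<chi> (Suc k)). \<Sum>i<k. ?f i) =
    (\<Sum>k\<in>{1..<n}. (\<chi> k - \<chi> (Suc k)) * (\<Sum>i<k. ?f i))"
  proof (rule sum.cong[OF refl])
    fix k assume "k \<in> {1..<n}"
    then have "1 \<le> k \<and> k < Suc k \<and> Suc k \<le> n" by auto
    then have "\<chi> k > \<chi> (Suc k)" using dom unfolding regular_dominant_def by blast
    then show "(\<Sum>m<nat (\<chi> k - \<chi> (Suc k)). \<Sum>i<k. ?f i) = (\<chi> k - \<chi> (Suc k)) * (\<Sum>i<k. ?f i)"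
      by simp
  qed
  show ?thesis
    unfolding minor_weight_def extremal_rows_def pairing_weyl_act[OF w] 2 1[symmetric]
    by (rule summation_by_parts)
qed

lemma (in triangular_direction) minor_product_extremal_nonzero:
  assumes w: "w permutes {1..n}" and g: "g \<in> carrier (GLn n)"
    and cell: "flag_point n g \<in> cell n (triangular R n) w"
  shows "minor_product n \<chi> (extremal_rows w) g \<noteq> 0"
proof -
  obtain b c where bc: "b \<in> triangular R n" "c \<in> Borel n" "g = b * perm_mat n w * c"
    using cell cell_iff[OF w g] by blast
  have "flag_minor k (perm_shift w) g \<noteq> 0" if "k \<in> {1..<n}" for k
    unfolding bc(3) by (rule flag_minor_cell[OF bc(1) w bc(2)]) (use that in auto)
  moreover have "det g \<noteq> 0" using g by (simp add: GL_iff)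
  ultimately show ?thesis
    unfolding minor_product_def extremal_rows_def using flag_minor_full[OF GL_carrier_mat[OF g]] by auto
qed

section \<open>Semi-invariant functions and sections\<close>

text \<open>The transformation law under \<open>B\<close> makes \<open>f\<close> a section of the \<open>d\<close>-th power of the line bundle of \<open>\<chi>\<close> over the
  Peterson variety; \<open>r\<close> is the weight of the one-parameter group on it.\<close>

definition semi_invariant ::
    "nat \<Rightarrow> (nat \<Rightarrow> int) \<Rightarrow> nat \<Rightarrow> int \<Rightarrow> (complex mat \<Rightarrow> complex) \<Rightarrow> bool" where
  "semi_invariant n \<chi> d r f \<longleftrightarrow> f \<in> regular_functions n \<and>
     (\<forall>g\<in>hessenberg_matrices n. \<forall>t. \<forall>b\<in>Borel n. t \<noteq> 0 \<longrightarrow>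
        f (cochar n t * g * b) = t powi r * char_val n \<chi> b ^ d * f g)"

lemma semi_invariantD:
  "semi_invariant n \<chi> d r f \<Longrightarrow> g \<in> hessenberg_matrices n \<Longrightarrow> t \<noteq> 0 \<Longrightarrow> b \<in> Borel n \<Longrightarrow>
     f (cochar n t * g * b) = t powi r * char_val n \<chi> b ^ d * f g"
  by (simp add: semi_invariant_def)

lemma semi_invariant_one: "semi_invariant n \<chi> 0 0 (\<lambda>g. 1)"
  by (simp add: semi_invariant_def regular_functions.const)

lemma semi_invariant_mult:
  assumes "semi_invariant n \<chi> d r f" "semi_invariant n \<chi> d' r' f'"
  shows "semi_invariant n \<chi> (d + d') (r + r') (\<lambda>g. f g * f' g)"
  using assms unfolding semi_invariant_def
  by (auto simp: regular_functions.mult power_add power_int_add)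

lemma semi_invariant_power:
  assumes f: "semi_invariant n \<chi> d r f"
  shows "semi_invariant n \<chi> (k * d) (int k * r) (\<lambda>g. f g ^ k)"
proof (induction k)
  case 0
  show ?case using semi_invariant_one by simp
next
  case (Suc k)
  from semi_invariant_mult[OF f Suc] show ?case by (simp add: algebra_simps)
qed

text \<open>Powers with exponents \<open>- b\<close> and \<open>a\<close> cancel the weights \<open>a\<close> and \<open>b\<close>.\<close>

lemma semi_invariant_balanced:
  assumes M: "semi_invariant n \<chi> 1 a M" and M': "semi_invariant n \<chi> 1 b M'" and ab: "a \<ge> 0" "b \<le> 0"
  shows "semi_invariant n \<chi> (nat (- b) + nat a) 0 (\<lambda>u. M u ^ nat (- b) * M' u ^ nat a)"
proof -
  have "semi_invariant n \<chi> (nat (- b) * 1 + nat a * 1) (int (nat (- b)) * a + int (nat a) * b)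
      (\<lambda>u. M u ^ nat (- b) * M' u ^ nat a)"
    by (rule semi_invariant_mult[OF semi_invariant_power[OF M] semi_invariant_power[OF M']])
  moreover have "int (nat (- b)) * a + int (nat a) * b = 0" using ab by simp
  ultimately show ?thesis by simp
qed

lemma semi_invariant_minor_product:
  assumes dom: "regular_dominant n \<chi>"
    and sel: "\<And>k m i. k \<in> {1..<n} \<Longrightarrow> m < nat (\<chi> k - \<chi> (Suc k)) \<Longrightarrow> i < k \<Longrightarrow> sel k m i < n"
  shows "semi_invariant n \<chi> 1 (minor_weight n \<chi> sel) (minor_product n \<chi> sel)"
  unfolding semi_invariant_def
proof (intro conjI ballI allI impI)
  show "minor_product n \<chi> sel \<in> regular_functions n" by (rule minor_product_regular[OF sel])
  fix g t b assume g: "g \<in> hessenberg_matrices n" and b: "b \<in> Borel n" and t: "t \<noteq> (0::complex)"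
  have gM: "g \<in> carrier_mat n n" by (rule GL_carrier_mat[OF hessenberg_GL[OF g]])
  show "minor_product n \<chi> sel (cochar n t * g * b) =
    t powi minor_weight n \<chi> sel * char_val n \<chi> b ^ 1 * minor_product n \<chi> sel g"
    using minor_product_Borel[OF square_mult[OF cochar_carrier gM] b dom sel]
      minor_product_cochar[OF gM t sel] by simp
qed

lemma semi_invariant_extremal:
  assumes "regular_dominant n \<chi>" and w: "w permutes {1..n}"
  shows "semi_invariant n \<chi> 1 (pairing n (weyl_act n w \<chi>)) (minor_product n \<chi> (extremal_rows w))"
  unfolding minor_weight_extremal[OF w assms(1), symmetric]
  by (rule semi_invariant_minor_product[OF assms(1)]) (auto simp: extremal_rows_def perm_shift_less[OF w])

lemma bundle_point_self:
  assumes g: "g \<in> carrier (GLn n)"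
  shows "(g, v) \<in> bundle_point n \<chi> g v"
proof -
  have "inv\<^bsub>GLn n\<^esub> (1\<^sub>m n) = (1\<^sub>m n :: complex mat)"
    using monoid.inv_one[OF group.is_monoid[OF group_GLn[of n]]] by simp
  then have "(g, v) = (g * inv\<^bsub>GLn n\<^esub> (1\<^sub>m n), char_val n (\<lambda>i. - \<chi> i) (1\<^sub>m n) * v)"
    using GL_one_mult(2)[OF g] by (simp add: char_val_one)
  then show ?thesis unfolding bundle_point_def using Borel_one[of n] by blast
qed

lemma bundle_point_mult_Borel:
  assumes g: "g \<in> carrier (GLn n)" and b: "b \<in> Borel n"
  shows "bundle_point n \<chi> (g * b) (char_val n \<chi> b * v) = bundle_point n \<chi> g v"
proof -
  have "(g * b * inv\<^bsub>GLn n\<^esub> c, char_val n (\<lambda>i. - \<chi> i) c * (char_val n \<chi> b * v)) =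
    (g * inv\<^bsub>GLn n\<^esub> (c * inv\<^bsub>GLn n\<^esub> b), char_val n (\<lambda>i. - \<chi> i) (c * inv\<^bsub>GLn n\<^esub> b) * v)"
    if c: "c \<in> Borel n" for c
  proof -
    note G = Borel_GL[OF b] Borel_GL[OF c]
    have ib: "inv\<^bsub>GLn n\<^esub> b \<in> Borel n" by (rule Borel_inv[OF b])
    have "inv\<^bsub>GLn n\<^esub> (c * inv\<^bsub>GLn n\<^esub> b) = b * inv\<^bsub>GLn n\<^esub> c"
      using GL_inv_of_mult[OF G(2) GL_inv[OF G(1)]] group.inv_inv[OF group_GLn G(1)] by simp
    moreover have "char_val n \<chi> (inv\<^bsub>GLn n\<^esub> b) * char_val n \<chi> b = 1"
      using char_val_mult[OF ib b, of \<chi>] GL_inv_mult[OF G(1)] by (simp add: char_val_one)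
    then have "inverse (char_val n \<chi> (inv\<^bsub>GLn n\<^esub> b)) = char_val n \<chi> b"
      by (rule inverse_unique)
    ultimately show ?thesis
      using g G by (simp add: GL_assoc[of _ n] GL_inv char_val_uminus char_val_mult[OF c ib])
  qed
  moreover have "\<exists>c\<in>Borel n. d = c * inv\<^bsub>GLn n\<^esub> b" if d: "d \<in> Borel n" for d
    using GL_cancel(3)[OF Borel_GL[OF b] Borel_GL[OF d]] Borel_mult[OF d b] by metis
  ultimately show ?thesis
    unfolding bundle_point_def using Borel_mult[OF _ Borel_inv[OF b]] by (auto 4 4) metis+
qed

lemma bundle_point_inj:
  assumes g: "g \<in> carrier (GLn n)" and eq: "bundle_point n \<chi> g v = bundle_point n \<chi> g v'"
  shows "v = v'"
proof -
  have "(g, v) \<in> bundle_point n \<chi> g v'" using bundle_point_self[OF g, of v \<chi>] eq by simp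
  then obtain b where b: "b \<in> Borel n" "g = g * inv\<^bsub>GLn n\<^esub> b" "v = char_val n (\<lambda>i. - \<chi> i) b * v'"
    unfolding bundle_point_def by auto
  have "g * b = g" using b(2) GL_cancel(4)[OF Borel_GL[OF b(1)] g] by simp
  then have "b = inv\<^bsub>GLn n\<^esub> g * g" using GL_cancel(1)[OF g Borel_GL[OF b(1)]] by simp
  then have "b = 1\<^sub>m n" by (simp add: GL_inv_mult[OF g])
  then show ?thesis using b(3) by (simp add: char_val_one)
qed

lemma bundle_act_point:
  assumes h: "h \<in> carrier (GLn n)" and g: "g \<in> carrier (GLn n)"
  shows "bundle_act n h (bundle_point n \<chi> g v) = bundle_point n \<chi> (h * g) v"
proof -
  have assoc: "h * (g * inv\<^bsub>GLn n\<^esub> b) = h * g * inv\<^bsub>GLn n\<^esub> b" if "b \<in> Borel n" for b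
    by (rule GL_assoc[OF h g GL_inv[OF Borel_GL[OF that]], symmetric])
  show ?thesis
  proof (rule Set.set_eqI, rule iffI)
    fix p assume "p \<in> bundle_act n h (bundle_point n \<chi> g v)"
    then obtain q where q: "p = (case q of (g, v) \<Rightarrow> (h * g, v))" "q \<in> bundle_point n \<chi> g v"
      unfolding bundle_act_def by (rule imageE)
    obtain b where b: "b \<in> Borel n" "q = (g * inv\<^bsub>GLn n\<^esub> b, char_val n (\<lambda>i. - \<chi> i) b * v)"
      using q(2) unfolding bundle_point_def by blast
    have "p = (h * g * inv\<^bsub>GLn n\<^esub> b, char_val n (\<lambda>i. - \<chi> i) b * v)"
      unfolding q(1) b(2) prod.case assoc[OF b(1)] ..
    then show "p \<in> bundle_point n \<chi> (h * g) v"
      unfolding bundle_point_def using b(1) by blast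
  next
    fix p assume "p \<in> bundle_point n \<chi> (h * g) v"
    then obtain b where b: "b \<in> Borel n" "p = (h * g * inv\<^bsub>GLn n\<^esub> b, char_val n (\<lambda>i. - \<chi> i) b * v)"
      unfolding bundle_point_def by blast
    have "(g * inv\<^bsub>GLn n\<^esub> b, char_val n (\<lambda>i. - \<chi> i) b * v) \<in> bundle_point n \<chi> g v"
      unfolding bundle_point_def using b(1) by blast
    then have "(\<lambda>(g, v). (h * g, v)) (g * inv\<^bsub>GLn n\<^esub> b, char_val n (\<lambda>i. - \<chi> i) b * v) \<in>
        bundle_act n h (bundle_point n \<chi> g v)"
      unfolding bundle_act_def by (rule imageI)
    then show "p \<in> bundle_act n h (bundle_point n \<chi> g v)"
      unfolding b(2) assoc[OF b(1), symmetric] prod.case .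
  qed
qed

lemma G0_carrier: "carrier (G0 n) = cochar n ` (UNIV - {0})"
  by (simp add: G0_def)

lemma G0_cases:
  assumes "h \<in> carrier (G0 n)"
  obtains t where "t \<noteq> 0" "h = cochar n t"
proof -
  obtain t where "h = cochar n t" "t \<in> UNIV - {0}"
    using assms unfolding G0_carrier by (rule imageE)
  with that show ?thesis by simp
qed

text \<open>A section has the form \<open>s(gB) = [g, f(g)]\<close>. Equivariance of \<open>f\<close> under \<open>B\<close> says that \<open>s\<close> is well defined, and
  invariance of \<open>s\<close> says that \<open>f\<close> has weight \<open>0\<close>.\<close>

lemma semistable_iff:
  assumes g: "g \<in> hessenberg_matrices n"
  shows "flag_point n g \<in> semistable_locus n \<chi> \<longleftrightarrow>
    (\<exists>m>0. \<exists>f. semi_invariant n \<chi> m 0 f \<and> f g \<noteq> 0)"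
proof
  have gG: "g \<in> carrier (GLn n)" by (rule hessenberg_GL[OF g])
  assume "flag_point n g \<in> semistable_locus n \<chi>"
  then obtain m s where m: "m > 0" and inv: "is_invariant_section n (\<lambda>i. int m * \<chi> i) s"
    and nv: "\<not> vanishes_at n (\<lambda>i. int m * \<chi> i) s (flag_point n g)"
    unfolding semistable_locus_def by blast
  let ?\<psi> = "\<lambda>i. int m * \<chi> i"
  have inv1: "is_section n ?\<psi> s"
    and inv2: "\<And>h x. h \<in> carrier (G0 n) \<Longrightarrow> x \<in> Pet n \<Longrightarrow> s (flag_act n h x) = bundle_act n h (s x)"
    using inv unfolding is_invariant_section_def by blast+
  obtain f where f1: "f \<in> regular_functions n" and f0: "\<forall>h\<in>carrier (GLn n).
      flag_point n h \<in> Pet n \<longrightarrow> s (flag_point n h) = bundle_point n ?\<psi> h (f h)"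
    using inv1 unfolding is_section_def by (rule bexE)
  have f2: "s (flag_point n h) = bundle_point n ?\<psi> h (f h)" if h: "h \<in> hessenberg_matrices n" for h
    using f0 hessenberg_GL[OF h] flag_point_Pet_iff[OF hessenberg_GL[OF h]] h by simp
  note f = f1 f2
  have "f (cochar n t * h * b) = t powi 0 * char_val n \<chi> b ^ m * f h"
    if h: "h \<in> hessenberg_matrices n" and b: "b \<in> Borel n" and t: "t \<noteq> 0" for h t b
  proof -
    let ?h = "cochar n t * h"
    note hG = hessenberg_GL[OF h] and h' = hessenberg_cochar[OF h t]
    note hG' = hessenberg_GL[OF h'] and cG = cochar_GL[OF t, of n]
    have "bundle_point n ?\<psi> ?h (f ?h) = s (flag_act n (cochar n t) (flag_point n h))"
      using f(2)[OF h'] flag_act_point[OF cG hG] by simp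
    also have "\<dots> = bundle_act n (cochar n t) (s (flag_point n h))"
      by (rule inv2) (use h t flag_point_Pet_iff[OF hG] in \<open>simp_all add: G0_carrier\<close>)
    also have "\<dots> = bundle_point n ?\<psi> ?h (f h)"
      unfolding f(2)[OF h] by (rule bundle_act_point[OF cG hG])
    finally have 1: "f ?h = f h" by (rule bundle_point_inj[OF hG'])
    have hb: "?h * b \<in> hessenberg_matrices n" by (rule hessenberg_mult_Borel[OF h' b])
    have "bundle_point n ?\<psi> (?h * b) (f (?h * b)) = s (flag_point n (?h * b))"
      using f(2)[OF hb] by simp
    also have "\<dots> = bundle_point n ?\<psi> ?h (f ?h)"
      unfolding flag_point_mult_Borel[OF hG' b] by (rule f(2)[OF h'])
    also have "\<dots> = bundle_point n ?\<psi> (?h * b) (char_val n ?\<psi> b * f ?h)"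
      by (rule bundle_point_mult_Borel[OF hG' b, symmetric])
    finally have "f (?h * b) = char_val n ?\<psi> b * f ?h" by (rule bundle_point_inj[OF hessenberg_GL[OF hb]])
    then show ?thesis by (simp add: 1 char_val_multiple)
  qed
  then have "semi_invariant n \<chi> m 0 f" unfolding semi_invariant_def using f(1) by simp
  moreover have "f g \<noteq> 0"
  proof
    assume "f g = 0"
    then have "s (flag_point n g) = bundle_point n ?\<psi> g 0" using f(2)[OF g] by simp
    then have "vanishes_at n ?\<psi> s (flag_point n g)"
      unfolding vanishes_at_def using flag_point_self[OF gG] by (rule bexI)
    with nv show False ..
  qed
  ultimately show "\<exists>m>0. \<exists>f. semi_invariant n \<chi> m 0 f \<and> f g \<noteq> 0" using m by blast
next
  have gG: "g \<in> carrier (GLn n)" by (rule hessenberg_GL[OF g])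
  assume "\<exists>m>0. \<exists>f. semi_invariant n \<chi> m 0 f \<and> f g \<noteq> 0"
  then obtain m f where m: "m > 0" and f: "semi_invariant n \<chi> m 0 f" and nz: "f g \<noteq> 0" by blast
  let ?\<psi> = "\<lambda>i. int m * \<chi> i"
  define rep where "rep x = (SOME h. h \<in> carrier (GLn n) \<and> flag_point n h = x)" for x
  define s where "s x = bundle_point n ?\<psi> (rep x) (f (rep x))" for x
  have fB: "f (h * b) = char_val n ?\<psi> b * f h" if "h \<in> hessenberg_matrices n" "b \<in> Borel n" for h b
  proof -
    have "cochar n 1 = 1\<^sub>m n" by (simp add: cochar_def)
    then show ?thesis
      using semi_invariantD[OF f that(1) _ that(2), of 1] GL_one_mult(1)[OF hessenberg_GL[OF that(1)]]
      by (simp add: char_val_multiple)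
  qed
  have s: "s (flag_point n h) = bundle_point n ?\<psi> h (f h)" if h: "h \<in> hessenberg_matrices n" for h
  proof -
    let ?r = "rep (flag_point n h)"
    note hG = hessenberg_GL[OF h]
    have "?r \<in> carrier (GLn n) \<and> flag_point n ?r = flag_point n h"
      unfolding rep_def by (rule someI[of _ h]) (simp add: hG)
    then have r: "?r \<in> carrier (GLn n)" "flag_point n ?r = flag_point n h" by simp_all
    obtain b where b: "b \<in> Borel n" "h = ?r * b" using flag_point_eq_iff[OF r(1) hG] r(2) by blast
    have "?r \<in> hessenberg_matrices n"
      using flag_point_Pet_iff[OF r(1)] flag_point_Pet_iff[OF hG] r(2) h by simp
    then have "bundle_point n ?\<psi> (?r * b) (f (?r * b)) = bundle_point n ?\<psi> ?r (f ?r)"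
      using fB[OF _ b(1)] bundle_point_mult_Borel[OF r(1) b(1)] by simp
    then show ?thesis unfolding s_def using b(2) by simp
  qed
  have "is_section n ?\<psi> s"
    unfolding is_section_def
  proof (intro bexI ballI impI)
    show "f \<in> regular_functions n" using f by (simp add: semi_invariant_def)
    fix h assume "h \<in> carrier (GLn n)" "flag_point n h \<in> Pet n"
    then show "s (flag_point n h) = bundle_point n ?\<psi> h (f h)" using s flag_point_Pet_iff by simp
  qed
  moreover have "s (flag_act n h x) = bundle_act n h (s x)"
    if h: "h \<in> carrier (G0 n)" and x: "x \<in> Pet n" for h x
  proof -
    obtain t where t: "t \<noteq> 0" "h = cochar n t" by (rule G0_cases[OF h])
    obtain k where k: "k \<in> hessenberg_matrices n" "x = flag_point n k" using Pet_cases[OF x] .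
    note kG = hessenberg_GL[OF k(1)] and tk = hessenberg_cochar[OF k(1) t(1)]
    have "f (cochar n t * k) = f k"
      using semi_invariantD[OF f k(1) t(1) Borel_one] GL_one_mult(2)[OF hessenberg_GL[OF tk]]
      by (simp add: char_val_one)
    then show ?thesis
      unfolding t(2) k(2) flag_act_point[OF cochar_GL[OF t(1)] kG] s[OF k(1)] s[OF tk]
        bundle_act_point[OF cochar_GL[OF t(1)] kG] by simp
  qed
  ultimately have "is_invariant_section n ?\<psi> s" unfolding is_invariant_section_def by blast
  moreover have "\<not> vanishes_at n ?\<psi> s (flag_point n g)"
  proof
    assume "vanishes_at n ?\<psi> s (flag_point n g)"
    then obtain b where b: "b \<in> Borel n" "s (flag_point n g) = bundle_point n ?\<psi> (g * b) 0"
      unfolding vanishes_at_def flag_point_eq by blast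
    then have "bundle_point n ?\<psi> g (f g) = bundle_point n ?\<psi> g 0"
      using bundle_point_mult_Borel[OF gG b(1), of ?\<psi> 0] s[OF g] by simp
    then show False using bundle_point_inj[OF gG] nz by blast
  qed
  ultimately show "flag_point n g \<in> semistable_locus n \<chi>"
    unfolding semistable_locus_def using m g flag_point_Pet_iff[OF gG] by (simp only: mem_Collect_eq) blast
qed

section \<open>Limits of one-parameter orbits\<close>

text \<open>For \<open>s \<noteq> 0\<close> this is the conjugate of \<open>b\<close> by the one-parameter group at \<open>s\<close> if \<open>b\<close> is lower triangular, and at
  \<open>s\<^sup>-\<^sup>1\<close> if \<open>b\<close> is upper triangular. It is defined for \<open>s = 0\<close> as well, where it is the diagonal part of \<open>b\<close>.\<close>

definition shrink :: "nat \<Rightarrow> complex mat \<Rightarrow> complex \<Rightarrow> complex mat" where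
  "shrink n b s = mat n n (\<lambda>(i, j). b $$ (i, j) * s ^ ((i - j) + (j - i)))"

lemma shrink_carrier [simp]: "shrink n b s \<in> carrier_mat n n"
  by (simp add: shrink_def)

text \<open>The conjugate of the one-parameter group by the permutation matrix of \<open>w\<close>.\<close>

definition conj_cochar :: "nat \<Rightarrow> (nat \<Rightarrow> nat) \<Rightarrow> complex \<Rightarrow> complex mat" where
  "conj_cochar n w t = mat_diag n (\<lambda>i. t ^ Suc (perm_shift w i))"

lemma conj_cochar_Borel: "t \<noteq> 0 \<Longrightarrow> conj_cochar n w t \<in> Borel n"
  unfolding Borel_eq conj_cochar_def
  by (rule upper.triangularI) (auto simp: mat_diag_def split: if_splits)

lemma cochar_mult_perm_mat:
  assumes w: "w permutes {1..n}"
  shows "cochar n t * perm_mat n w = perm_mat n w * conj_cochar n w t"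
proof (rule eq_matI)
  fix i j
  assume "i < dim_row (perm_mat n w * conj_cochar n w t)" "j < dim_col (perm_mat n w * conj_cochar n w t)"
  then have ij: "i < n" "j < n" by (auto simp: conj_cochar_def mat_diag_def)
  have "(perm_mat n w * conj_cochar n w t) $$ (i, j) = perm_mat n w $$ (i, j) * t ^ Suc (perm_shift w j)"
    unfolding conj_cochar_def using ij by (subst mat_diag_mult_right[of _ n n]) auto
  then show "(cochar n t * perm_mat n w) $$ (i, j) = (perm_mat n w * conj_cochar n w t) $$ (i, j)"
    using ij cochar_mult_entry[OF perm_mat_carrier ij] by (simp add: perm_mat_entry[OF w])
qed (auto simp: cochar_def conj_cochar_def mat_diag_def)

lemma char_val_conj_cochar:
  assumes w: "w permutes {1..n}" and t: "t \<noteq> 0"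
  shows "char_val n \<chi> (conj_cochar n w t) = t powi pairing n (weyl_act n w \<chi>)"
proof -
  have "char_val n \<chi> (conj_cochar n w t) = (\<Prod>i<n. t powi (\<chi> (Suc i) * int (Suc (perm_shift w i))))"
    unfolding char_val_def
  proof (rule prod.cong[OF refl])
    fix i assume i: "i \<in> {..<n}"
    have c: "conj_cochar n w t $$ (i, i) = t ^ Suc (perm_shift w i)"
      using i by (simp add: conj_cochar_def mat_diag_def)
    have pw: "t ^ Suc (perm_shift w i) = t powi int (Suc (perm_shift w i))"
      by (rule power_int_of_nat[symmetric])
    show "conj_cochar n w t $$ (i, i) powi \<chi> (Suc i) = t powi (\<chi> (Suc i) * int (Suc (perm_shift w i)))"
      unfolding c pw mult.commute[of "\<chi> (Suc i)"] power_int_mult ..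
  qed
  then show ?thesis by (simp only: power_int_prod_sum[OF t] pairing_weyl_act[OF w])
qed

lemma flag_act_fixed_point:
  assumes w: "w permutes {1..n}" and t: "t \<noteq> 0"
  shows "flag_act n (cochar n t) (flag_point n (perm_mat n w)) = flag_point n (perm_mat n w)"
  unfolding flag_act_point[OF cochar_GL[OF t] perm_mat_GL[OF w]] cochar_mult_perm_mat[OF w]
  by (rule flag_point_mult_Borel[OF perm_mat_GL[OF w] conj_cochar_Borel[OF t]])

lemma continuous_extends_constant:
  fixes h :: "complex \<Rightarrow> complex"
  assumes "continuous_on UNIV h" and "\<And>s. s \<noteq> 0 \<Longrightarrow> h s = c"
  shows "h 0 = c"
proof -
  have "h \<midarrow>0\<rightarrow> h 0" using assms(1) by (simp add: continuous_on_eq_continuous_at isCont_def)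
  then have "(\<lambda>s::complex. c) \<midarrow>0\<rightarrow> h 0"
    by (rule Lim_transform_eventually) (auto simp: eventually_at_filter assms(2))
  then show ?thesis by (rule LIM_const_eq[symmetric])
qed

context triangular_direction
begin

text \<open>The parameter of the one-parameter group is \<open>t = s\<close> for the lower and \<open>t = s\<^sup>-\<^sup>1\<close> for the upper
  triangular group, so that every limit is taken as \<open>s\<close> tends to \<open>0\<close>.\<close>

definition orientation :: int where
  "orientation = (if R = (\<le>) then - 1 else 1)"

lemma shrink_triangular:
  assumes b: "b \<in> triangular R n"
  shows "shrink n b s \<in> triangular R n"
proof (rule triangularI)
  fix i j assume "i < n" "j < n" "shrink n b s $$ (i, j) \<noteq> 0"
  then show "R i j" using triangularD[OF b, of i j] by (simp add: shrink_def)
next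
  fix i assume "i < n"
  then show "shrink n b s $$ (i, i) \<noteq> 0" using triangular_diag[OF b] by (simp add: shrink_def)
qed simp

lemma det_shrink:
  assumes b: "b \<in> triangular R n"
  shows "det (shrink n b s) = det b"
  unfolding triangular_det[OF b] triangular_det[OF shrink_triangular[OF b]]
  by (rule prod.cong) (auto simp: shrink_def)

lemma shrink_mult_cochar:
  assumes b: "b \<in> triangular R n" and s: "s \<noteq> 0"
  shows "cochar n (s powi orientation) * b = shrink n b s * cochar n (s powi orientation)"
proof (rule eq_matI)
  let ?t = "s powi orientation"
  have bM: "b \<in> carrier_mat n n" by (rule GL_carrier_mat[OF triangular_GL[OF b]])
  fix i j
  assume "i < dim_row (shrink n b s * cochar n ?t)" "j < dim_col (shrink n b s * cochar n ?t)"
  then have ij: "i < n" "j < n" by (auto simp: shrink_def cochar_def mat_diag_def)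
  have "?t ^ Suc i * b $$ (i, j) = b $$ (i, j) * s ^ ((i - j) + (j - i)) * ?t ^ Suc j"
  proof (cases "b $$ (i, j) = 0")
    case False
    have pw: "?t ^ Suc i = s ^ ((i - j) + (j - i)) * ?t ^ Suc j"
    proof (cases "R = (\<le>)")
      case True
      then have "i \<le> j" using triangularD[OF b ij False] by simp
      then obtain k where k: "j = i + k" by (metis le_Suc_ex)
      have o: "orientation = - 1" unfolding orientation_def using True by (rule if_P)
      have "?t = inverse s" unfolding o by (simp add: power_int_minus)
      then show ?thesis using s by (simp add: k power_add power_inverse)
    next
      case R: False
      then have "R = (\<ge>)" using direction by simp
      then have "j \<le> i" using triangularD[OF b ij False] by simp
      then obtain k where k: "i = j + k" by (metis le_Suc_ex)
      have o: "orientation = 1" unfolding orientation_def using R by (rule if_not_P)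
      have "?t = s" unfolding o by simp
      then show ?thesis by (simp add: k power_add)
    qed
    show ?thesis unfolding pw by (simp only: ac_simps)
  qed simp
  then show "(cochar n ?t * b) $$ (i, j) = (shrink n b s * cochar n ?t) $$ (i, j)"
    using cochar_mult_entry[OF bM ij] mult_cochar_entry[OF shrink_carrier ij] ij by (simp add: shrink_def)
qed (use b in \<open>auto simp: shrink_def cochar_def mat_diag_def dest!: triangular_GL GL_carrier_mat\<close>)

text \<open>The torus factor passes through \<open>b\<close> and the permutation matrix to the right, where it is part of
  \<open>B\<close> and contributes only a character value.\<close>

lemma cochar_curve:
  assumes b: "b \<in> triangular R n" and w: "w permutes {1..n}" and c: "c \<in> Borel n" and s: "s \<noteq> 0"
  shows "cochar n (s powi orientation) * (b * perm_mat n w * c) =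
    shrink n b s * perm_mat n w * (conj_cochar n w (s powi orientation) * c)"
proof -
  let ?t = "s powi orientation"
  have t: "?t \<noteq> 0" using s by simp
  note G = GL_carrier_mat[OF triangular_GL[OF b]] GL_carrier_mat[OF Borel_GL[OF c]]
    cochar_carrier[of n ?t] perm_mat_carrier[of n w] shrink_carrier[of n b s]
    GL_carrier_mat[OF Borel_GL[OF conj_cochar_Borel[OF t, of n w]]]
  have "cochar n ?t * (b * perm_mat n w * c) = (cochar n ?t * b) * (perm_mat n w * c)"
    using G by (simp add: square_assoc[of _ n] square_mult)
  also have "\<dots> = shrink n b s * ((cochar n ?t * perm_mat n w) * c)"
    unfolding shrink_mult_cochar[OF b s] using G by (simp add: square_assoc[of _ n] square_mult)
  also have "\<dots> = shrink n b s * perm_mat n w * (conj_cochar n w ?t * c)"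
    unfolding cochar_mult_perm_mat[OF w] using G by (simp add: square_assoc[of _ n] square_mult)
  finally show ?thesis .
qed

lemma curve_GL:
  assumes "b \<in> triangular R n" "w permutes {1..n}"
  shows "shrink n b s * perm_mat n w \<in> carrier (GLn n)"
  by (rule GL_mult[OF triangular_GL[OF shrink_triangular[OF assms(1)]] perm_mat_GL[OF assms(2)]])

lemma curve_point:
  assumes b: "b \<in> triangular R n" and w: "w permutes {1..n}" and c: "c \<in> Borel n" and s: "s \<noteq> 0"
  shows "flag_point n (cochar n (s powi orientation) * (b * perm_mat n w * c)) =
    flag_point n (shrink n b s * perm_mat n w)"
  unfolding cochar_curve[OF assms]
  by (rule flag_point_mult_Borel[OF curve_GL[OF b w] Borel_mult[OF conj_cochar_Borel c]]) (use s in simp)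

text \<open>At \<open>s = 0\<close> the triangular factor is diagonal. Hence the point lies in the upper and in the lower cell of \<open>w\<close>,
  which have only the fixed point in common.\<close>

lemma curve_limit_point:
  assumes b: "b \<in> triangular R n" and w: "w permutes {1..n}"
  shows "flag_point n (shrink n b 0 * perm_mat n w) = flag_point n (perm_mat n w)"
proof -
  let ?d = "shrink n b 0"
  have "?d $$ (i, j) = 0" if "i < n" "j < n" "i \<noteq> j" for i j
    using that by (auto simp: shrink_def zero_power)
  then have diag: "?d \<in> triangular (\<le>) n" "?d \<in> triangular (\<ge>) n"
    using triangular_GL[OF shrink_triangular[OF b, of 0]] by (auto simp: triangular_def)
  have "?d * perm_mat n w = ?d * perm_mat n w * 1\<^sub>m n"
    using GL_one_mult(2)[OF curve_GL[OF b w]] by simp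
  then have "flag_point n (?d * perm_mat n w) \<in> cell n (Borel n) w"
    "flag_point n (?d * perm_mat n w) \<in> cell n (Borel_opp n) w"
    using diag upper.cell_iff[OF w curve_GL[OF b w]] lower.cell_iff[OF w curve_GL[OF b w]] Borel_one
    unfolding Borel_eq Borel_opp_eq by blast+
  then show ?thesis by (rule cell_inter_opposite_cell[OF curve_GL[OF b w] w])
qed

lemma continuous_on_curve:
  assumes b: "b \<in> triangular R n" and w: "w permutes {1..n}" and f: "f \<in> regular_functions n"
  shows "continuous_on UNIV (\<lambda>s. f (shrink n b s * perm_mat n w))"
  using f
proof (induction f rule: regular_functions.induct)
  case (entry i j)
  have eq: "(\<lambda>s. (shrink n b s * perm_mat n w) $$ (i, j)) =
      (\<lambda>s. b $$ (i, perm_shift w j) * s ^ ((i - perm_shift w j) + (perm_shift w j - i)))"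
  proof
    fix s
    show "(shrink n b s * perm_mat n w) $$ (i, j) =
        b $$ (i, perm_shift w j) * s ^ ((i - perm_shift w j) + (perm_shift w j - i))"
      unfolding mult_perm_mat_entry[OF w shrink_carrier entry]
      using entry perm_shift_less[OF w, of j] by (simp add: shrink_def)
  qed
  show ?case unfolding eq
    by (intro continuous_on_mult continuous_on_const continuous_on_power continuous_on_id)
next
  case inverse_det
  have eq: "(\<lambda>s. inverse (det (shrink n b s * perm_mat n w))) = (\<lambda>s. inverse (det b * det (perm_mat n w)))"
    by (simp add: det_mult[OF shrink_carrier perm_mat_carrier] det_shrink[OF b])
  show ?case unfolding eq by (rule continuous_on_const)
next
  case (const c)
  show ?case by (rule continuous_on_const)
next
  case (add f h)
  show ?case by (rule continuous_on_add[OF add.IH])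
next
  case (mult f h)
  show ?case by (rule continuous_on_mult[OF mult.IH])
qed

text \<open>By invariance, \<open>f g\<close> is the value of \<open>f\<close> on the curve times a power of \<open>s\<close> and a constant, for every
  \<open>s \<noteq> 0\<close>. A positive exponent would give \<open>f g = 0\<close> by continuity at \<open>s = 0\<close>.\<close>

lemma semistable_cell_pairing:
  assumes g: "g \<in> hessenberg_matrices n" and w: "w permutes {1..n}"
    and cell: "flag_point n g \<in> cell n (triangular R n) w"
    and ss: "flag_point n g \<in> semistable_locus n \<chi>"
  shows "orientation * pairing n (weyl_act n w \<chi>) \<le> 0"
proof (rule ccontr)
  let ?a = "pairing n (weyl_act n w \<chi>)"
  assume "\<not> orientation * ?a \<le> 0"
  then have pos: "orientation * ?a > 0" by simp
  obtain m f where m: "m > 0" and f: "semi_invariant n \<chi> m 0 f" and nz: "f g \<noteq> 0"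
    using ss semistable_iff[OF g] by blast
  obtain b c where bc: "b \<in> triangular R n" "c \<in> Borel n" "g = b * perm_mat n w * c"
    using cell cell_iff[OF w hessenberg_GL[OF g]] by blast
  let ?\<gamma> = "\<lambda>s. shrink n b s * perm_mat n w"
  let ?N = "nat (orientation * ?a)"
  define K where "K = char_val n \<chi> c ^ m"
  define h where "h s = s ^ (?N * m) * (K * f (?\<gamma> s))" for s
  have "h s = f g" if s: "s \<noteq> 0" for s
  proof -
    let ?t = "s powi orientation" and ?d = "conj_cochar n w (s powi orientation)"
    have t: "?t \<noteq> 0" using s by simp
    have d: "?d \<in> Borel n" by (rule conj_cochar_Borel[OF t])
    have dc: "?d * c \<in> Borel n" by (rule Borel_mult[OF d bc(2)])
    have tg: "cochar n ?t * g \<in> hessenberg_matrices n" by (rule hessenberg_cochar[OF g t])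
    have eq: "cochar n ?t * g = ?\<gamma> s * (?d * c)"
      unfolding bc(3) by (rule cochar_curve[OF bc(1) w bc(2) s])
    have "?\<gamma> s = cochar n ?t * g * inv\<^bsub>GLn n\<^esub> (?d * c)"
      unfolding eq using GL_cancel(3)[OF Borel_GL[OF dc] curve_GL[OF bc(1) w]] by simp
    then have \<gamma>: "?\<gamma> s \<in> hessenberg_matrices n"
      using hessenberg_mult_Borel[OF tg Borel_inv[OF dc]] by simp
    have one: "cochar n 1 = 1\<^sub>m n" by (simp add: cochar_def)
    have "f g = f (cochar n ?t * g * 1\<^sub>m n)"
      using semi_invariantD[OF f g t Borel_one] by (simp add: char_val_one)
    also have "\<dots> = f (cochar n 1 * ?\<gamma> s * (?d * c))"
      unfolding eq using GL_one_mult[OF hessenberg_GL[OF tg, unfolded eq]]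
        GL_one_mult[OF hessenberg_GL[OF \<gamma>]] by (simp add: one)
    also have "\<dots> = char_val n \<chi> (?d * c) ^ m * f (?\<gamma> s)"
      using semi_invariantD[OF f \<gamma> _ dc, of 1] by simp
    also have "char_val n \<chi> (?d * c) = ?t powi ?a * char_val n \<chi> c"
      unfolding char_val_mult[OF d bc(2)] char_val_conj_cochar[OF w t] ..
    also have "?t powi ?a = s ^ ?N"
      unfolding power_int_mult[symmetric] by (rule powi_nat_diff[symmetric]) (use pos in simp)
    finally show ?thesis by (simp add: h_def K_def power_mult_distrib power_mult[symmetric] mult.assoc)
  qed
  moreover have "continuous_on UNIV h"
    unfolding h_def using f bc(1) w
    by (intro continuous_intros continuous_on_curve) (auto simp: semi_invariant_def)
  ultimately have "h 0 = f g" by (rule continuous_extends_constant[rotated])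
  moreover have "h 0 = 0" using pos m by (simp add: h_def)
  ultimately show False using nz by simp
qed

text \<open>A regular function that vanishes on the orbit vanishes along the curve for \<open>s \<noteq> 0\<close>, hence by continuity
  at the limit.\<close>

lemma closed_contains_limit:
  assumes Z: "zariski_closed_flag n Z" and g: "g \<in> carrier (GLn n)" and w: "w permutes {1..n}"
    and cell: "flag_point n g \<in> cell n (triangular R n) w"
    and orb: "\<And>t. t \<noteq> 0 \<Longrightarrow> flag_point n (cochar n t * g) \<in> Z"
  shows "flag_point n (perm_mat n w) \<in> Z"
proof -
  obtain b c where bc: "b \<in> triangular R n" "c \<in> Borel n" "g = b * perm_mat n w * c"
    using cell cell_iff[OF w g] by blast
  let ?\<gamma> = "\<lambda>s. shrink n b s * perm_mat n w"
  obtain F where F: "F \<subseteq> regular_functions n"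
    "{g \<in> carrier (GLn n). flag_point n g \<in> Z} = {g \<in> carrier (GLn n). \<forall>f\<in>F. f g = 0}"
    using Z unfolding zariski_closed_flag_def zariski_closed_GL_def by blast
  have mem: "flag_point n h \<in> Z \<longleftrightarrow> (\<forall>f\<in>F. f h = 0)" if "h \<in> carrier (GLn n)" for h
    using F(2) that by blast
  have "f (?\<gamma> 0) = 0" if f: "f \<in> F" for f
  proof (rule continuous_extends_constant)
    show "continuous_on UNIV (\<lambda>s. f (?\<gamma> s))"
      using continuous_on_curve[OF bc(1) w] F(1) f by blast
    fix s :: complex assume s: "s \<noteq> 0"
    then have "flag_point n (?\<gamma> s) \<in> Z"
      using orb[of "s powi orientation"] curve_point[OF bc(1) w bc(2) s] bc(3) by simp
    then show "f (?\<gamma> s) = 0" using mem[OF curve_GL[OF bc(1) w]] f by blast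
  qed
  then have "flag_point n (?\<gamma> 0) \<in> Z" using mem[OF curve_GL[OF bc(1) w]] by blast
  then show ?thesis using curve_limit_point[OF bc(1) w] by simp
qed

end

lemma upper_orientation: "upper.orientation = - 1"
  by (simp add: upper.orientation_def)

lemma lower_orientation: "lower.orientation = 1"
proof -
  have "(\<ge>) \<noteq> ((\<le>) :: nat \<Rightarrow> nat \<Rightarrow> bool)"
  proof
    assume "(\<ge>) = ((\<le>) :: nat \<Rightarrow> nat \<Rightarrow> bool)"
    from fun_cong[OF fun_cong[OF this, of 1], of 0] show False by simp
  qed
  then show ?thesis unfolding lower.orientation_def by (rule if_not_P)
qed

section \<open>The semistable locus\<close>

lemma Y0_flag_point:
  assumes "x \<in> Y0 n I J"
  obtains g where "g \<in> hessenberg_matrices n" "x = flag_point n g"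
    "flag_point n g \<in> cell n (triangular (\<le>) n) (longest n I)"
    "flag_point n g \<in> cell n (triangular (\<ge>) n) (longest n J)"
proof -
  have "x \<in> Pet n" using assms by (simp add: Y0_def)
  then obtain g where "g \<in> hessenberg_matrices n" "x = flag_point n g" by (rule Pet_cases)
  then show ?thesis using that assms unfolding Y0_def Borel_eq Borel_opp_eq by blast
qed

text \<open>Necessity comes from the two cells that contain \<open>x\<close>. For sufficiency, the extremal products of \<open>w\<^sub>I\<close> and
  \<open>w\<^sub>J\<close> do not vanish on these cells and have weights of opposite sign, which can be balanced.\<close>

lemma semistable_Y0_iff:
  assumes dom: "regular_dominant n \<chi>" and I: "I \<subseteq> simple_roots n" and J: "J \<subseteq> simple_roots n"
    and x: "x \<in> Y0 n I J"
  shows "x \<in> semistable_locus n \<chi> \<longleftrightarrow>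
    pairing n (weyl_act n (longest n I) \<chi>) \<ge> 0 \<and> pairing n (weyl_act n (longest n J) \<chi>) \<le> 0"
    (is "_ \<longleftrightarrow> ?a \<ge> 0 \<and> ?b \<le> 0")
proof -
  note wI = longest_permutes[OF I] and wJ = longest_permutes[OF J]
  obtain g where g: "g \<in> hessenberg_matrices n" "x = flag_point n g"
    "flag_point n g \<in> cell n (triangular (\<le>) n) (longest n I)"
    "flag_point n g \<in> cell n (triangular (\<ge>) n) (longest n J)"
    using Y0_flag_point[OF x] .
  show ?thesis
  proof
    assume "x \<in> semistable_locus n \<chi>"
    then have ss: "flag_point n g \<in> semistable_locus n \<chi>" using g(2) by simp
    have "upper.orientation = - 1" "lower.orientation = 1"
      by (rule upper_orientation, rule lower_orientation)
    then show "?a \<ge> 0 \<and> ?b \<le> 0"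
      using upper.semistable_cell_pairing[OF g(1) wI g(3) ss]
        lower.semistable_cell_pairing[OF g(1) wJ g(4) ss] by simp
  next
    assume ab: "?a \<ge> 0 \<and> ?b \<le> 0"
    let ?M = "minor_product n \<chi> (extremal_rows (longest n I))"
      and ?M' = "minor_product n \<chi> (extremal_rows (longest n J))"
    note M = semi_invariant_extremal[OF dom wI] and M' = semi_invariant_extremal[OF dom wJ]
    have nz: "?M g \<noteq> 0" "?M' g \<noteq> 0"
      using upper.minor_product_extremal_nonzero[OF wI hessenberg_GL[OF g(1)] g(3)]
        lower.minor_product_extremal_nonzero[OF wJ hessenberg_GL[OF g(1)] g(4)] by blast+
    have "\<exists>m>0. \<exists>f. semi_invariant n \<chi> m 0 f \<and> f g \<noteq> 0"
    proof (cases "?a = 0")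
      case True
      then show ?thesis using M nz(1) by (intro exI[of _ 1] conjI exI[of _ ?M]) simp_all
    next
      case False
      let ?p = "nat ?a" and ?q = "nat (- ?b)"
      show ?thesis
      proof (intro exI conjI)
        show "?q + ?p > 0" using ab False by simp
        show "semi_invariant n \<chi> (?q + ?p) 0 (\<lambda>g. ?M g ^ ?q * ?M' g ^ ?p)"
          by (rule semi_invariant_balanced[OF M M']) (use ab in simp_all)
        show "?M g ^ ?q * ?M' g ^ ?p \<noteq> 0" using nz by simp
      qed
    qed
    then show "x \<in> semistable_locus n \<chi>" using semistable_iff[OF g(1)] g(2) by simp
  qed
qed

lemma semistable_locus_eq:
  assumes dom: "regular_dominant n \<chi>"
  shows "semistable_locus n \<chi> = (\<Union>(I, J)\<in>{(I, J). J \<subseteq> I \<and> I \<subseteq> simple_roots n \<and>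
    pairing n (weyl_act n (longest n I) \<chi>) \<ge> 0 \<and> pairing n (weyl_act n (longest n J) \<chi>) \<le> 0}. Y0 n I J)"
proof (rule Set.set_eqI, rule iffI)
  fix x assume ss: "x \<in> semistable_locus n \<chi>"
  then have "x \<in> Pet n" by (simp add: semistable_locus_def)
  then obtain I J where IJ: "J \<subseteq> I" "I \<subseteq> simple_roots n" "x \<in> Y0 n I J" by (rule Pet_stratification)
  then show "x \<in> (\<Union>(I, J)\<in>{(I, J). J \<subseteq> I \<and> I \<subseteq> simple_roots n \<and>
    pairing n (weyl_act n (longest n I) \<chi>) \<ge> 0 \<and> pairing n (weyl_act n (longest n J) \<chi>) \<le> 0}. Y0 n I J)"
    using semistable_Y0_iff[OF dom IJ(2) order_trans[OF IJ(1,2)] IJ(3)] ss by blast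
next
  fix x assume "x \<in> (\<Union>(I, J)\<in>{(I, J). J \<subseteq> I \<and> I \<subseteq> simple_roots n \<and>
    pairing n (weyl_act n (longest n I) \<chi>) \<ge> 0 \<and> pairing n (weyl_act n (longest n J) \<chi>) \<le> 0}. Y0 n I J)"
  then obtain I J where IJ: "J \<subseteq> I" "I \<subseteq> simple_roots n" "x \<in> Y0 n I J"
    "pairing n (weyl_act n (longest n I) \<chi>) \<ge> 0 \<and> pairing n (weyl_act n (longest n J) \<chi>) \<le> 0"
    by blast
  then show "x \<in> semistable_locus n \<chi>"
    using semistable_Y0_iff[OF dom IJ(2) order_trans[OF IJ(1,2)] IJ(3)] by blast
qed

section \<open>Affine charts of the flag variety\<close>

text \<open>The leading minors being nonzero, the permutation in the lower Bruhat decomposition must fix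
  the indices one after the other.\<close>

lemma LU_decomposition:
  assumes h: "h \<in> carrier (GLn n)" and minors: "\<And>k. k \<le> n \<Longrightarrow> flag_minor k (\<lambda>i. i) h \<noteq> 0"
  obtains l c where "l \<in> triangular (\<ge>) n" "c \<in> Borel n" "h = l * c"
proof -
  obtain l v c where lvc: "l \<in> triangular (\<ge>) n" "v permutes {1..n}" "c \<in> Borel n"
    "h = l * perm_mat n v * c"
    by (rule lower.bruhat_decomposition[OF h])
  have lM: "l \<in> carrier_mat n n" by (rule GL_carrier_mat[OF triangular_GL[OF lvc(1)]])
  have lP: "l * perm_mat n v \<in> carrier_mat n n" by (rule square_mult[OF lM perm_mat_carrier])
  have fixed: "k < n \<longrightarrow> perm_shift v k = k" for k
  proof (induction k rule: less_induct)
    case (less k)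
    show ?case
    proof
      assume k: "k < n"
      let ?A = "mat (Suc k) (Suc k) (\<lambda>(i, j). (l * perm_mat n v) $$ (i, j))"
      have "flag_minor (Suc k) (\<lambda>i. i) h = det ?A * (\<Prod>i<Suc k. c $$ (i, i))"
        unfolding lvc(4) using flag_minor_mult_upper[OF lP lvc(3), of "Suc k" "\<lambda>i. i"] k
        by (simp add: flag_minor_def)
      then have "det ?A \<noteq> 0" using minors[of "Suc k"] k by auto
      then have "?A \<in> carrier (GLn (Suc k))" by (simp add: GL_iff)
      then obtain i where i: "i < Suc k" "?A $$ (i, k) \<noteq> 0" using GL_column_nonzero[of ?A "Suc k" k] by auto
      then have "l $$ (i, perm_shift v k) \<noteq> 0"
        using k mult_perm_mat_entry[OF lvc(2) lM, of i k] by simp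
      then have "perm_shift v k \<le> i"
        using triangularD[OF lvc(1), of i "perm_shift v k"] i k perm_shift_less[OF lvc(2), of k] by simp
      then have le: "perm_shift v k \<le> k" using i by simp
      show "perm_shift v k = k"
      proof (rule ccontr)
        assume "perm_shift v k \<noteq> k"
        then have "perm_shift v k < k" using le by simp
        then have "perm_shift v (perm_shift v k) = perm_shift v k" using less.IH k by simp
        then show False using perm_shift_inj[OF lvc(2)] \<open>perm_shift v k \<noteq> k\<close> by blast
      qed
    qed
  qed
  have "perm_mat n v = 1\<^sub>m n"
    by (rule eq_matI) (use fixed in \<open>auto simp: perm_mat_entry[OF lvc(2)]\<close>)
  then have "h = l * c" using lvc(4) GL_one_mult(2)[OF triangular_GL[OF lvc(1)]] by simp
  then show ?thesis using that lvc by blast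
qed

text \<open>The chosen rows of \<open>l\<close> again form a lower triangular matrix, with last diagonal entry \<open>l $$ (i, j)\<close>.\<close>

lemma flag_minor_LU:
  assumes l: "l \<in> triangular (\<ge>) n" and c: "c \<in> Borel n" and ij: "j \<le> i" "i < n"
  shows "flag_minor (Suc j) ((\<lambda>m. m)(j := i)) (l * c) =
    (\<Prod>m<j. l $$ (m, m)) * l $$ (i, j) * (\<Prod>m<Suc j. c $$ (m, m))"
proof -
  let ?r = "(\<lambda>m. m)(j := i)"
  let ?A = "mat (Suc j) (Suc j) (\<lambda>(p, q). l $$ (?r p, q))"
  have "det ?A = (\<Prod>m<Suc j. ?A $$ (m, m))"
  proof (rule lower.det_triangular)
    fix p q assume pq: "p < Suc j" "q < Suc j" "?A $$ (p, q) \<noteq> 0"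
    show "q \<le> p"
    proof (cases "p = j")
      case False
      then show ?thesis using pq ij triangularD[OF l, of p q] by simp
    qed (use pq in simp)
  qed simp
  also have "\<dots> = (\<Prod>m<j. l $$ (m, m)) * l $$ (i, j)" by simp
  finally have "flag_minor (Suc j) ?r l = (\<Prod>m<j. l $$ (m, m)) * l $$ (i, j)"
    by (simp add: flag_minor_def)
  then show ?thesis
    using flag_minor_mult_upper[OF GL_carrier_mat[OF triangular_GL[OF l]] c, of "Suc j" ?r] ij by simp
qed

text \<open>The quotients of minors determine \<open>l $$ (i, j) / l $$ (j, j)\<close>, that is, the lower triangular factor
  up to a diagonal matrix on the right.\<close>

lemma flag_point_eq_of_minors:
  assumes g: "g \<in> carrier (GLn n)" and h: "h \<in> carrier (GLn n)"
    and mg: "\<And>k. k \<le> n \<Longrightarrow> flag_minor k (\<lambda>i. i) g \<noteq> 0"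
    and mh: "\<And>k. k \<le> n \<Longrightarrow> flag_minor k (\<lambda>i. i) h \<noteq> 0"
    and eq: "\<And>i j. j < i \<Longrightarrow> i < n \<Longrightarrow>
      flag_minor (Suc j) ((\<lambda>m. m)(j := i)) g * flag_minor (Suc j) (\<lambda>m. m) h =
      flag_minor (Suc j) ((\<lambda>m. m)(j := i)) h * flag_minor (Suc j) (\<lambda>m. m) g"
  shows "flag_point n g = flag_point n h"
proof -
  obtain l c where lc: "l \<in> triangular (\<ge>) n" "c \<in> Borel n" "g = l * c"
    by (rule LU_decomposition[OF g mg])
  obtain l' c' where lc': "l' \<in> triangular (\<ge>) n" "c' \<in> Borel n" "h = l' * c'"
    by (rule LU_decomposition[OF h mh])
  note G = triangular_GL[OF lc(1)] triangular_GL[OF lc'(1)]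
  define d where "d = mat_diag n (\<lambda>i. l' $$ (i, i) / l $$ (i, i))"
  have d: "d \<in> Borel n"
    unfolding Borel_eq
  proof (rule upper.triangularI)
    fix i assume "i < n"
    then show "d $$ (i, i) \<noteq> 0"
      using lower.triangular_diag[OF lc(1)] lower.triangular_diag[OF lc'(1)] by (simp add: d_def mat_diag_def)
  qed (auto simp: d_def mat_diag_def split: if_splits)
  have entry: "l $$ (i, j) * l' $$ (j, j) = l' $$ (i, j) * l $$ (j, j)" if ij: "i < n" "j < n" for i j
  proof (cases "i = j")
    case False
    show ?thesis
    proof (cases "j < i")
      case True
      define A where "A = (\<Prod>m<j. l $$ (m, m))"
      define A' where "A' = (\<Prod>m<j. l' $$ (m, m))"
      define C where "C = (\<Prod>m<Suc j. c $$ (m, m))"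
      define C' where "C' = (\<Prod>m<Suc j. c' $$ (m, m))"
      have nz: "A \<noteq> 0" "A' \<noteq> 0" "C \<noteq> 0" "C' \<noteq> 0"
        unfolding A_def A'_def C_def C'_def
        using lower.triangular_diag[OF lc(1)] lower.triangular_diag[OF lc'(1)]
          Borel_diag[OF lc(2)] Borel_diag[OF lc'(2)] ij by auto
      have id: "(\<lambda>m. m)(j := j) = (\<lambda>m. m)" by auto
      have "flag_minor (Suc j) ((\<lambda>m. m)(j := i)) g = A * l $$ (i, j) * C"
        unfolding lc(3) A_def C_def by (rule flag_minor_LU[OF lc(1,2) less_imp_le[OF True] ij(1)])
      moreover have "flag_minor (Suc j) ((\<lambda>m. m)(j := i)) h = A' * l' $$ (i, j) * C'"
        unfolding lc'(3) A'_def C'_def by (rule flag_minor_LU[OF lc'(1,2) less_imp_le[OF True] ij(1)])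
      moreover have "flag_minor (Suc j) (\<lambda>m. m) g = A * l $$ (j, j) * C"
        unfolding lc(3) A_def C_def by (rule flag_minor_LU[OF lc(1,2) order_refl ij(2), unfolded id])
      moreover have "flag_minor (Suc j) (\<lambda>m. m) h = A' * l' $$ (j, j) * C'"
        unfolding lc'(3) A'_def C'_def by (rule flag_minor_LU[OF lc'(1,2) order_refl ij(2), unfolded id])
      ultimately have "A * l $$ (i, j) * C * (A' * l' $$ (j, j) * C') = A' * l' $$ (i, j) * C' * (A * l $$ (j, j) * C)"
        using eq[OF True ij(1)] by (simp only:)
      then have "(A * C * A' * C') * (l $$ (i, j) * l' $$ (j, j)) = (A * C * A' * C') * (l' $$ (i, j) * l $$ (j, j))"
        by (simp only: ac_simps)
      then show ?thesis using nz by simp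
    next
      case False
      then have "l $$ (i, j) = 0" "l' $$ (i, j) = 0"
        using triangularD[OF lc(1) ij] triangularD[OF lc'(1) ij] \<open>i \<noteq> j\<close> by auto
      then show ?thesis by simp
    qed
  qed simp
  have "l' = l * d"
  proof (rule eq_matI)
    fix i j assume "i < dim_row (l * d)" "j < dim_col (l * d)"
    then have ij: "i < n" "j < n"
      using GL_carrier_mat[OF G(1)] GL_carrier_mat[OF Borel_GL[OF d]] by auto
    have "(l * d) $$ (i, j) = l $$ (i, j) * (l' $$ (j, j) / l $$ (j, j))"
      unfolding d_def using ij GL_carrier_mat[OF G(1)] by (subst mat_diag_mult_right[of _ n n]) auto
    then show "l' $$ (i, j) = (l * d) $$ (i, j)"
      using entry[OF ij] lower.triangular_diag[OF lc(1) ij(2)] by (simp add: field_simps)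
  qed (use GL_carrier_mat[OF G(1)] GL_carrier_mat[OF G(2)] GL_carrier_mat[OF Borel_GL[OF d]] in auto)
  then have "flag_point n l' = flag_point n l" using flag_point_mult_Borel[OF G(1) d] by simp
  then show ?thesis
    unfolding lc(3) lc'(3) using flag_point_mult_Borel[OF G(1) lc(2)] flag_point_mult_Borel[OF G(2) lc'(2)]
    by simp
qed

lemma flag_minor_inv_perm_mat:
  assumes w: "w permutes {1..n}" and g: "g \<in> carrier_mat n n" and k: "k \<le> n"
    and \<rho>: "\<And>i. i < k \<Longrightarrow> \<rho> i < n"
  shows "flag_minor k \<rho> (inv\<^bsub>GLn n\<^esub> (perm_mat n w) * g) = flag_minor k (\<lambda>i. perm_shift w (\<rho> i)) g"
  unfolding flag_minor_def
  by (rule arg_cong[of _ _ det], rule eq_matI)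
    (use k \<rho> in \<open>simp_all add: inv_perm_mat_mult_entry[OF w g]\<close>)

text \<open>Near the fixed point of \<open>w\<close>, coordinates on the flag variety are the quotients of two minors of the
  same size, whose sets of rows differ in one element. Both are made sections of the same
  line bundle by completing them with the extremal minors.\<close>

definition exchange_rows :: "(nat \<Rightarrow> nat) \<Rightarrow> nat \<Rightarrow> nat \<Rightarrow> nat \<Rightarrow> nat \<Rightarrow> nat \<Rightarrow> nat" where
  "exchange_rows w i j k m =
     (if k = Suc j \<and> m = 0 then (perm_shift w)(j := perm_shift w i) else perm_shift w)"

lemma prod_change_one:
  fixes f f' :: "'a \<Rightarrow> 'b :: comm_monoid_mult"
  assumes "finite S" "a \<in> S" "\<And>x. x \<in> S \<Longrightarrow> x \<noteq> a \<Longrightarrow> f x = f' x"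
  shows "prod f S * f' a = prod f' S * f a"
proof -
  have "prod f (S - {a}) = prod f' (S - {a})" by (rule prod.cong) (use assms in auto)
  then show ?thesis using assms by (simp add: prod.remove[of S a] ac_simps)
qed

text \<open>The two products differ in a single factor, the first minor of size \<open>j + 1\<close>.\<close>

lemma minor_product_exchange:
  assumes dom: "regular_dominant n \<chi>" and ij: "j < i" "i < n"
  shows "minor_product n \<chi> (exchange_rows w i j) g * flag_minor (Suc j) (perm_shift w) g =
    minor_product n \<chi> (extremal_rows w) g * flag_minor (Suc j) ((perm_shift w)(j := perm_shift w i)) g"
proof -
  let ?c = "\<lambda>k. nat (\<chi> k - \<chi> (Suc k))"
  let ?S = "SIGMA k:{1..<n}. {..<?c k}"
  let ?e = "\<lambda>(k, m). flag_minor k (exchange_rows w i j k m) g"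
    and ?x = "\<lambda>(k, m). flag_minor k (extremal_rows w k m) g"
  \<comment> \<open>Regularity of \<open>\<chi>\<close> ensures that a minor of size \<open>j + 1\<close> occurs in the product.\<close>
  have "1 \<le> Suc j \<and> Suc j < Suc (Suc j) \<and> Suc (Suc j) \<le> n" using ij by simp
  then have "\<chi> (Suc j) > \<chi> (Suc (Suc j))" using dom unfolding regular_dominant_def by blast
  then have mem: "(Suc j, 0) \<in> ?S" using ij by simp
  have fin: "finite ?S" by simp
  have "prod ?e ?S * ?x (Suc j, 0) = prod ?x ?S * ?e (Suc j, 0)"
  proof (rule prod_change_one[OF fin mem])
    fix x assume "x \<noteq> (Suc j, 0 :: nat)"
    then have "exchange_rows w i j (fst x) (snd x) = extremal_rows w (fst x) (snd x)"
      unfolding exchange_rows_def extremal_rows_def by (cases x) auto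
    then show "?e x = ?x x" by (simp add: case_prod_beta)
  qed
  then have "prod ?e ?S * flag_minor (Suc j) (perm_shift w) g =
      prod ?x ?S * flag_minor (Suc j) ((perm_shift w)(j := perm_shift w i)) g"
    by (simp add: exchange_rows_def extremal_rows_def)
  moreover have "minor_product n \<chi> r g = prod (\<lambda>(k, m). flag_minor k (r k m) g) ?S *
      (flag_minor n (\<lambda>i. i) g ^ nat (\<chi> n) * inverse (det g) ^ nat (- \<chi> n))" for r
    unfolding minor_product_def by (subst prod.Sigma) auto
  ultimately show ?thesis by (simp add: ac_simps)
qed

lemma flag_point_eq_of_coordinates:
  assumes dom: "regular_dominant n \<chi>" and w: "w permutes {1..n}"
    and g: "g \<in> carrier (GLn n)" and h: "h \<in> carrier (GLn n)"
    and nz: "minor_product n \<chi> (extremal_rows w) g \<noteq> 0" "minor_product n \<chi> (extremal_rows w) h \<noteq> 0"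
    and eq: "\<And>i j. j < i \<Longrightarrow> i < n \<Longrightarrow>
      minor_product n \<chi> (exchange_rows w i j) g * minor_product n \<chi> (extremal_rows w) h =
      minor_product n \<chi> (exchange_rows w i j) h * minor_product n \<chi> (extremal_rows w) g"
  shows "flag_point n g = flag_point n h"
proof -
  let ?P = "perm_mat n w" and ?\<sigma> = "perm_shift w"
  have P: "?P \<in> carrier (GLn n)" by (rule perm_mat_GL[OF w])
  have iP: "inv\<^bsub>GLn n\<^esub> ?P \<in> carrier (GLn n)" by (rule GL_inv[OF P])
  have trans: "flag_minor k \<rho> (inv\<^bsub>GLn n\<^esub> ?P * u) = flag_minor k (\<lambda>i. ?\<sigma> (\<rho> i)) u"
    if "u \<in> carrier (GLn n)" "k \<le> n" "\<And>i. i < k \<Longrightarrow> \<rho> i < n" for u k \<rho>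
    by (rule flag_minor_inv_perm_mat[OF w GL_carrier_mat[OF that(1)] that(2,3)])
  have minors: "flag_minor k ?\<sigma> u \<noteq> 0"
    if u: "u \<in> carrier (GLn n)" and nz: "minor_product n \<chi> (extremal_rows w) u \<noteq> 0" and k: "k \<le> n" for u k
  proof (cases "k \<in> {1..<n}")
    case True
    have "1 \<le> k \<and> k < Suc k \<and> Suc k \<le> n" using True by auto
    then have "\<chi> k > \<chi> (Suc k)" using dom unfolding regular_dominant_def by blast
    have "(\<Prod>k\<in>{1..<n}. \<Prod>m<nat (\<chi> k - \<chi> (Suc k)). flag_minor k ?\<sigma> u) \<noteq> 0"
      using nz unfolding minor_product_def extremal_rows_def by fastforce
    then have "(\<Prod>m<nat (\<chi> k - \<chi> (Suc k)). flag_minor k ?\<sigma> u) \<noteq> 0"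
      using True by (metis (no_types, lifting) finite_atLeastLessThan prod_zero)
    then show ?thesis using \<open>\<chi> k > \<chi> (Suc k)\<close> by simp
  next
    case False
    then have "k = 0 \<or> k = n" using k by auto
    then show ?thesis
    proof
      assume "k = n"
      have "flag_minor n (\<lambda>i. i) (inv\<^bsub>GLn n\<^esub> ?P * u) = flag_minor n ?\<sigma> u" by (rule trans[OF u]) auto
      moreover have "flag_minor n (\<lambda>i. i) (inv\<^bsub>GLn n\<^esub> ?P * u) \<noteq> 0"
        using GL_mult[OF iP u] by (simp add: flag_minor_full GL_iff)
      ultimately show ?thesis using \<open>k = n\<close> by simp
    qed (simp add: flag_minor_def)
  qed
  have "flag_point n (inv\<^bsub>GLn n\<^esub> ?P * g) = flag_point n (inv\<^bsub>GLn n\<^esub> ?P * h)"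
  proof (rule flag_point_eq_of_minors[OF GL_mult[OF iP g] GL_mult[OF iP h]])
    fix k assume k: "k \<le> n"
    show "flag_minor k (\<lambda>i. i) (inv\<^bsub>GLn n\<^esub> ?P * g) \<noteq> 0"
      using minors[OF g nz(1) k] trans[OF g k, of "\<lambda>i. i"] k by simp
    show "flag_minor k (\<lambda>i. i) (inv\<^bsub>GLn n\<^esub> ?P * h) \<noteq> 0"
      using minors[OF h nz(2) k] trans[OF h k, of "\<lambda>i. i"] k by simp
  next
    fix i j assume ij: "j < i" "i < n"
    let ?N = "\<lambda>u. minor_product n \<chi> (exchange_rows w i j) u"
      and ?M = "\<lambda>u. minor_product n \<chi> (extremal_rows w) u"
      and ?f = "\<lambda>u. flag_minor (Suc j) (?\<sigma>(j := ?\<sigma> i)) u" and ?e = "\<lambda>u. flag_minor (Suc j) ?\<sigma> u"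
    have j: "Suc j \<le> n" using ij by simp
    have ex: "?N u * ?e u = ?M u * ?f u" for u by (rule minor_product_exchange[OF dom ij])
    have "(?M g * ?f g) * (?M h * ?e h) = (?M h * ?f h) * (?M g * ?e g)"
    proof -
      have "(?M g * ?f g) * (?M h * ?e h) = (?N g * ?M h) * (?e g * ?e h)"
        unfolding ex[symmetric] by (simp only: ac_simps)
      also have "\<dots> = (?N h * ?M g) * (?e g * ?e h)" unfolding eq[OF ij] ..
      also have "\<dots> = (?M h * ?f h) * (?M g * ?e g)"
        unfolding ex[symmetric] by (simp only: ac_simps)
      finally show ?thesis .
    qed
    then have "(?M g * ?M h) * (?f g * ?e h) = (?M g * ?M h) * (?f h * ?e g)" by (simp only: ac_simps)
    then have fe: "?f g * ?e h = ?f h * ?e g" using nz by simp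
    have sh: "(\<lambda>m. ?\<sigma> (((\<lambda>m. m)(j := i)) m)) = ?\<sigma>(j := ?\<sigma> i)" by auto
    have "flag_minor (Suc j) ((\<lambda>m. m)(j := i)) (inv\<^bsub>GLn n\<^esub> ?P * u) = ?f u"
      "flag_minor (Suc j) (\<lambda>m. m) (inv\<^bsub>GLn n\<^esub> ?P * u) = ?e u" if "u \<in> carrier (GLn n)" for u
      using trans[OF that j, of "(\<lambda>m. m)(j := i)"] trans[OF that j, of "\<lambda>m. m"] ij unfolding sh by auto
    then show "flag_minor (Suc j) ((\<lambda>m. m)(j := i)) (inv\<^bsub>GLn n\<^esub> ?P * g) *
        flag_minor (Suc j) (\<lambda>m. m) (inv\<^bsub>GLn n\<^esub> ?P * h) =
      flag_minor (Suc j) ((\<lambda>m. m)(j := i)) (inv\<^bsub>GLn n\<^esub> ?P * h) *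
        flag_minor (Suc j) (\<lambda>m. m) (inv\<^bsub>GLn n\<^esub> ?P * g)"
      using fe g h by simp
  qed
  then obtain b where b: "b \<in> Borel n" "inv\<^bsub>GLn n\<^esub> ?P * h = inv\<^bsub>GLn n\<^esub> ?P * g * b"
    using flag_point_eq_iff[OF GL_mult[OF iP g] GL_mult[OF iP h]] by blast
  have "h = ?P * (inv\<^bsub>GLn n\<^esub> ?P * h)" by (rule GL_cancel(2)[OF P h, symmetric])
  also have "\<dots> = ?P * (inv\<^bsub>GLn n\<^esub> ?P * (g * b))"
    unfolding b(2) using GL_assoc[OF iP g Borel_GL[OF b(1)]] by simp
  also have "\<dots> = g * b" by (rule GL_cancel(2)[OF P GL_mult[OF g Borel_GL[OF b(1)]]])
  finally show ?thesis using flag_point_eq_iff[OF g h] b(1) by blast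
qed

section \<open>Orbits of the one-parameter group\<close>

text \<open>Regular functions are defined on all matrices, but the translation formula for an entry holds
  for matrices of size \<open>n\<close> only; hence the restriction to \<open>GL\<^sub>n\<close>.\<close>

lemma regular_right_translate:
  assumes f: "f \<in> regular_functions n" and b: "b \<in> carrier (GLn n)"
  shows "\<exists>f'\<in>regular_functions n. \<forall>h\<in>carrier (GLn n). f' h = f (h * b)"
  using f
proof (induction f rule: regular_functions.induct)
  case (const c)
  show ?case by (rule bexI[OF _ regular_functions.const[of c]]) simp
next
  case (entry i j)
  have "(\<lambda>h. \<Sum>l<n. b $$ (l, j) * h $$ (i, l)) \<in> regular_functions n"
    by (intro regular_sum regular_cmult regular_functions.entry) (use entry in auto)
  moreover have "\<forall>h\<in>carrier (GLn n). (\<Sum>l<n. b $$ (l, j) * h $$ (i, l)) = (h * b) $$ (i, j)"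
    using mult_entry[OF GL_carrier_mat GL_carrier_mat[OF b] entry] by (simp add: mult.commute)
  ultimately show ?case
    by (intro bexI[where x = "\<lambda>h. \<Sum>l<n. b $$ (l, j) * h $$ (i, l)"])
next
  case inverse_det
  have "\<forall>h\<in>carrier (GLn n). inverse (det b) * inverse (det h) = inverse (det (h * b))"
    using det_mult[OF GL_carrier_mat GL_carrier_mat[OF b]] by (simp add: mult.commute)
  then show ?case by (rule bexI[OF _ regular_cmult[OF regular_functions.inverse_det]])
next
  case (add f h)
  then obtain f' h' where "f' \<in> regular_functions n" "h' \<in> regular_functions n"
    "\<forall>u\<in>carrier (GLn n). f' u = f (u * b)" "\<forall>u\<in>carrier (GLn n). h' u = h (u * b)" by blast
  then show ?case by (intro bexI[OF _ regular_functions.add[of f' n h']]) auto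
next
  case (mult f h)
  then obtain f' h' where "f' \<in> regular_functions n" "h' \<in> regular_functions n"
    "\<forall>u\<in>carrier (GLn n). f' u = f (u * b)" "\<forall>u\<in>carrier (GLn n). h' u = h (u * b)" by blast
  then show ?case by (intro bexI[OF _ regular_functions.mult[of f' n h']]) auto
qed

lemma orbit_flag_point:
  assumes g: "g \<in> carrier (GLn n)"
  shows "orbit (G0 n) (flag_act n) (flag_point n g) = {flag_point n (cochar n t * g) | t. t \<noteq> 0}"
proof -
  have act: "flag_act n (cochar n t) (flag_point n g) = flag_point n (cochar n t * g)" if "t \<noteq> 0" for t
    by (rule flag_act_point[OF cochar_GL[OF that] g])
  have mem: "cochar n t \<in> carrier (G0 n)" if "t \<noteq> 0" for t
    unfolding G0_carrier by (rule imageI) (use that in simp)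
  show ?thesis
  proof (intro subset_antisym subsetI)
    fix y assume "y \<in> orbit (G0 n) (flag_act n) (flag_point n g)"
    then obtain h where h: "h \<in> carrier (G0 n)" "y = flag_act n h (flag_point n g)"
      unfolding orbit_def by blast
    obtain t where "t \<noteq> 0" "h = cochar n t" using G0_cases[OF h(1)] .
    then show "y \<in> {flag_point n (cochar n t * g) | t. t \<noteq> 0}" using act h(2) by blast
  next
    fix y assume "y \<in> {flag_point n (cochar n t * g) | t. t \<noteq> 0}"
    then obtain t where t: "t \<noteq> 0" "y = flag_act n (cochar n t) (flag_point n g)" using act by auto
    show "y \<in> orbit (G0 n) (flag_act n) (flag_point n g)"
      unfolding orbit_def t(2) using mem[OF t(1)] by blast
  qed
qed

text \<open>The Zariski closure of an orbit of the one-parameter group is cut out by the regular functions that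
  vanish on its preimage; right translation by the Borel subgroup preserves this ideal, so its
  zero set is the preimage of a set of flags.\<close>

lemma orbit_closure:
  assumes g: "g \<in> carrier (GLn n)"
  obtains Z where "zariski_closed_flag n Z" "\<forall>t. t \<noteq> 0 \<longrightarrow> flag_point n (cochar n t * g) \<in> Z"
    "\<forall>h\<in>carrier (GLn n). flag_point n h \<in> Z \<longrightarrow> (\<forall>f\<in>regular_functions n.
      (\<forall>t b. t \<noteq> 0 \<longrightarrow> b \<in> Borel n \<longrightarrow> f (cochar n t * g * b) = 0) \<longrightarrow> f h = 0)"
proof -
  define F where "F = {f \<in> regular_functions n. \<forall>t b. t \<noteq> 0 \<longrightarrow> b \<in> Borel n \<longrightarrow> f (cochar n t * g * b) = 0}"
  define Z where "Z = {flag_point n h | h. h \<in> carrier (GLn n) \<and> (\<forall>f\<in>F. f h = 0)}"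
  have tg: "cochar n t * g \<in> carrier (GLn n)" if "t \<noteq> 0" for t
    by (rule GL_mult[OF cochar_GL[OF that] g])
  have mem: "flag_point n h \<in> Z \<longleftrightarrow> (\<forall>f\<in>F. f h = 0)" if h: "h \<in> carrier (GLn n)" for h
  proof
    assume "flag_point n h \<in> Z"
    then obtain k where k: "k \<in> carrier (GLn n)" "flag_point n k = flag_point n h" "\<forall>f\<in>F. f k = 0"
      unfolding Z_def by auto
    obtain b where b: "b \<in> Borel n" "h = k * b" using flag_point_eq_iff[OF k(1) h] k(2) by blast
    show "\<forall>f\<in>F. f h = 0"
    proof
      fix f assume f: "f \<in> F"
      then have "f \<in> regular_functions n" by (simp add: F_def)
      then obtain f' where f': "f' \<in> regular_functions n" "\<forall>u\<in>carrier (GLn n). f' u = f (u * b)"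
        using regular_right_translate[OF _ Borel_GL[OF b(1)]] by blast
      have "f' (cochar n t * g * c) = 0" if t: "t \<noteq> 0" and c: "c \<in> Borel n" for t c
      proof -
        have "f' (cochar n t * g * c) = f (cochar n t * g * c * b)"
          using f'(2) GL_mult[OF tg[OF t] Borel_GL[OF c]] by blast
        also have "\<dots> = f (cochar n t * g * (c * b))"
          by (simp only: GL_assoc[OF tg[OF t] Borel_GL[OF c] Borel_GL[OF b(1)]])
        also have "\<dots> = 0" using f t Borel_mult[OF c b(1)] by (simp add: F_def)
        finally show ?thesis .
      qed
      then have "f' \<in> F" using f'(1) by (simp add: F_def)
      then have "f' k = 0" using k(3) by blast
      then show "f h = 0" using f'(2) k(1) b(2) by simp
    qed
  next
    assume "\<forall>f\<in>F. f h = 0"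
    then show "flag_point n h \<in> Z" unfolding Z_def using h by blast
  qed
  have "zariski_closed_GL n {h \<in> carrier (GLn n). flag_point n h \<in> Z}"
    unfolding zariski_closed_GL_def
  proof (intro exI conjI)
    show "F \<subseteq> regular_functions n" unfolding F_def by blast
    show "{h \<in> carrier (GLn n). flag_point n h \<in> Z} = {h \<in> carrier (GLn n). \<forall>f\<in>F. f h = 0}"
      using mem by blast
  qed
  moreover have "Z \<subseteq> flag_variety n"
    unfolding Z_def flag_variety_def LCOSETS_def flag_point_def by blast
  ultimately have closed: "zariski_closed_flag n Z" by (simp add: zariski_closed_flag_def)
  have "\<forall>t. t \<noteq> 0 \<longrightarrow> flag_point n (cochar n t * g) \<in> Z"
  proof (intro allI impI)
    fix t :: complex assume t: "t \<noteq> 0"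
    have "f (cochar n t * g) = 0" if f: "f \<in> F" for f
    proof -
      have "f (cochar n t * g * 1\<^sub>m n) = 0" using f t Borel_one[of n] unfolding F_def by blast
      then show ?thesis using GL_one_mult(2)[OF tg[OF t]] by simp
    qed
    then show "flag_point n (cochar n t * g) \<in> Z" using mem[OF tg[OF t]] by blast
  qed
  moreover have "\<forall>h\<in>carrier (GLn n). flag_point n h \<in> Z \<longrightarrow> (\<forall>f\<in>regular_functions n.
      (\<forall>t b. t \<noteq> 0 \<longrightarrow> b \<in> Borel n \<longrightarrow> f (cochar n t * g * b) = 0) \<longrightarrow> f h = 0)"
  proof (intro ballI impI)
    fix h f assume h: "h \<in> carrier (GLn n)" "flag_point n h \<in> Z"
      and f: "f \<in> regular_functions n" "\<forall>t b. t \<noteq> 0 \<longrightarrow> b \<in> Borel n \<longrightarrow> f (cochar n t * g * b) = 0"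
    have "f \<in> F" unfolding F_def mem_Collect_eq using f by (rule conjI)
    then show "f h = 0" using mem[OF h(1)] h(2) by blast
  qed
  ultimately show ?thesis by (rule that[OF closed])
qed

text \<open>Both functions scale alike along the orbit, so their combination that vanishes at \<open>g\<close> is a regular
  function that vanishes on the orbit, hence on its closure.\<close>

lemma semi_invariant_proportional:
  assumes f: "semi_invariant n \<chi> d r f" and f': "semi_invariant n \<chi> d r f'"
    and g: "g \<in> hessenberg_matrices n" and h: "h \<in> carrier (GLn n)"
    and closure: "\<forall>f\<in>regular_functions n.
      (\<forall>t b. t \<noteq> 0 \<longrightarrow> b \<in> Borel n \<longrightarrow> f (cochar n t * g * b) = 0) \<longrightarrow> f h = 0"
  shows "f g * f' h = f' g * f h"
proof -
  let ?\<phi> = "\<lambda>u. f g * f' u + (- f' g) * f u"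
  have "?\<phi> \<in> regular_functions n"
    using f f' by (intro regular_functions.add regular_cmult) (simp_all add: semi_invariant_def)
  moreover have "\<forall>t b. t \<noteq> 0 \<longrightarrow> b \<in> Borel n \<longrightarrow> ?\<phi> (cochar n t * g * b) = 0"
  proof (intro allI impI)
    fix t :: complex and b assume tb: "t \<noteq> 0" "b \<in> Borel n"
    show "?\<phi> (cochar n t * g * b) = 0"
      using semi_invariantD[OF f g tb] semi_invariantD[OF f' g tb] by simp
  qed
  ultimately have "?\<phi> h = 0" using bspec[OF closure, of ?\<phi>] by blast
  then show ?thesis by simp
qed

lemma complex_root_exists:
  fixes z :: complex
  assumes "n > 0"
  obtains t where "t ^ n = z"
proof
  show "rcis (root n (cmod z)) (Arg z / real n) ^ n = z"
    using assms by (simp add: DeMoivre2 rcis_cmod_Arg real_root_pow_pos2)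
qed

text \<open>The projection of the subgroup \<open>A\<close> to \<open>\<int>\<close> is injective and cyclic. If \<open>d > 0\<close> generates the image and
  \<open>(d, s)\<close> belongs to \<open>A\<close>, any \<open>d\<close>-th root of \<open>s\<close> serves as \<open>t\<close>.\<close>

lemma graph_of_character:
  fixes A :: "(int \<times> complex) set"
  assumes one: "(0, 1) \<in> A"
    and mult: "\<And>r u r' u'. (r, u) \<in> A \<Longrightarrow> (r', u') \<in> A \<Longrightarrow> (r + r', u * u') \<in> A"
    and inv: "\<And>r u. (r, u) \<in> A \<Longrightarrow> (- r, inverse u) \<in> A"
    and inj: "\<And>u. (0, u) \<in> A \<Longrightarrow> u = 1"
    and nz: "\<And>r u. (r, u) \<in> A \<Longrightarrow> u \<noteq> 0"
  obtains t where "t \<noteq> 0" "\<And>r u. (r, u) \<in> A \<Longrightarrow> u = t powi r"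
proof (cases "\<exists>d>0. \<exists>u. (int d, u) \<in> A")
  case False
  have "r = 0" if A: "(r, u) \<in> A" for r u
  proof (rule ccontr)
    assume "r \<noteq> 0"
    then consider "r > 0" | "- r > 0" by linarith
    then show False
    proof cases
      case 1
      then have "nat r > 0" "(int (nat r), u) \<in> A" using A by auto
      then show False using False by blast
    next
      case 2
      then have "nat (- r) > 0" "(int (nat (- r)), inverse u) \<in> A" using inv[OF A] by auto
      then show False using False by blast
    qed
  qed
  then have "u = 1 powi r" if "(r, u) \<in> A" for r u using that inj by force
  then show ?thesis using that[of 1] by simp
next
  case True
  define d where "d = (LEAST d. d > 0 \<and> (\<exists>u. (int d, u) \<in> A))"
  have "d > 0 \<and> (\<exists>u. (int d, u) \<in> A)"
    unfolding d_def using True by (rule LeastI_ex)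
  then obtain s where d: "d > 0" and s: "(int d, s) \<in> A" by blast
  have min: "\<not> (\<exists>u. (int e, u) \<in> A)" if "0 < e" "e < d" for e
    using not_less_Least[of e "\<lambda>d. d > 0 \<and> (\<exists>u. (int d, u) \<in> A)"] that unfolding d_def by blast
  obtain t where t: "t ^ d = s" using complex_root_exists[OF d] .
  have s0: "s \<noteq> 0" by (rule nz[OF s])
  have t0: "t \<noteq> 0" using t s0 d by (metis power_eq_0_iff)
  have pow: "(int k * int d, s ^ k) \<in> A" for k
  proof (induction k)
    case (Suc k)
    from mult[OF s Suc] show ?case by (simp add: algebra_simps)
  qed (simp add: one)
  have powi: "(q * int d, s powi q) \<in> A" for q
  proof (cases "q \<ge> 0")
    case True
    then show ?thesis using pow[of "nat q"] by (simp add: power_int_def)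
  next
    case False
    then show ?thesis using inv[OF pow[of "nat (- q)"]] by (simp add: power_int_def power_inverse)
  qed
  have "u = t powi r" if A: "(r, u) \<in> A" for r u
  proof -
    define q where "q = r div int d"
    define e where "e = r mod int d"
    have r: "r = q * int d + e" by (simp add: q_def e_def)
    have e: "0 \<le> e" "e < int d" using d by (simp_all add: e_def)
    have "(r + - (q * int d), u * inverse (s powi q)) \<in> A" by (rule mult[OF A inv[OF powi]])
    then have eA: "(e, u * inverse (s powi q)) \<in> A" using r by simp
    have "e = 0"
    proof (rule ccontr)
      assume "e \<noteq> 0"
      then have "0 < nat e" "nat e < d" using e by auto
      then show False using min[of "nat e"] eA e by auto
    qed
    then have "u * inverse (s powi q) = 1" using inj eA by simp
    then have "u = s powi q" using s0 by (simp add: field_simps)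
    also have "\<dots> = (t powi int d) powi q" by (simp only: power_int_of_nat t)
    also have "\<dots> = t powi (int d * q)" by (rule power_int_mult[symmetric])
    also have "int d * q = r" using r \<open>e = 0\<close> by simp
    finally show ?thesis .
  qed
  then show ?thesis using that[OF t0] by blast
qed

text \<open>The balanced product \<open>E\<close> of \<open>M\<close> and \<open>M'\<close> is invariant, and so are suitable powers of \<open>E\<close> and of \<open>f\<close>,
  which have the same degree. Proportionality excludes \<open>E h = 0\<close>, because \<open>E g\<close> and \<open>f h\<close> are nonzero.\<close>

lemma nonvanishing_on_closure:
  assumes proportional: "\<And>d r f f'. semi_invariant n \<chi> d r f \<Longrightarrow> semi_invariant n \<chi> d r f' \<Longrightarrow> f g * f' h = f' g * f h"
    and M: "semi_invariant n \<chi> 1 a M" and M': "semi_invariant n \<chi> 1 b M'"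
    and ab: "a > 0" "b < 0" and nz: "M g \<noteq> 0" "M' g \<noteq> 0"
    and f: "semi_invariant n \<chi> m 0 f" "m > 0" "f h \<noteq> 0"
  shows "M h \<noteq> 0 \<and> M' h \<noteq> 0"
proof -
  let ?p = "nat a" and ?q = "nat (- b)"
  let ?E = "\<lambda>u. M u ^ ?q * M' u ^ ?p"
  have E: "semi_invariant n \<chi> (?q + ?p) 0 ?E"
    by (rule semi_invariant_balanced[OF M M']) (use ab in simp_all)
  have "semi_invariant n \<chi> (m * (?q + ?p)) 0 (\<lambda>u. ?E u ^ m)"
    using semi_invariant_power[OF E, of m] by simp
  moreover have "semi_invariant n \<chi> (m * (?q + ?p)) 0 (\<lambda>u. f u ^ (?q + ?p))"
    using semi_invariant_power[OF f(1), of "?q + ?p"] by (simp add: mult.commute)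
  ultimately have "?E g ^ m * f h ^ (?q + ?p) = f g ^ (?q + ?p) * ?E h ^ m" by (rule proportional)
  moreover have "?E g ^ m * f h ^ (?q + ?p) \<noteq> 0" using nz f(3) by simp
  ultimately have "?E h ^ m \<noteq> 0" by auto
  then have "?E h \<noteq> 0" using f(2) by (metis power_eq_0_iff)
  then show ?thesis using ab by auto
qed

text \<open>For two semi-invariants of the same degree, nonzero at \<open>g\<close> and \<open>h\<close>, consider the difference of their
  weights and the factor by which their quotient changes from \<open>g\<close> to \<open>h\<close>. These pairs form a subgroup as in
  \<open>graph_of_character\<close>. The normalization by \<open>M\<close> removes the common factor that a semi-invariant
  of degree \<open>1\<close> picks up from the choice of \<open>h\<close> in its flag.\<close>

lemma closure_point_scaling:
  assumes proportional: "\<And>d r f f'. semi_invariant n \<chi> d r f \<Longrightarrow> semi_invariant n \<chi> d r f' \<Longrightarrow> f g * f' h = f' g * f h"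
    and M: "semi_invariant n \<chi> 1 a M" and M': "semi_invariant n \<chi> 1 b M'"
    and ab: "a > 0" "b < 0" and nz: "M g \<noteq> 0" "M' g \<noteq> 0" "M h \<noteq> 0" "M' h \<noteq> 0"
  obtains t where "t \<noteq> 0"
    "\<forall>r N. semi_invariant n \<chi> 1 r N \<longrightarrow> N h * (t powi a * M g) = (t powi r * N g) * M h"
proof -
  define A where "A = {(r - r', (f h * f' g) / (f' h * f g)) | r r' d f f'.
    semi_invariant n \<chi> d r f \<and> semi_invariant n \<chi> d r' f' \<and> f g \<noteq> 0 \<and> f h \<noteq> 0 \<and> f' g \<noteq> 0 \<and> f' h \<noteq> 0}"
  have AI: "(r - r', (f h * f' g) / (f' h * f g)) \<in> A"
    if "semi_invariant n \<chi> d r f" "semi_invariant n \<chi> d r' f'" "f g \<noteq> 0" "f h \<noteq> 0" "f' g \<noteq> 0" "f' h \<noteq> 0"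
    for r r' d f f'
    unfolding A_def using that by blast
  have AE: "\<exists>r1 r2 d f f'. r = r1 - r2 \<and> u = (f h * f' g) / (f' h * f g) \<and> semi_invariant n \<chi> d r1 f \<and>
      semi_invariant n \<chi> d r2 f' \<and> f g \<noteq> 0 \<and> f h \<noteq> 0 \<and> f' g \<noteq> 0 \<and> f' h \<noteq> 0"
    if "(r, u) \<in> A" for r u
    using that unfolding A_def by blast
  obtain t where t: "t \<noteq> 0" "\<And>r u. (r, u) \<in> A \<Longrightarrow> u = t powi r"
  proof (rule graph_of_character)
    show "(0, 1) \<in> A" using AI[OF M M nz(1,3,1,3)] nz by simp
    show "(r + r', u * u') \<in> A" if 1: "(r, u) \<in> A" and 2: "(r', u') \<in> A" for r u r' u'
    proof -
      obtain r1 r2 d f1 f2 where f: "r = r1 - r2" "u = (f1 h * f2 g) / (f2 h * f1 g)"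
        "semi_invariant n \<chi> d r1 f1" "semi_invariant n \<chi> d r2 f2" "f1 g \<noteq> 0" "f1 h \<noteq> 0" "f2 g \<noteq> 0" "f2 h \<noteq> 0"
        using AE[OF 1] by blast
      obtain s1 s2 e k1 k2 where k: "r' = s1 - s2" "u' = (k1 h * k2 g) / (k2 h * k1 g)"
        "semi_invariant n \<chi> e s1 k1" "semi_invariant n \<chi> e s2 k2" "k1 g \<noteq> 0" "k1 h \<noteq> 0" "k2 g \<noteq> 0" "k2 h \<noteq> 0"
        using AE[OF 2] by blast
      have "((r1 + s1) - (r2 + s2), ((f1 h * k1 h) * (f2 g * k2 g)) / ((f2 h * k2 h) * (f1 g * k1 g))) \<in> A"
        by (rule AI[OF semi_invariant_mult[OF f(3) k(3)] semi_invariant_mult[OF f(4) k(4)]])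
          (use f k in simp_all)
      moreover have "(r1 + s1) - (r2 + s2) = r + r'" using f(1) k(1) by simp
      moreover have "((f1 h * k1 h) * (f2 g * k2 g)) / ((f2 h * k2 h) * (f1 g * k1 g)) = u * u'"
        unfolding f(2) k(2) by (simp add: ac_simps)
      ultimately show ?thesis by simp
    qed
    show "(- r, inverse u) \<in> A" if 1: "(r, u) \<in> A" for r u
    proof -
      obtain r1 r2 d f1 f2 where f: "r = r1 - r2" "u = (f1 h * f2 g) / (f2 h * f1 g)"
        "semi_invariant n \<chi> d r1 f1" "semi_invariant n \<chi> d r2 f2" "f1 g \<noteq> 0" "f1 h \<noteq> 0" "f2 g \<noteq> 0" "f2 h \<noteq> 0"
        using AE[OF 1] by blast
      have "(r2 - r1, (f2 h * f1 g) / (f1 h * f2 g)) \<in> A" by (rule AI[OF f(4,3,7,8,5,6)])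
      then show ?thesis using f(1,2) by (simp add: inverse_eq_divide)
    qed
    show "u = 1" if 1: "(0, u) \<in> A" for u
    proof -
      obtain r1 r2 d f1 f2 where f: "0 = r1 - r2" "u = (f1 h * f2 g) / (f2 h * f1 g)"
        "semi_invariant n \<chi> d r1 f1" "semi_invariant n \<chi> d r2 f2" "f1 g \<noteq> 0" "f1 h \<noteq> 0" "f2 g \<noteq> 0" "f2 h \<noteq> 0"
        using AE[OF 1] by blast
      have "r2 = r1" using f(1) by simp
      then have "f1 g * f2 h = f2 g * f1 h" using proportional[OF f(3)] f(4) by simp
      then show ?thesis unfolding f(2) using f(5-8) by (simp add: ac_simps)
    qed
    show "u \<noteq> 0" if 1: "(r, u) \<in> A" for r u
      using AE[OF 1] by auto
  qed (rule that, assumption, blast)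
  \<comment> \<open>Combined with the extremal product whose weight has the opposite sign, \<open>N\<close> becomes invariant and
    can be compared with \<open>E\<close>, which is nonzero at both points.\<close>
  have zero: "N g = 0 \<longleftrightarrow> N h = 0" if N: "semi_invariant n \<chi> 1 r N" for r N
  proof -
    let ?p = "nat a" and ?q = "nat (- b)"
    have key: "N g = 0 \<longleftrightarrow> N h = 0"
      if K: "semi_invariant n \<chi> 1 k K" and eq: "int e * r + int l * k = 0" and e: "e > 0"
        and K0: "K g \<noteq> 0" "K h \<noteq> 0" for k K e l
    proof -
      let ?X = "\<lambda>u. N u ^ e * K u ^ l" and ?E = "\<lambda>u. M u ^ ?q * M' u ^ ?p"
      have "semi_invariant n \<chi> (e * 1 + l * 1) (int e * r + int l * k) ?X"
        by (rule semi_invariant_mult[OF semi_invariant_power[OF N] semi_invariant_power[OF K]])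
      then have X: "semi_invariant n \<chi> (e + l) 0 ?X" unfolding eq by simp
      have E: "semi_invariant n \<chi> (?q + ?p) 0 ?E"
        by (rule semi_invariant_balanced[OF M M']) (use ab in simp_all)
      have "semi_invariant n \<chi> ((?q + ?p) * (e + l)) 0 (\<lambda>u. ?X u ^ (?q + ?p))"
        using semi_invariant_power[OF X, of "?q + ?p"] by simp
      moreover have "semi_invariant n \<chi> ((?q + ?p) * (e + l)) 0 (\<lambda>u. ?E u ^ (e + l))"
        using semi_invariant_power[OF E, of "e + l"] by (simp add: mult.commute)
      ultimately have "?X g ^ (?q + ?p) * ?E h ^ (e + l) = ?E g ^ (e + l) * ?X h ^ (?q + ?p)" by (rule proportional)
      moreover have "?E g ^ (e + l) \<noteq> 0" "?E h ^ (e + l) \<noteq> 0" using nz by simp_all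
      ultimately have "?X g ^ (?q + ?p) = 0 \<longleftrightarrow> ?X h ^ (?q + ?p) = 0" by (metis mult_eq_0_iff)
      moreover have "?q + ?p > 0" using ab by simp
      ultimately have "?X g = 0 \<longleftrightarrow> ?X h = 0" by simp
      then show ?thesis using K0 e by simp
    qed
    show ?thesis
    proof (cases "r \<ge> 0")
      case True
      show ?thesis by (rule key[OF M', of ?q "nat r"]) (use True ab nz in simp_all)
    next
      case False
      show ?thesis by (rule key[OF M, of ?p "nat (- r)"]) (use False ab nz in simp_all)
    qed
  qed
  have "N h * (t powi a * M g) = (t powi r * N g) * M h" if N: "semi_invariant n \<chi> 1 r N" for r N
  proof (cases "N g = 0")
    case True
    then show ?thesis using zero[OF N] by simp
  next
    case False
    then have "N h \<noteq> 0" using zero[OF N] by simp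
    then have "(N h * M g) / (M h * N g) = t powi (r - a)"
      using t(2)[OF AI[OF N M]] False nz by simp
    then have "N h * M g = t powi (r - a) * (M h * N g)" using False nz by (simp add: field_simps)
    then have "t powi a * (N h * M g) = (t powi a * t powi (r - a)) * (M h * N g)"
      by (simp only: mult.assoc)
    also have "t powi a * t powi (r - a) = t powi r" using t(1) by (simp add: power_int_add[symmetric])
    finally have "t powi a * (N h * M g) = t powi r * (M h * N g)" .
    then show ?thesis by (simp only: ac_simps)
  qed
  then have "\<forall>r N. semi_invariant n \<chi> 1 r N \<longrightarrow> N h * (t powi a * M g) = (t powi r * N g) * M h"
    by blast
  then show ?thesis by (rule that[OF t(1)])
qed

section \<open>The stable and the polystable locus\<close>

lemma fixed_point_semistable:
  assumes dom: "regular_dominant n \<chi>" and K: "K \<subseteq> simple_roots n"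
    and zero: "pairing n (weyl_act n (longest n K) \<chi>) = 0"
  shows "fixed_point n K \<in> semistable_locus n \<chi>"
  using semistable_Y0_iff[OF dom K K, of "fixed_point n K"] Y0_diagonal[OF K] zero by simp

text \<open>If the extremal weight of a cell is \<open>0\<close>, the limit of a point in that cell is semistable, hence
  belongs to the orbit of the point when this orbit is closed in the semistable locus.\<close>

lemma (in triangular_direction) polystable_limit:
  assumes g: "g \<in> hessenberg_matrices n" and K: "K \<subseteq> simple_roots n"
    and cell: "flag_point n g \<in> cell n (triangular R n) (longest n K)"
    and zero: "pairing n (weyl_act n (longest n K) \<chi>) = 0"
    and ps: "flag_point n g \<in> polystable_locus n \<chi>" and dom: "regular_dominant n \<chi>"
  shows "flag_point n g = fixed_point n K"
proof -
  note w = longest_permutes[OF K] and gG = hessenberg_GL[OF g]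
  obtain Z where Z: "zariski_closed_flag n Z"
    "orbit (G0 n) (flag_act n) (flag_point n g) = Z \<inter> semistable_locus n \<chi>"
    using ps unfolding polystable_locus_def by blast
  have "flag_point n (perm_mat n (longest n K)) \<in> Z"
  proof (rule closed_contains_limit[OF Z(1) gG w cell])
    fix t :: complex assume "t \<noteq> 0"
    then show "flag_point n (cochar n t * g) \<in> Z" using Z(2) orbit_flag_point[OF gG] by blast
  qed
  moreover have "flag_point n (perm_mat n (longest n K)) \<in> semistable_locus n \<chi>"
    using fixed_point_semistable[OF dom K zero] by (simp add: fixed_point_def)
  ultimately have "flag_point n (perm_mat n (longest n K)) \<in> orbit (G0 n) (flag_act n) (flag_point n g)"
    unfolding Z(2) by blast
  then obtain t where t: "t \<noteq> 0" "flag_point n (perm_mat n (longest n K)) = flag_point n (cochar n t * g)"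
    unfolding orbit_flag_point[OF gG] by blast
  have it: "inverse t \<noteq> 0" using t(1) by simp
  have "cochar n (inverse t) * cochar n t = 1\<^sub>m n"
    using t(1) unfolding cochar_def mat_diag_diag
    by (simp add: power_mult_distrib[symmetric] del: power_Suc)
  then have "cochar n (inverse t) * (cochar n t * g) = g"
    using GL_assoc[OF cochar_GL[OF it] cochar_GL[OF t(1)] gG] GL_one_mult(1)[OF gG] by simp
  then have "flag_point n g = flag_act n (cochar n (inverse t)) (flag_point n (cochar n t * g))"
    using flag_act_point[OF cochar_GL[OF it] GL_mult[OF cochar_GL[OF t(1)] gG]] by simp
  also have "\<dots> = flag_point n (perm_mat n (longest n K))"
    unfolding t(2)[symmetric] by (rule flag_act_fixed_point[OF w it])
  finally show ?thesis by (simp add: fixed_point_def)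
qed

context
  fixes n :: nat and \<chi> :: "nat \<Rightarrow> int"
  assumes dom: "regular_dominant n \<chi>"
begin

abbreviation (input) extremal_weight :: "(nat \<Rightarrow> int) set \<Rightarrow> int" where
  "extremal_weight I \<equiv> pairing n (weyl_act n (longest n I) \<chi>)"

lemma semistable_orbit:
  assumes g: "g \<in> hessenberg_matrices n" and t: "t \<noteq> 0" and ss: "flag_point n g \<in> semistable_locus n \<chi>"
  shows "flag_point n (cochar n t * g) \<in> semistable_locus n \<chi>"
proof -
  obtain m f where m: "m > 0" and f: "semi_invariant n \<chi> m 0 f" "f g \<noteq> 0"
    using semistable_iff[OF g] ss by blast
  have tg: "cochar n t * g \<in> hessenberg_matrices n" by (rule hessenberg_cochar[OF g t])
  have "f (cochar n t * g) = f g"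
    using semi_invariantD[OF f(1) g t Borel_one] GL_one_mult(2)[OF hessenberg_GL[OF tg]]
    by (simp add: char_val_one)
  then show ?thesis using semistable_iff[OF tg] m f by metis
qed

lemma semi_invariant_cochar:
  assumes f: "semi_invariant n \<chi> d r f" and g: "g \<in> hessenberg_matrices n" and t: "t \<noteq> 0"
  shows "f (cochar n t * g) = t powi r * f g"
  using semi_invariantD[OF f g t Borel_one] GL_one_mult(2)[OF hessenberg_GL[OF hessenberg_cochar[OF g t]]]
  by (simp add: char_val_one)

text \<open>A semistable point of the orbit closure is obtained from \<open>x\<close> by the scaling that
  \<open>closure_point_scaling\<close> provides, as it has the same coordinates in the chart at \<open>w\<^sub>I\<close>.\<close>

lemma strictly_between_polystable:
  assumes I: "I \<subseteq> simple_roots n" and J: "J \<subseteq> simple_roots n" and x: "x \<in> Y0 n I J"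
    and ab: "extremal_weight I > 0" "extremal_weight J < 0"
  shows "x \<in> polystable_locus n \<chi>"
proof -
  note wI = longest_permutes[OF I] and wJ = longest_permutes[OF J]
  obtain g where g: "g \<in> hessenberg_matrices n" "x = flag_point n g"
    "flag_point n g \<in> cell n (triangular (\<le>) n) (longest n I)"
    "flag_point n g \<in> cell n (triangular (\<ge>) n) (longest n J)"
    using Y0_flag_point[OF x] .
  note gG = hessenberg_GL[OF g(1)]
  let ?M = "minor_product n \<chi> (extremal_rows (longest n I))"
    and ?M' = "minor_product n \<chi> (extremal_rows (longest n J))"
  note M = semi_invariant_extremal[OF dom wI] and M' = semi_invariant_extremal[OF dom wJ]
  have nz: "?M g \<noteq> 0" "?M' g \<noteq> 0"
    using upper.minor_product_extremal_nonzero[OF wI gG g(3)]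
      lower.minor_product_extremal_nonzero[OF wJ gG g(4)] by blast+
  have ss: "flag_point n g \<in> semistable_locus n \<chi>"
    using semistable_Y0_iff[OF dom I J x] ab g(2) by simp
  obtain Z where Z: "zariski_closed_flag n Z" "\<forall>t. t \<noteq> 0 \<longrightarrow> flag_point n (cochar n t * g) \<in> Z"
    and closure: "\<forall>h\<in>carrier (GLn n). flag_point n h \<in> Z \<longrightarrow> (\<forall>f\<in>regular_functions n.
      (\<forall>t b. t \<noteq> 0 \<longrightarrow> b \<in> Borel n \<longrightarrow> f (cochar n t * g * b) = 0) \<longrightarrow> f h = 0)"
    by (rule orbit_closure[OF gG])
  have sub: "y \<in> orbit (G0 n) (flag_act n) x" if y: "y \<in> Z" "y \<in> semistable_locus n \<chi>" for y
  proof -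
    have "y \<in> Pet n" using y(2) by (simp add: semistable_locus_def)
    then obtain h where h: "h \<in> hessenberg_matrices n" "y = flag_point n h" by (rule Pet_cases)
    note hG = hessenberg_GL[OF h(1)]
    have proportional: "f g * f' h = f' g * f h" if "semi_invariant n \<chi> d r f" "semi_invariant n \<chi> d r f'" for d r f f'
      by (rule semi_invariant_proportional[OF that g(1) hG mp[OF bspec[OF closure hG]]]) (use y(1) h(2) in simp)
    obtain m f where f: "semi_invariant n \<chi> m 0 f" "m > 0" "f h \<noteq> 0"
      using semistable_iff[OF h(1)] y(2) h(2) by blast
    have both: "?M h \<noteq> 0 \<and> ?M' h \<noteq> 0"
      by (rule nonvanishing_on_closure[OF proportional M M' ab nz f])
    have nzh: "?M h \<noteq> 0" "?M' h \<noteq> 0"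
      by (rule conjunct1[OF both]) (rule conjunct2[OF both])
    obtain t where t: "t \<noteq> 0"
      "\<forall>r N. semi_invariant n \<chi> 1 r N \<longrightarrow>
        N h * (t powi extremal_weight I * ?M g) = (t powi r * N g) * ?M h"
      by (rule closure_point_scaling[OF proportional M M' ab nz nzh])
    have tg: "cochar n t * g \<in> hessenberg_matrices n" by (rule hessenberg_cochar[OF g(1) t(1)])
    have "flag_point n (cochar n t * g) = flag_point n h"
    proof (rule flag_point_eq_of_coordinates[OF dom wI hessenberg_GL[OF tg] hG _ nzh(1)])
      show "?M (cochar n t * g) \<noteq> 0"
        unfolding semi_invariant_cochar[OF M g(1) t(1)] using nz(1) t(1) by simp
      fix i j assume ij: "j < i" "i < n"
      have N: "semi_invariant n \<chi> 1 (minor_weight n \<chi> (exchange_rows (longest n I) i j))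
          (minor_product n \<chi> (exchange_rows (longest n I) i j))"
        by (rule semi_invariant_minor_product[OF dom])
          (use ij in \<open>auto simp: exchange_rows_def perm_shift_less[OF wI]\<close>)
      show "minor_product n \<chi> (exchange_rows (longest n I) i j) (cochar n t * g) * ?M h =
          minor_product n \<chi> (exchange_rows (longest n I) i j) h * ?M (cochar n t * g)"
        unfolding semi_invariant_cochar[OF N g(1) t(1)] semi_invariant_cochar[OF M g(1) t(1)]
        using t(2) N by simp
    qed
    then show ?thesis unfolding g(2) orbit_flag_point[OF gG] h(2) using t(1) by blast
  qed
  have sup: "y \<in> Z \<inter> semistable_locus n \<chi>" if "y \<in> orbit (G0 n) (flag_act n) x" for y
  proof -
    obtain t where t: "t \<noteq> 0" "y = flag_point n (cochar n t * g)"
      using \<open>y \<in> orbit (G0 n) (flag_act n) x\<close> unfolding g(2) orbit_flag_point[OF gG] by blast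
    show ?thesis unfolding t(2) using Z(2) t(1) semistable_orbit[OF g(1) t(1) ss] by blast
  qed
  have "orbit (G0 n) (flag_act n) x = Z \<inter> semistable_locus n \<chi>"
    using sub sup by blast
  then show ?thesis unfolding polystable_locus_def using ss g(2) Z(1) by blast
qed

text \<open>If \<open>\<lambda>(t)\<close> fixes the point, \<open>t\<close> raised to either weight is the value of \<open>\<chi>\<close> at the same element of \<open>B\<close>.\<close>

lemma strictly_between_finite_stabilizer:
  assumes I: "I \<subseteq> simple_roots n" and J: "J \<subseteq> simple_roots n" and x: "x \<in> Y0 n I J"
    and ab: "extremal_weight I > 0" "extremal_weight J < 0"
  shows "finite (stabilizer (G0 n) (flag_act n) x)"
proof -
  note wI = longest_permutes[OF I] and wJ = longest_permutes[OF J]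
  obtain g where g: "g \<in> hessenberg_matrices n" "x = flag_point n g"
    "flag_point n g \<in> cell n (triangular (\<le>) n) (longest n I)"
    "flag_point n g \<in> cell n (triangular (\<ge>) n) (longest n J)"
    using Y0_flag_point[OF x] .
  note gG = hessenberg_GL[OF g(1)]
  let ?M = "minor_product n \<chi> (extremal_rows (longest n I))"
    and ?M' = "minor_product n \<chi> (extremal_rows (longest n J))"
  note M = semi_invariant_extremal[OF dom wI] and M' = semi_invariant_extremal[OF dom wJ]
  have nz: "?M g \<noteq> 0" "?M' g \<noteq> 0"
    using upper.minor_product_extremal_nonzero[OF wI gG g(3)]
      lower.minor_product_extremal_nonzero[OF wJ gG g(4)] by blast+
  let ?N = "nat (extremal_weight I - extremal_weight J)"
  have "stabilizer (G0 n) (flag_act n) x \<subseteq> cochar n ` {t. t ^ ?N = 1}"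
  proof
    fix k assume "k \<in> stabilizer (G0 n) (flag_act n) x"
    then have k: "k \<in> carrier (G0 n)" "flag_act n k x = x" by (simp_all add: stabilizer_def)
    obtain t where t: "t \<noteq> 0" "k = cochar n t" using G0_cases[OF k(1)] .
    have "flag_point n g = flag_point n (cochar n t * g)"
      using k(2) unfolding t(2) g(2) flag_act_point[OF cochar_GL[OF t(1)] gG] by simp
    then obtain c where c: "c \<in> Borel n" "cochar n t * g = g * c"
      using flag_point_eq_iff[OF gG GL_mult[OF cochar_GL[OF t(1)] gG]] by blast
    have B: "f (g * c) = char_val n \<chi> c * f g" if "semi_invariant n \<chi> 1 r f" for r f
      using semi_invariantD[OF that g(1) _ c(1), of 1] GL_one_mult(1)[OF gG] by (simp add: cochar_def)
    have "t powi extremal_weight I = char_val n \<chi> c" "t powi extremal_weight J = char_val n \<chi> c"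
      using B[OF M] B[OF M'] semi_invariant_cochar[OF M g(1) t(1)] semi_invariant_cochar[OF M' g(1) t(1)]
        nz unfolding c(2) by simp_all
    then have "t powi (extremal_weight I - extremal_weight J) = 1"
      using t(1) char_val_nonzero[OF c(1)] by (simp add: power_int_diff)
    then have "t ^ ?N = 1" using ab by (simp add: power_int_def)
    then show "k \<in> cochar n ` {t. t ^ ?N = 1}" unfolding t(2) by blast
  qed
  moreover have "finite {t :: complex. t ^ ?N = 1}" by (rule finite_roots_unity) (use ab in simp)
  ultimately show ?thesis by (meson finite_imageI finite_subset)
qed

lemma singleton_fixed_point_closed:
  assumes w: "w permutes {1..n}"
  shows "zariski_closed_flag n {flag_point n (perm_mat n w)}"
proof -
  let ?P = "perm_mat n w" and ?F = "{(\<lambda>g :: complex mat. g $$ (perm_shift w i, j)) | i j. j < i \<and> i < n}"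
  have P: "?P \<in> carrier (GLn n)" by (rule perm_mat_GL[OF w])
  have iff: "flag_point n g \<in> {flag_point n ?P} \<longleftrightarrow> (\<forall>f\<in>?F. f g = 0)" if g: "g \<in> carrier (GLn n)" for g
  proof -
    have inv: "inv\<^bsub>GLn n\<^esub> ?P * g \<in> carrier (GLn n)" by (rule GL_mult[OF GL_inv[OF P] g])
    have "flag_point n g \<in> {flag_point n ?P} \<longleftrightarrow> (\<exists>b\<in>Borel n. g = ?P * b)"
      using flag_point_eq_iff[OF P g] by (auto simp: eq_commute)
    also have "\<dots> \<longleftrightarrow> inv\<^bsub>GLn n\<^esub> ?P * g \<in> Borel n"
    proof
      assume "\<exists>b\<in>Borel n. g = ?P * b"
      then obtain b where b: "b \<in> Borel n" "g = ?P * b" by blast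
      then show "inv\<^bsub>GLn n\<^esub> ?P * g \<in> Borel n" using GL_cancel(1)[OF P Borel_GL[OF b(1)]] by simp
    next
      assume "inv\<^bsub>GLn n\<^esub> ?P * g \<in> Borel n"
      then show "\<exists>b\<in>Borel n. g = ?P * b" using GL_cancel(2)[OF P g, symmetric] by (rule bexI[rotated])
    qed
    also have "\<dots> \<longleftrightarrow> (\<forall>i<n. \<forall>j<i. g $$ (perm_shift w i, j) = 0)"
    proof -
      have entry: "(inv\<^bsub>GLn n\<^esub> ?P * g) $$ (i, j) = g $$ (perm_shift w i, j)" if "i < n" "j < n" for i j
        by (rule inv_perm_mat_mult_entry[OF w GL_carrier_mat[OF g] that])
      show ?thesis
        unfolding Borel_eq triangular_def using inv entry by (auto simp: not_le)
    qed
    also have "\<dots> \<longleftrightarrow> (\<forall>f\<in>?F. f g = 0)"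
    proof
      assume zero: "\<forall>i<n. \<forall>j<i. g $$ (perm_shift w i, j) = 0"
      show "\<forall>f\<in>?F. f g = 0"
      proof
        fix f assume "f \<in> ?F"
        then obtain i j where "f = (\<lambda>g. g $$ (perm_shift w i, j))" "j < i" "i < n" by blast
        then show "f g = 0" using zero by simp
      qed
    next
      assume van: "\<forall>f\<in>?F. f g = 0"
      show "\<forall>i<n. \<forall>j<i. g $$ (perm_shift w i, j) = 0"
      proof (intro allI impI)
        fix i j assume "i < n" "j < i"
        then have "(\<lambda>g :: complex mat. g $$ (perm_shift w i, j)) \<in> ?F" by blast
        with van show "g $$ (perm_shift w i, j) = 0" by (rule bspec)
      qed
    qed
    finally show ?thesis .
  qed
  have "?F \<subseteq> regular_functions n"
  proof
    fix f assume "f \<in> ?F"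
    then obtain i j where "f = (\<lambda>g. g $$ (perm_shift w i, j))" "j < i" "i < n" by blast
    then show "f \<in> regular_functions n"
      using perm_shift_less[OF w, of i] by (simp add: regular_functions.entry)
  qed
  moreover have "{g \<in> carrier (GLn n). flag_point n g \<in> {flag_point n ?P}} = {g \<in> carrier (GLn n). \<forall>f\<in>?F. f g = 0}"
    by (rule Collect_cong, rule conj_cong[OF refl iff])
  ultimately have "zariski_closed_GL n {g \<in> carrier (GLn n). flag_point n g \<in> {flag_point n ?P}}"
    unfolding zariski_closed_GL_def by (intro exI[of _ ?F] conjI)
  moreover have "{flag_point n ?P} \<subseteq> flag_variety n"
    unfolding flag_variety_def LCOSETS_def flag_point_def using P by blast
  ultimately show ?thesis by (simp only: zariski_closed_flag_def)
qed

lemma fixed_point_polystable: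
  assumes K: "K \<subseteq> simple_roots n" and zero: "extremal_weight K = 0"
  shows "fixed_point n K \<in> polystable_locus n \<chi>"
proof -
  note w = longest_permutes[OF K]
  let ?p = "flag_point n (perm_mat n (longest n K))"
  have act: "flag_act n h ?p = ?p" if "h \<in> carrier (G0 n)" for h
    using G0_cases[OF that] flag_act_fixed_point[OF w] by metis
  have "cochar n 1 \<in> carrier (G0 n)" unfolding G0_carrier by (rule imageI) simp
  then have "orbit (G0 n) (flag_act n) ?p = {?p}"
    unfolding orbit_def using act by blast
  also have "\<dots> = {?p} \<inter> semistable_locus n \<chi>"
    using fixed_point_semistable[OF dom assms] unfolding fixed_point_def by blast
  finally show ?thesis
    unfolding polystable_locus_def fixed_point_def
    using fixed_point_semistable[OF dom assms] singleton_fixed_point_closed[OF w] unfolding fixed_point_def by blast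
qed

lemma fixed_point_infinite_stabilizer:
  assumes n: "n \<ge> 1" and K: "K \<subseteq> simple_roots n"
  shows "infinite (stabilizer (G0 n) (flag_act n) (fixed_point n K))"
proof
  note w = longest_permutes[OF K]
  assume fin: "finite (stabilizer (G0 n) (flag_act n) (fixed_point n K))"
  have "cochar n ` (UNIV - {0}) \<subseteq> stabilizer (G0 n) (flag_act n) (fixed_point n K)"
  proof
    fix h assume h: "h \<in> cochar n ` (UNIV - {0})"
    then have hG: "h \<in> carrier (G0 n)" by (simp add: G0_carrier)
    then obtain t where "t \<noteq> 0" "h = cochar n t" by (rule G0_cases)
    then show "h \<in> stabilizer (G0 n) (flag_act n) (fixed_point n K)"
      unfolding stabilizer_def fixed_point_def using hG flag_act_fixed_point[OF w] by simp
  qed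
  then have "finite (cochar n ` (UNIV - {0}))" using fin by (rule finite_subset)
  moreover have "inj_on (cochar n) (UNIV - {0})"
  proof (rule inj_onI)
    fix s t :: complex assume "cochar n s = cochar n t"
    then have "cochar n s $$ (0, 0) = cochar n t $$ (0, 0)" by simp
    then show "s = t" using n by (simp add: cochar_def mat_diag_def)
  qed
  ultimately have "finite (UNIV - {0 :: complex})" by (rule finite_imageD)
  then show False using infinite_UNIV_char_0[where 'a = complex] by simp
qed

lemma polystable_cases:
  assumes I: "I \<subseteq> simple_roots n" and J: "J \<subseteq> simple_roots n" and x: "x \<in> Y0 n I J"
    and ps: "x \<in> polystable_locus n \<chi>"
  shows "(extremal_weight I > 0 \<and> extremal_weight J < 0) \<or>
    (\<exists>K. K \<subseteq> simple_roots n \<and> extremal_weight K = 0 \<and> x = fixed_point n K)"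
proof -
  obtain g where g: "g \<in> hessenberg_matrices n" "x = flag_point n g"
    "flag_point n g \<in> cell n (triangular (\<le>) n) (longest n I)"
    "flag_point n g \<in> cell n (triangular (\<ge>) n) (longest n J)"
    using Y0_flag_point[OF x] .
  have ps': "flag_point n g \<in> polystable_locus n \<chi>" using ps g(2) by simp
  have "x \<in> semistable_locus n \<chi>" using ps by (simp add: polystable_locus_def)
  then have "extremal_weight I \<ge> 0 \<and> extremal_weight J \<le> 0" using semistable_Y0_iff[OF dom I J x] by blast
  then consider "extremal_weight I > 0 \<and> extremal_weight J < 0" | "extremal_weight I = 0" | "extremal_weight J = 0"
    by linarith
  then show ?thesis
  proof cases
    case 2
    then show ?thesis using upper.polystable_limit[OF g(1) I g(3) 2 ps' dom] I g(2) by blast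
  next
    case 3
    then show ?thesis using lower.polystable_limit[OF g(1) J g(4) 3 ps' dom] J g(2) by blast
  qed blast
qed

lemma stable_locus_eq:
  assumes n: "n \<ge> 1"
  shows "stable_locus n \<chi> = (\<Union>(I, J)\<in>{(I, J). J \<subseteq> I \<and> I \<subseteq> simple_roots n \<and>
    extremal_weight I > 0 \<and> extremal_weight J < 0}. Y0 n I J)" (is "_ = ?U")
proof (rule Set.set_eqI, rule iffI)
  fix x assume st: "x \<in> stable_locus n \<chi>"
  then have ps: "x \<in> polystable_locus n \<chi>" and fin: "finite (stabilizer (G0 n) (flag_act n) x)"
    by (simp_all add: stable_locus_def)
  have "x \<in> Pet n" using ps by (simp add: polystable_locus_def semistable_locus_def)
  then obtain I J where IJ: "J \<subseteq> I" "I \<subseteq> simple_roots n" "x \<in> Y0 n I J" by (rule Pet_stratification)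
  have "extremal_weight I > 0 \<and> extremal_weight J < 0"
    using polystable_cases[OF IJ(2) order_trans[OF IJ(1,2)] IJ(3) ps] fixed_point_infinite_stabilizer[OF n] fin
    by blast
  then show "x \<in> ?U" using IJ by blast
next
  fix x assume "x \<in> ?U"
  then obtain I J where IJ: "J \<subseteq> I" "I \<subseteq> simple_roots n" "x \<in> Y0 n I J"
    "extremal_weight I > 0" "extremal_weight J < 0" by blast
  note J = order_trans[OF IJ(1,2)]
  show "x \<in> stable_locus n \<chi>"
    unfolding stable_locus_def
    using strictly_between_polystable[OF IJ(2) J IJ(3-5)] strictly_between_finite_stabilizer[OF IJ(2) J IJ(3-5)]
    by blast
qed

lemma polystable_locus_eq:
  assumes n: "n \<ge> 1"
  shows "polystable_locus n \<chi> = stable_locus n \<chi> \<union>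
    (\<Union>I\<in>{I. I \<subseteq> simple_roots n \<and> extremal_weight I = 0}. {fixed_point n I})" (is "_ = _ \<union> ?F")
proof (rule Set.set_eqI, rule iffI)
  fix x assume ps: "x \<in> polystable_locus n \<chi>"
  have "x \<in> Pet n" using ps by (simp add: polystable_locus_def semistable_locus_def)
  then obtain I J where IJ: "J \<subseteq> I" "I \<subseteq> simple_roots n" "x \<in> Y0 n I J" by (rule Pet_stratification)
  note J = order_trans[OF IJ(1,2)]
  from polystable_cases[OF IJ(2) J IJ(3) ps] show "x \<in> stable_locus n \<chi> \<union> ?F"
  proof
    assume "extremal_weight I > 0 \<and> extremal_weight J < 0"
    then show ?thesis
      unfolding stable_locus_def using ps strictly_between_finite_stabilizer[OF IJ(2) J IJ(3)] by blast
  qed blast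
next
  fix x assume "x \<in> stable_locus n \<chi> \<union> ?F"
  then show "x \<in> polystable_locus n \<chi>"
    using fixed_point_polystable unfolding stable_locus_def by blast
qed

end

theorem lemma3p2:
  fixes n :: nat and \<chi> :: "nat \<Rightarrow> int"
  assumes "n \<ge> 2"
    and "\<chi> \<in> root_lattice n"
    and "regular_dominant n \<chi>"
  defines "a \<equiv> \<lambda>I. pairing n (weyl_act n (longest n I) \<chi>)"
  defines "Pss \<equiv> {(I, J). J \<subseteq> I \<and> I \<subseteq> simple_roots n \<and> a I \<ge> 0 \<and> a J \<le> 0}"
    and "Ps \<equiv> {(I, J). J \<subseteq> I \<and> I \<subseteq> simple_roots n \<and> a I > 0 \<and> a J < 0}"
    and "Z \<equiv> {I. I \<subseteq> simple_roots n \<and> a I = 0}"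
  shows
    "semistable_locus n \<chi> = (\<Union>(I, J)\<in>Pss. Y0 n I J) \<and>
       disjoint_family_on (\<lambda>(I, J). Y0 n I J) Pss \<and>
     stable_locus n \<chi> = (\<Union>(I, J)\<in>Ps. Y0 n I J) \<and>
       disjoint_family_on (\<lambda>(I, J). Y0 n I J) Ps \<and>
     polystable_locus n \<chi> = stable_locus n \<chi> \<union> (\<Union>I\<in>Z. {fixed_point n I}) \<and>
       stable_locus n \<chi> \<inter> (\<Union>I\<in>Z. {fixed_point n I}) = {} \<and>
       disjoint_family_on (\<lambda>I. {fixed_point n I}) Z \<and>
     (\<forall>I \<subseteq> simple_roots n. Y0 n I I = {fixed_point n I}) \<and>
     polystable_locus n \<chi> = stable_locus n \<chi> \<union> (\<Union>I\<in>Z. Y0 n I I) \<and>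
       stable_locus n \<chi> \<inter> (\<Union>I\<in>Z. Y0 n I I) = {} \<and>
       disjoint_family_on (\<lambda>I. Y0 n I I) Z"
proof -
  note dom = assms(3)
  have n: "n \<ge> 1" using assms(1) by simp
  have disj: "disjoint_family_on (\<lambda>(I, J). Y0 n I J) S"
    if S: "\<And>I J. (I, J) \<in> S \<Longrightarrow> J \<subseteq> I \<and> I \<subseteq> simple_roots n" for S
    unfolding disjoint_family_on_def
  proof (intro ballI impI)
    fix p q assume pq: "p \<in> S" "q \<in> S" "p \<noteq> q"
    obtain I J where p: "p = (I, J)" by force
    obtain I' J' where q: "q = (I', J')" by force
    have IJ: "I \<subseteq> simple_roots n" "J \<subseteq> simple_roots n" "I' \<subseteq> simple_roots n" "J' \<subseteq> simple_roots n"
      using S[of I J] S[of I' J'] pq p q by blast+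
    have "Y0 n I J \<inter> Y0 n I' J' = {}"
      using Y0_disjoint[OF IJ] pq(3) unfolding p q by blast
    then show "(case p of (I, J) \<Rightarrow> Y0 n I J) \<inter> (case q of (I, J) \<Rightarrow> Y0 n I J) = {}"
      unfolding p q prod.case .
  qed
  have diag: "Y0 n I I = {fixed_point n I}" if "I \<subseteq> simple_roots n" for I
    by (rule Y0_diagonal[OF that])
  have Z: "I \<subseteq> simple_roots n" if "I \<in> Z" for I using that by (simp add: Z_def)
  have fix_inj: "I = J" if "I \<in> Z" "J \<in> Z" "fixed_point n I = fixed_point n J" for I J
    using Y0_disjoint[OF Z Z Z Z, OF that(1,1,2,2), of "fixed_point n I"] diag[OF Z] that by blast
  have ss: "semistable_locus n \<chi> = (\<Union>(I, J)\<in>Pss. Y0 n I J)"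
    unfolding Pss_def a_def by (rule semistable_locus_eq[OF dom])
  have st: "stable_locus n \<chi> = (\<Union>(I, J)\<in>Ps. Y0 n I J)"
    unfolding Ps_def a_def by (rule stable_locus_eq[OF dom n])
  have ps: "polystable_locus n \<chi> = stable_locus n \<chi> \<union> (\<Union>I\<in>Z. {fixed_point n I})"
    unfolding Z_def a_def by (rule polystable_locus_eq[OF dom n])
  have cap: "stable_locus n \<chi> \<inter> (\<Union>I\<in>Z. {fixed_point n I}) = {}"
    unfolding stable_locus_def using fixed_point_infinite_stabilizer[OF dom n Z] by blast
  have fd: "disjoint_family_on (\<lambda>I. {fixed_point n I}) Z"
    using fix_inj unfolding disjoint_family_on_def by blast
  have YZ: "(\<Union>I\<in>Z. Y0 n I I) = (\<Union>I\<in>Z. {fixed_point n I})"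
    using diag Z by (intro SUP_cong) auto
  have Yd: "disjoint_family_on (\<lambda>I. Y0 n I I) Z"
    using fd diag[OF Z] unfolding disjoint_family_on_def by metis
  have d1: "disjoint_family_on (\<lambda>(I, J). Y0 n I J) Pss"
    by (rule disj) (simp add: Pss_def)
  have d2: "disjoint_family_on (\<lambda>(I, J). Y0 n I J) Ps"
    by (rule disj) (simp add: Ps_def)
  show ?thesis
    unfolding YZ using ss st ps cap fd Yd d1 d2 diag by (intro conjI allI impI)
qed

end
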